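(* For any countable group $G$ there exists a non-degenerate probability measure $\mu$ on $G$ (which can be chosen to be symmetric and to have a finite entropy) such that for almost every point of the Poisson boundary $\partial_\mu G$ its stabilizer is the hyper-FC-centre $\mathrm{FC}_{\lim}(G)$ of the group $G$.
   Context: The FC-centre $\mathrm{FC}(G)$ of a group $G$ is the normal subgroup which is the union of all finite conjugacy classes. The transfinite upper FC-central series is defined by $\mathrm{FC}_0(G)=\{e\}$, $\mathrm{FC}_{\alpha+1}(G)$ is the preimage in $G$ of $\mathrm{FC}(G/\mathrm{FC}_\alpha(G))$, and $\mathrm{FC}_\alpha(G)=\bigcup_{\beta<\alpha}\mathrm{FC}_\beta(G)$ for limit ordinals $\alpha$. The hyper-FC-centre is $\mathrm{FC}_{\lim}(G)=\bigcup_\alpha\mathrm{FC}_\alpha(G)$, the union being over all ordinals. A probability measure $\mu$ on $G$ is non-degenerate if its support generates $G$ as a semigroup, symmetric if $\mu(g)=\mu(g^{-1})$ for all $g$, and of finite entropy if $-\sum_g\mu(g)\log\mu(g)<\infty$. The random walk $(G,\mu)$ is the Markov chain on $G$ with transitions $g\mapsto gh$, $h$ sampled from $\mu$; its sample paths are $\boldsymbol y=(y_0,y_1,\dots)$ with $y_n=y_0x_1\cdots x_n$, where $(x_n)$ are independent and $\mu$-distributed. $\mathbf P_g$ is the measure on $G^{\mathbb Z_+}$ for the starting point $y_0=g$, and $\mathbf P_\#=\sum_{g\in G}\mathbf P_g$. Let $T$ be the time shift on $G^{\mathbb Z_+}$. The exit $\sigma$-algebra consists of all measurable subsets of $(G^{\mathbb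 Z_+},\mathbf P_\#)$ that are ($\mathbf P_\#$-mod 0) $T$-invariant, i.e., unions of classes of the relation $\boldsymbol y\sim\boldsymbol y'\iff T^n\boldsymbol y=T^{n'}\boldsymbol y'$ for some $n,n'\ge0$. The Poisson boundary $\partial_\mu G$ is the corresponding quotient measure space, with quotient map $\operatorname{bnd}$ and harmonic measures $\nu_g=\operatorname{bnd}\mathbf P_g$. "Almost every" point of $\partial_\mu G$ refers to the common class of the measures $\sum_g\theta(g)\nu_g$, where $\theta$ is a probability measure with full support on $G$. The coordinate-wise left action of $G$ on paths descends to an action on $\partial_\mu G$ preserving this measure class. The stabilizer of $\zeta\in\partial_\mu G$ is $\{g\in G: g\zeta=\zeta\}$. *)

theory Defs
  imports "HOL-Algebra.Coset" "HOL-Probability.Probability"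
begin

section \<open>The upper FC-central series\<close>

definition FC_centre :: "('a, 'b) monoid_scheme \<Rightarrow> 'a set" where
  "FC_centre G = {g \<in> carrier G. finite {x \<otimes>\<^bsub>G\<^esub> g \<otimes>\<^bsub>G\<^esub> inv\<^bsub>G\<^esub> x | x. x \<in> carrier G}}"

definition FC_next :: "('a, 'b) monoid_scheme \<Rightarrow> 'a set \<Rightarrow> 'a set" where
  "FC_next G N = {g \<in> carrier G. N #>\<^bsub>G\<^esub> g \<in> FC_centre (G Mod N)}"

text \<open>
  Ordinals are represented by the elements of the field of a well-order \<open>r\<close>
  (an element stands for the order type of its set of strict predecessors \<open>underS r a\<close>).
\<close>

definition immediate_pred :: "'i rel \<Rightarrow> 'i \<Rightarrow> 'i \<Rightarrow> bool" where
  "immediate_pred r b a \<longleftrightarrow> b \<in> underS r a \<and> (\<forall>c \<in> underS r a. (c, b) \<in> r)"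

definition FC_rec ::
  "('a, 'b) monoid_scheme \<Rightarrow> 'i rel \<Rightarrow> ('i \<Rightarrow> 'a set) \<Rightarrow> 'i \<Rightarrow> 'a set" where
  "FC_rec G r F a =
     (if underS r a = {} then {\<one>\<^bsub>G\<^esub>}
      else if \<exists>b. immediate_pred r b a then FC_next G (F (THE b. immediate_pred r b a))
      else \<Union>b \<in> underS r a. F b)"

definition FC_series :: "('a, 'b) monoid_scheme \<Rightarrow> 'i rel \<Rightarrow> 'i \<Rightarrow> 'a set" where
  "FC_series G r = wo_rel.worec r (FC_rec G r)"

lemma FC_series_unfold:
  assumes "Well_order r"
  shows "FC_series G r a = FC_rec G r (FC_series G r) a"
proof -
  interpret W: wo_rel r using assms by (simp add: wo_rel_def)
  have pred: "(THE b. immediate_pred r b x) \<in> underS r x" if "\<exists>b. immediate_pred r b x" for x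
  proof -
    from that obtain b where b: "immediate_pred r b x" by blast
    have "(THE b. immediate_pred r b x) = b"
      using b W.ANTISYM by (intro the_equality) (auto simp: immediate_pred_def antisym_def)
    then show ?thesis using b by (simp add: immediate_pred_def)
  qed
  have "W.adm_wo (FC_rec G r)"
    unfolding W.adm_wo_def
  proof (intro allI impI)
    fix f g :: "'a \<Rightarrow> 'b set" and x
    assume eq: "\<forall>y \<in> underS r x. f y = g y"
    show "FC_rec G r f x = FC_rec G r g x"
      using eq pred[of x] by (auto simp: FC_rec_def)
  qed
  from W.worec_fixpoint[OF this] show ?thesis
    by (simp add: FC_series_def fun_eq_iff)
qed

lemma FC_series_zero:
  "Well_order r \<Longrightarrow> underS r a = {} \<Longrightarrow> FC_series G r a = {\<one>\<^bsub>G\<^esub>}"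
  by (subst FC_series_unfold) (auto simp: FC_rec_def)

lemma FC_series_succ:
  assumes "Well_order r" "immediate_pred r b a"
  shows "FC_series G r a = FC_next G (FC_series G r b)"
proof -
  interpret W: wo_rel r using assms by (simp add: wo_rel_def)
  have "(THE b. immediate_pred r b a) = b"
    using assms(2) W.ANTISYM by (intro the_equality) (auto simp: immediate_pred_def antisym_def)
  then show ?thesis
    using assms(2)
    by (subst FC_series_unfold[OF assms(1)]) (auto simp: FC_rec_def immediate_pred_def)
qed

lemma FC_series_limit:
  "Well_order r \<Longrightarrow> underS r a \<noteq> {} \<Longrightarrow> (\<nexists>b. immediate_pred r b a) \<Longrightarrow>
   FC_series G r a = (\<Union>b \<in> underS r a. FC_series G r b)"
  by (subst FC_series_unfold) (auto simp: FC_rec_def)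

text \<open>
  Every term of the series is contained in the type \<open>'a\<close>, so the increasing series is constant from
  an ordinal of cardinality at most \<open>|'a|\<close> on.  Hence all its terms occur already at
  the ordinals that are represented in well-orders on the larger type \<open>'a set\<close>.
\<close>

definition hyper_FC_centre :: "('a, 'b) monoid_scheme \<Rightarrow> 'a set" where
  "hyper_FC_centre G = (\<Union>r \<in> {r :: 'a set rel. Well_order r}. \<Union>a \<in> Field r. FC_series G r a)"


section \<open>Random walks\<close>

inductive_set semigroup_generate :: "('a, 'b) monoid_scheme \<Rightarrow> 'a set \<Rightarrow> 'a set"
  for G and S where
  incl: "s \<in> S \<Longrightarrow> s \<in> semigroup_generate G S"
| mult: "s \<in> semigroup_generate G S \<Longrightarrow> t \<in> semigroup_generate G S \<Longrightarrow>
         s \<otimes>\<^bsub>G\<^esub> t \<in> semigroup_generate G S"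

definition nondegenerate :: "('a, 'b) monoid_scheme \<Rightarrow> 'a pmf \<Rightarrow> bool" where
  "nondegenerate G \<mu> \<longleftrightarrow> semigroup_generate G (set_pmf \<mu>) = carrier G"

definition symmetric_pmf :: "('a, 'b) monoid_scheme \<Rightarrow> 'a pmf \<Rightarrow> bool" where
  "symmetric_pmf G \<mu> \<longleftrightarrow> (\<forall>g \<in> carrier G. pmf \<mu> g = pmf \<mu> (inv\<^bsub>G\<^esub> g))"

text \<open>All summands are nonnegative, and \<open>0 * ln 0 = 0\<close>.\<close>

definition finite_entropy :: "('a, 'b) monoid_scheme \<Rightarrow> 'a pmf \<Rightarrow> bool" where
  "finite_entropy G \<mu> \<longleftrightarrow> (\<lambda>g. - (pmf \<mu> g * ln (pmf \<mu> g))) summable_on carrier G"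

definition path_space :: "('a, 'b) monoid_scheme \<Rightarrow> (nat \<Rightarrow> 'a) measure" where
  "path_space G = (\<Pi>\<^sub>M n\<in>UNIV. count_space (carrier G))"

text \<open>The increment \<open>x n\<close> is applied at time \<open>n + 1\<close>, i.e. it is the increment with index \<open>n + 1\<close>.\<close>

primrec walk :: "('a, 'b) monoid_scheme \<Rightarrow> 'a \<Rightarrow> (nat \<Rightarrow> 'a) \<Rightarrow> nat \<Rightarrow> 'a" where
  "walk G g x 0 = g"
| "walk G g x (Suc n) = walk G g x n \<otimes>\<^bsub>G\<^esub> x n"

definition increments :: "('a, 'b) monoid_scheme \<Rightarrow> 'a pmf \<Rightarrow> (nat \<Rightarrow> 'a) measure" where
  "increments G \<mu> = (\<Pi>\<^sub>M n\<in>UNIV. restrict_space (measure_pmf \<mu>) (carrier G))"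

definition path_measure :: "('a, 'b) monoid_scheme \<Rightarrow> 'a pmf \<Rightarrow> 'a \<Rightarrow> (nat \<Rightarrow> 'a) measure" where
  "path_measure G \<mu> g = distr (increments G \<mu>) (path_space G) (walk G g)"

text \<open>The measure \<open>\<Sum>i\<in>I. w i * N i\<close> on the measurable space \<open>M\<close>.\<close>

definition weighted_sum ::
  "'x measure \<Rightarrow> 'i set \<Rightarrow> ('i \<Rightarrow> ennreal) \<Rightarrow> ('i \<Rightarrow> 'x measure) \<Rightarrow> 'x measure" where
  "weighted_sum M I w N =
     measure_of (space M) (sets M) (\<lambda>A. \<integral>\<^sup>+ i. w i * emeasure (N i) A \<partial>count_space I)"

definition path_measure_sum :: "('a, 'b) monoid_scheme \<Rightarrow> 'a pmf \<Rightarrow> (nat \<Rightarrow> 'a) measure" where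
  "path_measure_sum G \<mu> = weighted_sum (path_space G) (carrier G) (\<lambda>_. 1) (path_measure G \<mu>)"


section \<open>The Poisson boundary\<close>

definition path_shift :: "(nat \<Rightarrow> 'a) \<Rightarrow> nat \<Rightarrow> 'a" where
  "path_shift y = (\<lambda>n. y (Suc n))"

definition left_mult :: "('a, 'b) monoid_scheme \<Rightarrow> 'a \<Rightarrow> (nat \<Rightarrow> 'a) \<Rightarrow> nat \<Rightarrow> 'a" where
  "left_mult G g y = (\<lambda>n. g \<otimes>\<^bsub>G\<^esub> y n)"

definition exit_sets :: "('a, 'b) monoid_scheme \<Rightarrow> 'a pmf \<Rightarrow> (nat \<Rightarrow> 'a) set set" where
  "exit_sets G \<mu> =
     {A \<in> sets (path_space G). AE y in path_measure_sum G \<mu>. path_shift y \<in> A \<longleftrightarrow> y \<in> A}"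

text \<open>
  The quotient by the exit \<open>\<sigma>\<close>-algebra is taken in the category of Lebesgue spaces: it is a standard
  Borel space with a map \<open>bnd\<close> such that the preimages of measurable sets are, up to null sets,
  exactly the exit sets.  (It is not the set of classes of the tail relation, which need not be
  countably separated.)  It is unique only up to isomorphism modulo null sets, so the locale
  describes all its realizations.  As every standard Borel space is isomorphic to a Borel subset of
  the real line, only such subsets are considered.

  Likewise, the left action on the boundary is the one induced from the path space modulo null
  sets; its values on null sets are arbitrary.
\<close>

locale poisson_boundary =
  fixes G :: "('a, 'b) monoid_scheme" (structure)
    and \<mu> :: "'a pmf"
    and X :: "real measure"
    and bnd :: "(nat \<Rightarrow> 'a) \<Rightarrow> real"
    and act :: "'a \<Rightarrow> real \<Rightarrow> real"
  assumes space_borel: "space X \<in> sets borel"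
    and sets_borel: "sets X = sets (restrict_space borel (space X))"
    and bnd_measurable: "bnd \<in> path_space G \<rightarrow>\<^sub>M X"
    and bnd_exit: "B \<in> sets X \<Longrightarrow> bnd -` B \<inter> space (path_space G) \<in> exit_sets G \<mu>"
    and exit_bnd: "A \<in> exit_sets G \<mu> \<Longrightarrow>
      \<exists>B \<in> sets X. AE y in path_measure_sum G \<mu>. y \<in> A \<longleftrightarrow> bnd y \<in> B"
    and act_measurable: "g \<in> carrier G \<Longrightarrow> act g \<in> X \<rightarrow>\<^sub>M X"
    and act_bnd: "g \<in> carrier G \<Longrightarrow>
      AE y in path_measure_sum G \<mu>. act g (bnd y) = bnd (left_mult G g y)"

definition harmonic_measure ::
  "('a, 'b) monoid_scheme \<Rightarrow> 'a pmf \<Rightarrow> real measure \<Rightarrow> ((nat \<Rightarrow> 'a) \<Rightarrow> real) \<Rightarrow> 'a \<Rightarrow> real measure"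
where
  "harmonic_measure G \<mu> X bnd g = distr (path_measure G \<mu> g) X bnd"

definition boundary_measure ::
  "('a, 'b) monoid_scheme \<Rightarrow> 'a pmf \<Rightarrow> real measure \<Rightarrow> ((nat \<Rightarrow> 'a) \<Rightarrow> real) \<Rightarrow> 'a pmf \<Rightarrow> real measure"
where
  "boundary_measure G \<mu> X bnd \<theta> =
     weighted_sum X (carrier G) (\<lambda>g. ennreal (pmf \<theta> g)) (harmonic_measure G \<mu> X bnd)"

definition boundary_stabilizer ::
  "('a, 'b) monoid_scheme \<Rightarrow> ('a \<Rightarrow> real \<Rightarrow> real) \<Rightarrow> real \<Rightarrow> 'a set" where
  "boundary_stabilizer G act \<zeta> = {g \<in> carrier G. act g \<zeta> = \<zeta>}"


section \<open>Existence of the Poisson boundary\<close>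

lemma space_weighted_sum [simp]: "space (weighted_sum M I w N) = space M"
  and sets_weighted_sum [simp, measurable_cong]: "sets (weighted_sum M I w N) = sets M"
  by (simp_all add: weighted_sum_def)

lemma emeasure_weighted_sum:
  assumes "\<And>i. i \<in> I \<Longrightarrow> sets (N i) = sets M" and "A \<in> sets M"
  shows "emeasure (weighted_sum M I w N) A = (\<integral>\<^sup>+ i. w i * emeasure (N i) A \<partial>count_space I)"
proof (rule emeasure_measure_of[OF weighted_sum_def])
  show "sets M \<subseteq> Pow (space M)" by (rule sets.space_closed)
  show "A \<in> sets (weighted_sum M I w N)" using assms by simp
  show "positive (sets (weighted_sum M I w N)) (\<lambda>A. \<integral>\<^sup>+ i. w i * emeasure (N i) A \<partial>count_space I)"
    by (simp add: positive_def)
  show "countably_additive (sets (weighted_sum M I w N))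
          (\<lambda>A. \<integral>\<^sup>+ i. w i * emeasure (N i) A \<partial>count_space I)"
  proof (rule countably_additiveI)
    fix A :: "nat \<Rightarrow> _"
    assume A: "range A \<subseteq> sets (weighted_sum M I w N)" "disjoint_family A"
    have "(\<Sum>n. \<integral>\<^sup>+ i. w i * emeasure (N i) (A n) \<partial>count_space I) =
          (\<integral>\<^sup>+ i. (\<Sum>n. w i * emeasure (N i) (A n)) \<partial>count_space I)"
      by (rule nn_integral_suminf[symmetric]) auto
    also have "\<dots> = (\<integral>\<^sup>+ i. w i * emeasure (N i) (\<Union>n. A n) \<partial>count_space I)"
      using A assms(1) by (intro nn_integral_cong) (auto simp: suminf_emeasure)
    finally show "(\<Sum>n. \<integral>\<^sup>+ i. w i * emeasure (N i) (A n) \<partial>count_space I) =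
      (\<integral>\<^sup>+ i. w i * emeasure (N i) (\<Union>n. A n) \<partial>count_space I)" .
  qed
qed

lemma null_sets_weighted_sum:
  assumes "\<And>i. i \<in> I \<Longrightarrow> sets (N i) = sets M"
  shows "A \<in> null_sets (weighted_sum M I w N) \<longleftrightarrow>
         A \<in> sets M \<and> (\<forall>i \<in> I. w i \<noteq> 0 \<longrightarrow> A \<in> null_sets (N i))"
  using assms
  by (auto simp: null_sets_def emeasure_weighted_sum nn_integral_0_iff_AE AE_count_space)

lemma AE_weighted_sum:
  assumes sets: "\<And>i. i \<in> I \<Longrightarrow> sets (N i) = sets M" and I: "countable I"
  shows "(AE x in weighted_sum M I w N. Q x) \<longleftrightarrow> (\<forall>i \<in> I. w i \<noteq> 0 \<longrightarrow> (AE x in N i. Q x))"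
proof safe
  have space: "space (N i) = space M" if "i \<in> I" for i
    using sets[OF that] by (rule sets_eq_imp_space_eq)
  {
    fix i assume *: "AE x in weighted_sum M I w N. Q x" and i: "i \<in> I" "w i \<noteq> 0"
    from * obtain B where "B \<in> null_sets (weighted_sum M I w N)" and B: "{x \<in> space M. \<not> Q x} \<subseteq> B"
      unfolding eventually_ae_filter space_weighted_sum by blast
    then have "B \<in> null_sets (N i)"
      using i null_sets_weighted_sum[of I N M B w, OF sets] by blast
    then show "AE x in N i. Q x"
      using B space[OF i(1)] by (intro AE_I'[of B]) auto
  }
  assume *: "\<forall>i \<in> I. w i \<noteq> 0 \<longrightarrow> (AE x in N i. Q x)"
  define J where "J = {i \<in> I. w i \<noteq> 0}"
  have "\<forall>i \<in> J. \<exists>B \<in> null_sets (N i). {x \<in> space M. \<not> Q x} \<subseteq> B"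
    using * space by (fastforce simp: J_def eventually_ae_filter)
  then obtain B where B: "\<And>i. i \<in> J \<Longrightarrow> B i \<in> null_sets (N i)"
    "\<And>i. i \<in> J \<Longrightarrow> {x \<in> space M. \<not> Q x} \<subseteq> B i" by metis
  have BM: "B i \<in> sets M" if "i \<in> J" for i
    using B(1)[OF that] sets that by (auto simp: J_def)
  define C where "C = space M \<inter> (\<Inter>i \<in> J. B i)"
  have CM: "C \<in> sets M"
  proof (cases "J = {}")
    case False
    have "(\<Inter>i \<in> J. B i) \<in> sets M"
      using BM False I by (intro sets.countable_INT') (auto simp: J_def)
    then show ?thesis by (simp add: C_def)
  qed (simp add: C_def)
  have "C \<in> null_sets (N i)" if "i \<in> J" for i
  proof (rule null_sets_subset[OF B(1)[OF that]])
    show "C \<in> sets (N i)" using CM sets[of i] that by (simp add: J_def)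
    show "C \<subseteq> B i" using that by (auto simp: C_def)
  qed
  then have "C \<in> null_sets (weighted_sum M I w N)"
    using CM null_sets_weighted_sum[of I N M C w, OF sets] unfolding J_def by blast
  moreover have "{x \<in> space M. \<not> Q x} \<subseteq> C"
    using B(2) by (auto simp: C_def)
  ultimately show "AE x in weighted_sum M I w N. Q x"
    by (intro AE_I'[of C]) auto
qed

lemma countable_dense_sets:
  fixes Q :: "'x measure"
  assumes "finite_measure Q" and gen: "sets Q = sigma_sets (space Q) K" and K: "countable K"
  shows "\<exists>D. countable D \<and> D \<subseteq> sets Q \<and>
           (\<forall>A \<in> sets Q. \<forall>e > 0. \<exists>C \<in> D. measure Q (sym_diff A C) < e)"
proof -
  interpret finite_measure Q by fact
  define F where "F = rec_nat (insert {} K)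
     (\<lambda>_ S. S \<union> (\<lambda>A. space Q - A) ` S \<union> (\<lambda>(A, B). A \<union> B) ` (S \<times> S))"
  have F0: "F 0 = insert {} K" and
    FS: "F (Suc n) = F n \<union> (\<lambda>A. space Q - A) ` F n \<union> (\<lambda>(A, B). A \<union> B) ` (F n \<times> F n)" for n
    by (simp_all add: F_def)
  define D where "D = (\<Union>n. F n)"
  have "countable (F n)" for n
    by (induction n) (auto simp: F0 FS K)
  then have "countable D" by (simp add: D_def)
  have "F n \<subseteq> sets Q" for n
  proof (induction n)
    case 0
    show ?case by (auto simp: F0 gen intro: sigma_sets.intros)
  qed (auto simp: FS)
  then have DQ: "D \<subseteq> sets Q" by (auto simp: D_def)
  have mono: "F m \<subseteq> F n" if "m \<le> n" for m n
    using that by (induction rule: dec_induct) (auto simp: FS)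
  have Dc: "space Q - A \<in> D" if "A \<in> D" for A
    using that FS unfolding D_def by blast
  have Du: "A \<union> B \<in> D" if AB: "A \<in> D" "B \<in> D" for A B
  proof -
    from AB obtain m n where "A \<in> F m" "B \<in> F n" by (auto simp: D_def)
    then have "A \<in> F (max m n)" "B \<in> F (max m n)"
      using mono[of m "max m n"] mono[of n "max m n"] by auto
    then have "A \<union> B \<in> F (Suc (max m n))" unfolding FS by blast
    then show ?thesis by (auto simp: D_def)
  qed
  have De: "{} \<in> D" using F0 by (auto simp: D_def)
  have "\<forall>e > 0. \<exists>C \<in> D. measure Q (sym_diff A C) < e" if "A \<in> sigma_sets (space Q) K" for A
    using that
  proof induction
    case (Basic A)
    then have "A \<in> D" using F0 unfolding D_def by blast
    then show ?case by (intro allI impI bexI[of _ A]) auto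
  next
    case Empty
    show ?case using De by (intro allI impI bexI[of _ "{}"]) auto
  next
    case (Compl A)
    have "A \<subseteq> space Q" using Compl gen sets.sets_into_space by metis
    show ?case
    proof (intro allI impI)
      fix e :: real assume "e > 0"
      with Compl obtain C where C: "C \<in> D" "measure Q (sym_diff A C) < e" by blast
      have "C \<subseteq> space Q" using C(1) DQ sets.sets_into_space by blast
      then have "sym_diff (space Q - A) (space Q - C) = sym_diff A C"
        using \<open>A \<subseteq> space Q\<close> by blast
      with C Dc show "\<exists>C\<in>D. measure Q (sym_diff (space Q - A) C) < e"
        by (intro bexI[of _ "space Q - C"]) auto
    qed
  next
    case (Union A)
    have AQ: "A i \<in> sets Q" for i using Union gen by simp
    show ?case
    proof (intro allI impI)
      fix e :: real assume e: "e > 0"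
      have "(\<lambda>n. measure Q (\<Union>i<n. A i)) \<longlonglongrightarrow> measure Q (\<Union>n. \<Union>i<n. A i)"
        using AQ by (intro finite_Lim_measure_incseq) (auto simp: incseq_def intro: less_le_trans)
      moreover have "(\<Union>n. \<Union>i<n. A i) = (\<Union>i. A i)" by auto
      ultimately have "(\<lambda>n. measure Q (\<Union>i<n. A i)) \<longlonglongrightarrow> measure Q (\<Union>i. A i)" by simp
      then obtain n where n: "dist (measure Q (\<Union>i<n. A i)) (measure Q (\<Union>i. A i)) < e / 2"
        using e by (metis half_gt_zero lim_sequentially order_refl)
      have "measure Q ((\<Union>i. A i) - (\<Union>i<n. A i)) = measure Q (\<Union>i. A i) - measure Q (\<Union>i<n. A i)"
        using AQ by (intro finite_measure_Diff) auto
      then have n': "measure Q ((\<Union>i. A i) - (\<Union>i<n. A i)) < e / 2"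
        using n by (simp only: dist_real_def)
      have "\<forall>d>0. \<exists>C \<in> D. measure Q (sym_diff (\<Union>i<n. A i) C) < d"
      proof (induction n)
        case 0
        show ?case using De by (intro allI impI bexI[of _ "{}"]) auto
      next
        case (Suc n)
        show ?case
        proof (intro allI impI)
          fix d :: real assume "d > 0"
          then have "d / 2 > 0" by simp
          with Suc obtain C where C: "C \<in> D" "measure Q (sym_diff (\<Union>i<n. A i) C) < d / 2" by blast
          from \<open>d / 2 > 0\<close> Union.IH[of n] obtain C' where
            C': "C' \<in> D" "measure Q (sym_diff (A n) C') < d / 2" by blast
          have [measurable]: "C \<in> sets Q" "C' \<in> sets Q" using C C' DQ by auto
          have "measure Q (sym_diff (\<Union>i<Suc n. A i) (C \<union> C')) \<le>
                measure Q (sym_diff (\<Union>i<n. A i) C \<union> sym_diff (A n) C')"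
            using AQ by (intro finite_measure_mono) (auto simp: lessThan_Suc)
          also have "\<dots> \<le> measure Q (sym_diff (\<Union>i<n. A i) C) + measure Q (sym_diff (A n) C')"
            using AQ by (intro measure_Un_le) auto
          also have "\<dots> < d" using C C' by simp
          finally show "\<exists>C\<in>D. measure Q (sym_diff (\<Union>i<Suc n. A i) C) < d"
            using Du C C' by blast
        qed
      qed
      moreover have "e / 2 > 0" using e by simp
      ultimately obtain C where C: "C \<in> D" "measure Q (sym_diff (\<Union>i<n. A i) C) < e / 2" by blast
      have [measurable]: "C \<in> sets Q" using C DQ by auto
      have "measure Q (sym_diff (\<Union>i. A i) C) \<le>
            measure Q (((\<Union>i. A i) - (\<Union>i<n. A i)) \<union> sym_diff (\<Union>i<n. A i) C)"
        using AQ by (intro finite_measure_mono) auto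
      also have "\<dots> \<le> measure Q ((\<Union>i. A i) - (\<Union>i<n. A i)) + measure Q (sym_diff (\<Union>i<n. A i) C)"
        using AQ by (intro measure_Un_le) auto
      also have "\<dots> < e" using C n' by simp
      finally show "\<exists>C\<in>D. measure Q (sym_diff (\<Union>i. A i) C) < e" using C by blast
    qed
  qed
  then show ?thesis using \<open>countable D\<close> DQ gen by auto
qed

lemma countable_dense_subfamily:
  fixes Q :: "'x measure"
  assumes "finite_measure Q" and gen: "sets Q = sigma_sets (space Q) K" and K: "countable K"
    and E: "E \<subseteq> sets Q" "E \<noteq> {}"
  shows "\<exists>S :: nat \<Rightarrow> 'x set. range S \<subseteq> E \<and>
           (\<forall>A \<in> E. \<exists>f. AE y in Q. y \<in> A \<longleftrightarrow> (\<exists>\<^sub>\<infinity>n::nat. y \<in> S (f n)))"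
proof -
  interpret finite_measure Q by fact
  obtain D where D: "countable D" "D \<subseteq> sets Q"
    "\<And>A e. A \<in> sets Q \<Longrightarrow> e > 0 \<Longrightarrow> \<exists>C \<in> D. measure Q (sym_diff A C) < e"
    using countable_dense_sets[OF assms(1-3)] by blast
  define pick where "pick C k = (SOME A. A \<in> E \<and>
     ((\<exists>A \<in> E. measure Q (sym_diff A C) < (1/2)^k) \<longrightarrow> measure Q (sym_diff A C) < (1/2)^k))"
    for C and k :: nat
  have pick: "pick C k \<in> E"
    "A \<in> E \<Longrightarrow> measure Q (sym_diff A C) < (1/2)^k \<Longrightarrow> measure Q (sym_diff (pick C k) C) < (1/2)^k"
    for A C k
  proof -
    have ex: "\<exists>A. A \<in> E \<and> ((\<exists>A \<in> E. measure Q (sym_diff A C) < (1/2)^k) \<longrightarrow>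
            measure Q (sym_diff A C) < (1/2)^k)"
      using E(2) by blast
    show "pick C k \<in> E" using someI_ex[OF ex] unfolding pick_def by blast
    show "A \<in> E \<Longrightarrow> measure Q (sym_diff A C) < (1/2)^k \<Longrightarrow>
      measure Q (sym_diff (pick C k) C) < (1/2)^k"
      using someI_ex[OF ex] unfolding pick_def by blast
  qed
  define R where "R = (\<lambda>(C, k). pick C k) ` (D \<times> UNIV)"
  have "countable R" using D(1) by (auto simp: R_def)
  have "D \<noteq> {}" using D(3)[of "{}" 1] by auto
  then have "R \<noteq> {}" by (auto simp: R_def)
  define S where "S = from_nat_into R"
  have S: "range S = R" unfolding S_def using \<open>R \<noteq> {}\<close> \<open>countable R\<close> by (rule range_from_nat_into)
  have "R \<subseteq> E" using pick by (auto simp: R_def)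
  have "\<exists>f. AE y in Q. y \<in> A \<longleftrightarrow> (\<exists>\<^sub>\<infinity>n::nat. y \<in> S (f n))" if A: "A \<in> E" for A
  proof -
    have AQ: "A \<in> sets Q" using A E by auto
    have "\<exists>i. measure Q (sym_diff A (S i)) < 2 * (1/2)^k" for k :: nat
    proof -
      obtain C where C: "C \<in> D" "measure Q (sym_diff A C) < (1/2)^k"
        using D(3)[OF AQ, of "(1/2)^k"] by auto
      have CQ: "C \<in> sets Q" using C D by auto
      have "pick C k \<in> sets Q" using pick(1) E(1) by blast
      have "measure Q (sym_diff A (pick C k)) \<le> measure Q (sym_diff A C \<union> sym_diff (pick C k) C)"
        using AQ CQ \<open>pick C k \<in> sets Q\<close> by (intro finite_measure_mono) auto
      also have "\<dots> \<le> measure Q (sym_diff A C) + measure Q (sym_diff (pick C k) C)"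
        using AQ CQ \<open>pick C k \<in> sets Q\<close> by (intro measure_Un_le) auto
      also have "\<dots> < 2 * (1/2)^k" using C(2) pick(2)[OF A C(2)] by simp
      finally have "measure Q (sym_diff A (pick C k)) < 2 * (1/2)^k" .
      moreover have "pick C k \<in> range S" using C(1) unfolding S R_def by force
      ultimately show ?thesis by (metis rangeE)
    qed
    then obtain f where f: "\<And>k. measure Q (sym_diff A (S (f k))) < 2 * (1/2)^k" by metis
    have SQ: "S i \<in> sets Q" for i using S \<open>R \<subseteq> E\<close> E by blast
    have "AE y in Q. eventually (\<lambda>k. y \<in> space Q - sym_diff A (S (f k))) sequentially"
    proof (rule borel_cantelli_AE1)
      show "sym_diff A (S (f k)) \<in> sets Q" for k using AQ SQ by auto
      show "emeasure Q (sym_diff A (S (f k))) < \<infinity>" for k by (simp add: less_top[symmetric])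
      show "summable (\<lambda>k. measure Q (sym_diff A (S (f k))))"
      proof (rule summable_comparison_test')
        show "summable (\<lambda>k. 2 * (1/2::real)^k)" by (intro summable_mult summable_geometric) simp
        show "norm (measure Q (sym_diff A (S (f k)))) \<le> 2 * (1/2)^k" if "k \<ge> 0" for k
          using f[of k] by simp
      qed
    qed
    then have "AE y in Q. y \<in> A \<longleftrightarrow> (\<exists>\<^sub>\<infinity>n::nat. y \<in> S (f n))"
    proof eventually_elim
      case (elim y)
      then have ev: "eventually (\<lambda>k. y \<in> A \<longleftrightarrow> y \<in> S (f k)) sequentially"
        by (auto elim!: eventually_mono)
      then obtain m where m: "\<And>k. k \<ge> m \<Longrightarrow> y \<in> A \<longleftrightarrow> y \<in> S (f k)"
        by (auto simp: eventually_sequentially)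
      show ?case
        unfolding INFM_nat_le using m by (meson nat_le_linear order_refl)
    qed
    then show ?thesis by blast
  qed
  with S \<open>R \<subseteq> E\<close> show ?thesis by blast
qed

text \<open>
  A countable family \<open>S\<close> of sets is turned into one real-valued map, which records membership in the
  sets \<open>S n\<close> as the digits 0 and 1 of a ternary expansion.
\<close>

definition code_real :: "(nat \<Rightarrow> 'y set) \<Rightarrow> 'y \<Rightarrow> real" where
  "code_real S y = (\<Sum>n. (1/3)^n * indicator (S n) y)"

primrec bit_tail :: "nat \<Rightarrow> real \<Rightarrow> real" where
  "bit_tail 0 x = x"
| "bit_tail (Suc n) x = 3 * (bit_tail n x - (if bit_tail n x \<ge> 1 then 1 else 0))"

lemma bit_tail_measurable [measurable]: "bit_tail n \<in> borel_measurable borel"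
proof (induction n)
  case (Suc n)
  note [measurable] = Suc
  show ?case by simp
qed simp

lemma summable_code: "summable (\<lambda>n. (1/3::real)^n * indicator (S n) y)"
  by (rule summable_comparison_test'[of "\<lambda>n. (1/3)^n" 0])
     (auto simp: summable_geometric indicator_def)

lemma code_real_split: "code_real S y = indicator (S 0) y + code_real (\<lambda>n. S (Suc n)) y / 3"
proof -
  have "code_real S y = (\<Sum>n. (1/3)^Suc n * indicator (S (Suc n)) y) + indicator (S 0) y"
    unfolding code_real_def using suminf_split_head[OF summable_code[of S y]] by simp
  also have "(\<Sum>n. (1/3)^Suc n * indicator (S (Suc n)) y) =
             (1/3) * (\<Sum>n. (1/3)^n * indicator (S (Suc n)) y :: real)"
    by (subst suminf_mult[OF summable_code, symmetric]) (simp add: mult.assoc)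
  finally show ?thesis by (simp add: code_real_def)
qed

lemma code_real_bounds: "0 \<le> code_real S y" "code_real S y \<le> 3/2"
proof -
  show "0 \<le> code_real S y"
    unfolding code_real_def by (intro suminf_nonneg summable_code) simp
  have "code_real S y \<le> (\<Sum>n. (1/3)^n)"
    unfolding code_real_def
    by (intro suminf_le summable_code summable_geometric) (auto simp: indicator_def)
  also have "\<dots> = 3/2" by (subst suminf_geometric) auto
  finally show "code_real S y \<le> 3/2" .
qed

lemma code_real_ge_1: "code_real S y \<ge> 1 \<longleftrightarrow> y \<in> S 0"
  using code_real_split[of S y] code_real_bounds[of "\<lambda>n. S (Suc n)" y]
  by (auto simp: indicator_def)

lemma bit_tail_code: "bit_tail n (code_real S y) = code_real (\<lambda>k. S (k + n)) y"
proof (induction n)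
  case (Suc n)
  show ?case
    unfolding bit_tail.simps Suc code_real_ge_1
    using code_real_split[of "\<lambda>k. S (k + n)" y] by (auto simp: indicator_def)
qed simp

lemma bit_code: "bit_tail n (code_real S y) \<ge> 1 \<longleftrightarrow> y \<in> S n"
  by (simp add: bit_tail_code code_real_ge_1)

lemma code_real_cong: "(\<And>n. y \<in> S n \<longleftrightarrow> z \<in> S' n) \<Longrightarrow> code_real S y = code_real S' z"
  by (simp add: code_real_def indicator_def)

lemma code_real_measurable:
  assumes "\<And>n. S n \<in> sets M"
  shows "code_real S \<in> borel_measurable M"
  unfolding code_real_def using assms by measurable

lemma space_path_space: "space (path_space G) = {y. \<forall>n. y n \<in> carrier G}"
  by (auto simp: path_space_def space_PiM PiE_def)

lemma sets_path_measure [simp]: "sets (path_measure G \<mu> g) = sets (path_space G)"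
  by (simp add: path_measure_def)

lemma path_space_measurableI:
  assumes "\<And>n. (\<lambda>x. f x n) \<in> M \<rightarrow>\<^sub>M count_space (carrier G)"
  shows "f \<in> M \<rightarrow>\<^sub>M path_space G"
  unfolding path_space_def
proof (rule measurable_PiM_single')
  show "f \<in> space M \<rightarrow> (\<Pi>\<^sub>E n\<in>UNIV. space (count_space (carrier G)))"
    using measurable_space[OF assms] by auto
qed (use assms in auto)

lemma path_component [measurable]: "(\<lambda>y. y n) \<in> path_space G \<rightarrow>\<^sub>M count_space (carrier G)"
  unfolding path_space_def by measurable

lemma path_space_sets_generated:
  assumes "countable (carrier G)"
  shows "\<exists>K. countable K \<and> sets (path_space G) = sigma_sets (space (path_space G)) K"
proof -
  define K where "K = (\<lambda>(n, a). {y \<in> space (path_space G). y n = a}) ` (UNIV \<times> carrier G)"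
  have KP: "K \<subseteq> sets (path_space G)"
  proof -
    have "{y \<in> space (path_space G). y n = a} \<in> sets (path_space G)" if "a \<in> carrier G" for n a
    proof -
      have "(\<lambda>y. y n) -` {a} \<inter> space (path_space G) \<in> sets (path_space G)"
        using that by (intro measurable_sets[OF path_component]) auto
      moreover have "(\<lambda>y. y n) -` {a} \<inter> space (path_space G) =
         {y \<in> space (path_space G). y n = a}" by auto
      ultimately show ?thesis by simp
    qed
    then show ?thesis by (auto simp: K_def)
  qed
  let ?N = "sigma (space (path_space G)) K"
  have KPow: "K \<subseteq> Pow (space (path_space G))" by (auto simp: K_def)
  have sp: "space ?N = space (path_space G)" and se: "sets ?N = sigma_sets (space (path_space G)) K"
    using KPow by (simp_all add: sets_measure_of space_measure_of)
  have "(\<lambda>y. y) \<in> ?N \<rightarrow>\<^sub>M path_space G"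
  proof (rule path_space_measurableI)
    fix n
    show "(\<lambda>y. y n) \<in> ?N \<rightarrow>\<^sub>M count_space (carrier G)"
      unfolding measurable_count_space_eq_countable[OF assms]
    proof (intro conjI ballI)
      show "(\<lambda>y. y n) \<in> space ?N \<rightarrow> carrier G"
        unfolding sp by (auto simp: space_path_space)
      fix a assume "a \<in> carrier G"
      then have "{y \<in> space (path_space G). y n = a} \<in> sets ?N"
        unfolding se by (intro sigma_sets.Basic) (auto simp: K_def)
      moreover have "(\<lambda>y. y n) -` {a} \<inter> space ?N = {y \<in> space (path_space G). y n = a}"
        unfolding sp by auto
      ultimately show "(\<lambda>y. y n) -` {a} \<inter> space ?N \<in> sets ?N" by simp
    qed
  qed
  then have "sets (path_space G) \<subseteq> sets ?N"
  proof -
    assume id: "(\<lambda>y. y) \<in> ?N \<rightarrow>\<^sub>M path_space G"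
    show ?thesis
    proof
      fix A assume A: "A \<in> sets (path_space G)"
      then have "(\<lambda>y. y) -` A \<inter> space ?N = A"
        unfolding sp using sets.sets_into_space by blast
      with measurable_sets[OF id A] show "A \<in> sets ?N" by simp
    qed
  qed
  moreover have "sigma_sets (space (path_space G)) K \<subseteq> sets (path_space G)"
    using KP by (rule sets.sigma_sets_subset)
  ultimately have "sets (path_space G) = sigma_sets (space (path_space G)) K"
    unfolding se by (rule equalityI)
  moreover have "countable K"
    unfolding K_def using assms by (intro countable_image countable_SIGMA) simp_all
  ultimately show ?thesis by blast
qed

context
  fixes G :: "('a, 'b) monoid_scheme" (structure) and \<mu> :: "'a pmf"
  assumes grp: "group G" and cnt: "countable (carrier G)" and supp: "set_pmf \<mu> \<subseteq> carrier G"
begin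

interpretation group G by (rule grp)

lemma prob_space_increment: "prob_space (restrict_space (measure_pmf \<mu>) (carrier G))"
proof (rule prob_spaceI)
  have "emeasure (measure_pmf \<mu>) (carrier G) = 1"
    using supp by (metis measure_pmf.emeasure_eq_1_AE AE_measure_pmf_iff UNIV_I sets_measure_pmf subsetD)
  then show "emeasure (restrict_space (measure_pmf \<mu>) (carrier G))
    (space (restrict_space (measure_pmf \<mu>) (carrier G))) = 1"
    by (simp add: space_restrict_space emeasure_restrict_space)
qed

lemma sets_increment:
  "sets (restrict_space (measure_pmf \<mu>) (carrier G)) = sets (count_space (carrier G))"
  by (auto simp: sets_restrict_space)

lemma sets_increments: "sets (increments G \<mu>) = sets (path_space G)"
  unfolding increments_def path_space_def by (intro sets_PiM_cong sets_increment) simp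

lemma prob_space_increments: "prob_space (increments G \<mu>)"
  unfolding increments_def by (intro prob_space_PiM prob_space_increment)

lemma walk_measurable:
  assumes "g \<in> carrier G"
  shows "walk G g \<in> increments G \<mu> \<rightarrow>\<^sub>M path_space G"
proof -
  have "walk G g \<in> path_space G \<rightarrow>\<^sub>M path_space G"
  proof (rule path_space_measurableI)
    fix n
    show "(\<lambda>x. walk G g x n) \<in> path_space G \<rightarrow>\<^sub>M count_space (carrier G)"
    proof (induction n)
      case 0
      then show ?case using assms by simp
    next
      case (Suc n)
      have "(\<lambda>x. (walk G g x n, x n)) \<in> path_space G \<rightarrow>\<^sub>M
              count_space (carrier G) \<Otimes>\<^sub>M count_space (carrier G)"
        using Suc path_component by (rule measurable_Pair)
      then have "(\<lambda>x. (walk G g x n, x n)) \<in> path_space G \<rightarrow>\<^sub>M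
              count_space (carrier G \<times> carrier G)"
        by (simp add: pair_measure_countable cnt)
      from measurable_compose[OF this, of "\<lambda>(a, b). a \<otimes> b" "count_space (carrier G)"]
      show ?case by (simp add: case_prod_beta Pi_iff)
    qed
  qed
  then show ?thesis by (simp cong: measurable_cong_sets add: sets_increments)
qed

lemma prob_space_path_measure: "g \<in> carrier G \<Longrightarrow> prob_space (path_measure G \<mu> g)"
  unfolding path_measure_def
  by (intro prob_space.prob_space_distr prob_space_increments walk_measurable)

lemma AE_path_measure_sum:
  "(AE y in path_measure_sum G \<mu>. Q y) \<longleftrightarrow> (\<forall>g \<in> carrier G. AE y in path_measure G \<mu> g. Q y)"
  unfolding path_measure_sum_def by (subst AE_weighted_sum) (auto simp: cnt)

lemma left_mult_measurable [measurable]: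
  assumes "g \<in> carrier G"
  shows "left_mult G g \<in> path_space G \<rightarrow>\<^sub>M path_space G"
proof (rule path_space_measurableI)
  fix n
  show "(\<lambda>y. left_mult G g y n) \<in> path_space G \<rightarrow>\<^sub>M count_space (carrier G)"
    unfolding left_mult_def
    using measurable_compose[OF path_component[of n G], where g = "\<lambda>a. g \<otimes> a" and L = "count_space (carrier G)"] assms
    by (simp add: Pi_iff)
qed

lemma walk_left_mult:
  assumes "g \<in> carrier G" "h \<in> carrier G" "\<And>n. x n \<in> carrier G"
  shows "walk G (g \<otimes> h) x n = g \<otimes> walk G h x n \<and> walk G h x n \<in> carrier G"
  by (induction n) (use assms in \<open>auto simp: m_assoc\<close>)

lemma distr_left_mult:
  assumes "g \<in> carrier G" "h \<in> carrier G"
  shows "distr (path_measure G \<mu> h) (path_space G) (left_mult G g) = path_measure G \<mu> (g \<otimes> h)"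
proof -
  have "distr (path_measure G \<mu> h) (path_space G) (left_mult G g) =
        distr (increments G \<mu>) (path_space G) (left_mult G g \<circ> walk G h)"
    unfolding path_measure_def
    using assms by (intro distr_distr left_mult_measurable walk_measurable)
  also have "\<dots> = path_measure G \<mu> (g \<otimes> h)"
    unfolding path_measure_def
  proof (rule distr_cong)
    fix x assume "x \<in> space (increments G \<mu>)"
    then have "x n \<in> carrier G" for n
      using sets_eq_imp_space_eq[OF sets_increments] by (auto simp: space_path_space)
    with walk_left_mult[OF assms, of x] show "(left_mult G g \<circ> walk G h) x = walk G (g \<otimes> h) x"
      by (auto simp: left_mult_def fun_eq_iff)
  qed simp_all
  finally show ?thesis .
qed

lemma AE_left_mult:
  assumes "g \<in> carrier G" "AE y in path_measure_sum G \<mu>. Q y"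
  shows "AE y in path_measure_sum G \<mu>. Q (left_mult G g y)"
  unfolding AE_path_measure_sum
proof
  fix h assume h: "h \<in> carrier G"
  have "AE y in distr (path_measure G \<mu> h) (path_space G) (left_mult G g). Q y"
    unfolding distr_left_mult[OF assms(1) h]
    using assms h by (auto simp: AE_path_measure_sum)
  moreover have "left_mult G g \<in> path_measure G \<mu> h \<rightarrow>\<^sub>M path_space G"
    using left_mult_measurable[OF assms(1)] by (simp cong: measurable_cong_sets)
  ultimately show "AE y in path_measure G \<mu> h. Q (left_mult G g y)" by (rule AE_distrD[rotated])
qed

lemma exit_left_mult:
  assumes "g \<in> carrier G" "A \<in> exit_sets G \<mu>"
  shows "left_mult G g -` A \<inter> space (path_space G) \<in> exit_sets G \<mu>"
proof -
  have "AE y in path_measure_sum G \<mu>. path_shift (left_mult G g y) \<in> A \<longleftrightarrow> left_mult G g y \<in> A"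
    using assms(2) by (intro AE_left_mult[OF assms(1)]) (simp add: exit_sets_def)
  moreover have "AE y in path_measure_sum G \<mu>. y \<in> space (path_space G)"
    using AE_space[of "path_measure_sum G \<mu>"] by (simp add: path_measure_sum_def)
  ultimately have "AE y in path_measure_sum G \<mu>.
     path_shift y \<in> left_mult G g -` A \<inter> space (path_space G) \<longleftrightarrow>
     y \<in> left_mult G g -` A \<inter> space (path_space G)"
    by eventually_elim (auto simp: path_shift_def left_mult_def space_path_space)
  then show ?thesis
    using measurable_sets[OF left_mult_measurable[OF assms(1)]] assms(2)
    by (auto simp: exit_sets_def)
qed


theorem poisson_boundary_exists: "\<exists>X bnd act. poisson_boundary G \<mu> X bnd act"
proof -
  define \<theta> where "\<theta> = map_pmf (from_nat_into (carrier G)) (geometric_pmf (1/2))"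
  have \<theta>: "set_pmf \<theta> = carrier G"
    using range_from_nat_into[OF carrier_not_empty cnt] by (simp add: \<theta>_def set_pmf_geometric)
  define Q where "Q = weighted_sum (path_space G) (carrier G) (\<lambda>g. ennreal (pmf \<theta> g)) (path_measure G \<mu>)"
  have spQ: "space Q = space (path_space G)" and seQ: "sets Q = sets (path_space G)"
    by (simp_all add: Q_def)
  have AEQ: "(AE y in Q. Z y) \<longleftrightarrow> (AE y in path_measure_sum G \<mu>. Z y)" for Z
    unfolding Q_def AE_path_measure_sum
    by (subst AE_weighted_sum) (use \<theta> set_pmf_iff[of _ \<theta>] in \<open>auto simp: cnt\<close>)
  have "finite_measure Q"
  proof (rule finite_measureI)
    have "emeasure Q (space Q) =
       (\<integral>\<^sup>+ g. ennreal (pmf \<theta> g) * emeasure (path_measure G \<mu> g) (space (path_space G)) \<partial>count_space (carrier G))"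
      unfolding spQ unfolding Q_def by (rule emeasure_weighted_sum) auto
    also have "\<dots> = (\<integral>\<^sup>+ g. ennreal (pmf \<theta> g) \<partial>count_space (carrier G))"
      using prob_space.emeasure_space_1[OF prob_space_path_measure]
      by (intro nn_integral_cong) (auto simp: path_measure_def)
    also have "\<dots> = emeasure (measure_pmf \<theta>) (carrier G)"
      by (simp add: nn_integral_pmf)
    finally show "emeasure Q (space Q) \<noteq> \<infinity>" by simp
  qed
  obtain K where K: "countable K" "sets (path_space G) = sigma_sets (space (path_space G)) K"
    using path_space_sets_generated[OF cnt] by blast
  have "exit_sets G \<mu> \<subseteq> sets Q" by (auto simp: exit_sets_def seQ)
  moreover have "exit_sets G \<mu> \<noteq> {}"
  proof -
    have "{} \<in> exit_sets G \<mu>" by (simp add: exit_sets_def)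
    then show ?thesis by blast
  qed
  moreover have "sets Q = sigma_sets (space Q) K" using K(2) spQ seQ by simp
  ultimately have "\<exists>S :: nat \<Rightarrow> (nat \<Rightarrow> 'a) set. range S \<subseteq> exit_sets G \<mu> \<and>
    (\<forall>A \<in> exit_sets G \<mu>. \<exists>f. AE y in Q. y \<in> A \<longleftrightarrow> (\<exists>\<^sub>\<infinity>n::nat. y \<in> S (f n)))"
    by (intro countable_dense_subfamily[OF \<open>finite_measure Q\<close> _ K(1)])
  then obtain S :: "nat \<Rightarrow> (nat \<Rightarrow> 'a) set" where S: "range S \<subseteq> exit_sets G \<mu>"
    and Sd: "\<And>A. A \<in> exit_sets G \<mu> \<Longrightarrow> \<exists>f. AE y in Q. y \<in> A \<longleftrightarrow> (\<exists>\<^sub>\<infinity>n::nat. y \<in> S (f n))"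
    by blast
  have SP: "S n \<in> sets (path_space G)" for n using S by (auto simp: exit_sets_def)
  define bnd where "bnd = code_real S"
  have bnd_meas: "bnd \<in> borel_measurable (path_space G)"
    unfolding bnd_def by (rule code_real_measurable) (rule SP)
  have exb: "\<exists>B \<in> sets borel. AE y in path_measure_sum G \<mu>. y \<in> A \<longleftrightarrow> bnd y \<in> B"
    if A: "A \<in> exit_sets G \<mu>" for A
  proof -
    obtain f where f: "AE y in Q. y \<in> A \<longleftrightarrow> (\<exists>\<^sub>\<infinity>n::nat. y \<in> S (f n))" using Sd[OF A] by blast
    define B where "B = {x. \<forall>m. \<exists>n\<ge>m. bit_tail (f n) x \<ge> 1}"
    have "{x \<in> space borel. \<forall>m. \<exists>n\<ge>m. bit_tail (f n) x \<ge> 1} \<in> sets borel" by measurable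
    then have "B \<in> sets borel" by (simp add: B_def)
    moreover have "AE y in path_measure_sum G \<mu>. y \<in> A \<longleftrightarrow> bnd y \<in> B"
      using f unfolding AEQ
      by eventually_elim (simp add: B_def bnd_def bit_code INFM_nat_le)
    ultimately show ?thesis by blast
  qed
  have "\<forall>g \<in> carrier G. \<forall>n. \<exists>B \<in> sets borel. AE y in path_measure_sum G \<mu>.
          y \<in> left_mult G g -` S n \<inter> space (path_space G) \<longleftrightarrow> bnd y \<in> B"
    using S by (intro ballI allI exb exit_left_mult) auto
  then obtain C where "\<forall>g \<in> carrier G. \<forall>n. C g n \<in> sets borel \<and>
        (AE y in path_measure_sum G \<mu>.
          y \<in> left_mult G g -` S n \<inter> space (path_space G) \<longleftrightarrow> bnd y \<in> C g n)"
    unfolding Bex_def bchoice_iff choice_iff by blast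
  then have C: "\<And>g n. g \<in> carrier G \<Longrightarrow> C g n \<in> sets borel"
    "\<And>g n. g \<in> carrier G \<Longrightarrow> AE y in path_measure_sum G \<mu>.
          y \<in> left_mult G g -` S n \<inter> space (path_space G) \<longleftrightarrow> bnd y \<in> C g n"
    by blast+
  define act where "act g = code_real (C g)" for g
  have "poisson_boundary G \<mu> borel bnd act"
  proof
    fix B :: "real set" assume "B \<in> sets borel"
    have "\<forall>n. AE y in path_measure_sum G \<mu>. path_shift y \<in> S n \<longleftrightarrow> y \<in> S n"
      using S by (auto simp: exit_sets_def)
    then have "AE y in path_measure_sum G \<mu>. \<forall>n. path_shift y \<in> S n \<longleftrightarrow> y \<in> S n"
      by (simp add: AE_all_countable)
    moreover have "AE y in path_measure_sum G \<mu>. y \<in> space (path_space G)"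
      using AE_space[of "path_measure_sum G \<mu>"] by (simp add: path_measure_sum_def)
    ultimately have "AE y in path_measure_sum G \<mu>.
      path_shift y \<in> bnd -` B \<inter> space (path_space G) \<longleftrightarrow> y \<in> bnd -` B \<inter> space (path_space G)"
    proof eventually_elim
      case (elim y)
      then have "bnd (path_shift y) = bnd y" unfolding bnd_def by (intro code_real_cong) auto
      with elim show ?case by (auto simp: space_path_space path_shift_def)
    qed
    then show "bnd -` B \<inter> space (path_space G) \<in> exit_sets G \<mu>"
      using measurable_sets[OF bnd_meas \<open>B \<in> sets borel\<close>] by (simp add: exit_sets_def)
  next
    fix g assume g: "g \<in> carrier G"
    show "act g \<in> borel_measurable borel"
      unfolding act_def using C(1)[OF g] by (rule code_real_measurable)
    have "AE y in path_measure_sum G \<mu>. \<forall>n.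
          y \<in> left_mult G g -` S n \<inter> space (path_space G) \<longleftrightarrow> bnd y \<in> C g n"
      using C(2)[OF g] by (simp add: AE_all_countable)
    moreover have "AE y in path_measure_sum G \<mu>. y \<in> space (path_space G)"
      using AE_space[of "path_measure_sum G \<mu>"] by (simp add: path_measure_sum_def)
    ultimately show "AE y in path_measure_sum G \<mu>. act g (bnd y) = bnd (left_mult G g y)"
    proof eventually_elim
      case (elim y)
      then show ?case unfolding act_def bnd_def[of] by (intro code_real_cong) auto
    qed
  qed (use bnd_meas exb in auto)
  then show ?thesis by blast
qed

end

end

theory Submission
  imports Defs "HOL-Real_Asymp.Real_Asymp"
begin

text \<open>
  Let \<open>H\<close> be the hyper-FC-centre of \<open>G\<close>. It is a normal subgroup with \<open>FC_next G H \<subseteq> H\<close>, so all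
  nontrivial conjugacy classes of \<open>Q = G/H\<close> are infinite. The measure \<open>\<mu>\<close> that is constructed here
  charges every element of \<open>G\<close>. Two things have to be shown.

  \<^emph>\<open>The subgroup \<open>H\<close> acts trivially.\<close> Along the random walk the mean square of a bounded harmonic
  function \<open>f\<close> increases by the mean squared increments of \<open>f\<close>, so these tend to zero. If \<open>f\<close> is
  invariant under \<open>N\<close> and \<open>z\<close> has finitely many conjugates modulo \<open>N\<close>, then \<open>f (z g) - f g\<close> is an
  increment \<open>f (g c) - f g\<close> with \<open>c\<close> in a finite set; being harmonic in \<open>g\<close>, this difference must
  vanish (\<open>harmonic_invariant_FC_next\<close>). Hence \<open>H\<close> leaves all bounded harmonic functions
  invariant. Since an exit set is determined modulo null sets by its harmonic function
  (\<open>exit_sets_eq_AE\<close>), \<open>H\<close> preserves all exit sets, and therefore fixes almost every boundary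
  point.

  \<^emph>\<open>Nothing else has fixed points.\<close> The increments of the walk have levels with a heavy tail:
  almost surely, from some time on, the highest level \<open>m\<close> among the first \<open>t\<close> increments is
  attained only once and is at least \<open>t\<close> (\<open>AE_eventually_record\<close>). The increments of level \<open>m\<close> are
  \<open>b m\<close> and its inverse, so that the position at time \<open>t\<close> is \<open>w \<otimes> b m \<otimes> v\<close> or \<open>w \<otimes> inv (b m) \<otimes> v\<close>,
  where \<open>w\<close> and \<open>v\<close> are words of bounded length in finitely many letters of lower level. In a
  group with infinite conjugacy classes the element \<open>b m\<close> can be chosen such that the product
  determines \<open>w\<close> (\<open>switching_exists\<close>). Calling \<open>w\<close> the parent of the product turns \<open>Q\<close> into a
  forest, and the path converges to an end of this forest: the position before a late record is an
  ancestor of all later positions. To descend ultimately from a given element is an exit event. A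
  translation by \<open>\<gamma>\<close> carries the late ancestors \<open>w\<close> of the path to ancestors \<open>\<gamma> \<otimes> w\<close> of the
  translated path. The two have the same level, so if \<open>\<gamma>\<close> is nontrivial in \<open>Q\<close>, then \<open>w\<close> is no
  ancestor of the translated path (\<open>records_separate\<close>). Thus the path and its translate have
  different boundary points.
\<close>


section \<open>The upper FC-central series\<close>

lemma finite_image_factor:
  assumes "finite (f ` S)" and "\<And>x y. x \<in> S \<Longrightarrow> y \<in> S \<Longrightarrow> f x = f y \<Longrightarrow> g x = g y"
  shows "finite (g ` S)"
proof -
  have "g ` S \<subseteq> (\<lambda>z. g (SOME x. x \<in> S \<and> f x = z)) ` (f ` S)"
  proof
    fix w assume "w \<in> g ` S"
    then obtain x where x: "x \<in> S" "w = g x" by blast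
    define x' where "x' = (SOME y. y \<in> S \<and> f y = f x)"
    have "x' \<in> S \<and> f x' = f x" unfolding x'_def by (rule someI[of _ x]) (use x in auto)
    then have "g x' = w" using assms(2)[of x' x] x by auto
    then show "w \<in> (\<lambda>z. g (SOME x. x \<in> S \<and> f x = z)) ` (f ` S)"
      using x unfolding x'_def by blast
  qed
  then show ?thesis using assms(1) by (meson finite_imageI finite_subset)
qed

context group
begin

lemma cancel_inv_left:
  assumes "x \<in> carrier G" "y \<in> carrier G"
  shows "inv x \<otimes> (x \<otimes> y) = y" "x \<otimes> (inv x \<otimes> y) = y"
  using assms by (simp_all flip: m_assoc)

text \<open>
  Conjugacy classes of the quotient are described by coset images in the group, so that the
  quotient group is needed only through this lemma.
\<close>

lemma FC_next_iff:
  assumes "N \<lhd> G"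
  shows "g \<in> FC_next G N \<longleftrightarrow>
    g \<in> carrier G \<and> finite ((\<lambda>x. N #> (x \<otimes> g \<otimes> inv x)) ` carrier G)"
proof -
  interpret normal N G by fact
  have "{x \<otimes>\<^bsub>G Mod N\<^esub> (N #> g) \<otimes>\<^bsub>G Mod N\<^esub> inv\<^bsub>G Mod N\<^esub> x | x. x \<in> carrier (G Mod N)}
      = (\<lambda>x. N #> (x \<otimes> g \<otimes> inv x)) ` carrier G" if "g \<in> carrier G"
  proof -
    have "(N #> x) \<otimes>\<^bsub>G Mod N\<^esub> (N #> g) \<otimes>\<^bsub>G Mod N\<^esub> inv\<^bsub>G Mod N\<^esub> (N #> x)
        = N #> (x \<otimes> g \<otimes> inv x)" if "x \<in> carrier G" for x
    proof -
      have "N #> x \<in> carrier (G Mod N)" using that by (auto simp: carrier_FactGroup)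
      then show ?thesis
        using that \<open>g \<in> carrier G\<close> by (simp add: inv_FactGroup rcos_inv rcos_sum)
    qed
    then show ?thesis by (auto simp: carrier_FactGroup image_iff)
  qed
  then show ?thesis
    by (auto simp: FC_next_def FC_centre_def carrier_FactGroup)
qed

lemma coset_transfer:
  assumes "N \<lhd> G" "N' \<lhd> G" "N \<subseteq> N'" "a \<in> carrier G" "b \<in> carrier G" "N #> a = N #> b"
  shows "N' #> a = N' #> b"
proof -
  interpret A: normal N G by fact
  interpret B: normal N' G by fact
  have "a \<in> N #> b" using assms by (metis A.subgroup_axioms rcos_self)
  then have "a \<in> N' #> b" using assms(3) by (auto simp: r_coset_def)
  then show ?thesis using B.subgroup_axioms assms(5) repr_independence by metis
qed

lemma FC_next_mono:
  assumes "N \<lhd> G" "N' \<lhd> G" "N \<subseteq> N'"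
  shows "FC_next G N \<subseteq> FC_next G N'"
proof
  fix g assume g: "g \<in> FC_next G N"
  then have *: "g \<in> carrier G" "finite ((\<lambda>x. N #> (x \<otimes> g \<otimes> inv x)) ` carrier G)"
    using FC_next_iff[OF assms(1)] by auto
  have "finite ((\<lambda>x. N' #> (x \<otimes> g \<otimes> inv x)) ` carrier G)"
    by (rule finite_image_factor[OF *(2)], rule coset_transfer[OF assms]) (use * in auto)
  with * show "g \<in> FC_next G N'" using FC_next_iff[OF assms(2)] by auto
qed

lemma subset_FC_next:
  assumes "N \<lhd> G"
  shows "N \<subseteq> FC_next G N"
proof
  interpret normal N G by fact
  fix g assume g: "g \<in> N"
  have "N #> (x \<otimes> g \<otimes> inv x) = N" if "x \<in> carrier G" for x
    using inv_op_closed2[OF that g] coset_join2 subgroup_axioms by (meson mem_carrier)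
  then have "(\<lambda>x. N #> (x \<otimes> g \<otimes> inv x)) ` carrier G \<subseteq> {N}" by auto
  then have "finite ((\<lambda>x. N #> (x \<otimes> g \<otimes> inv x)) ` carrier G)" by (rule finite_subset) simp
  then show "g \<in> FC_next G N" using g FC_next_iff[OF assms] by auto
qed

lemma normal_FC_next:
  assumes "N \<lhd> G"
  shows "FC_next G N \<lhd> G"
proof -
  interpret N: normal N G by fact
  note iff = FC_next_iff[OF assms]
  show ?thesis
    unfolding normal_inv_iff
  proof (intro conjI subgroup.intro ballI)
    show "FC_next G N \<subseteq> carrier G" using iff by blast
    show "\<one> \<in> FC_next G N" using subset_FC_next[OF assms] N.one_closed by blast
  next
    fix x y assume xy: "x \<in> FC_next G N" "y \<in> FC_next G N"
    then have c: "x \<in> carrier G" "y \<in> carrier G" by (auto simp: iff)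
    have "(\<lambda>z. N #> (z \<otimes> (x \<otimes> y) \<otimes> inv z)) ` carrier G \<subseteq>
       (\<lambda>(A, B). A <#> B) ` ((\<lambda>z. N #> (z \<otimes> x \<otimes> inv z)) ` carrier G \<times>
                              (\<lambda>z. N #> (z \<otimes> y \<otimes> inv z)) ` carrier G)"
    proof
      fix w assume "w \<in> (\<lambda>z. N #> (z \<otimes> (x \<otimes> y) \<otimes> inv z)) ` carrier G"
      then obtain z where z: "z \<in> carrier G" "w = N #> (z \<otimes> (x \<otimes> y) \<otimes> inv z)" by blast
      have "z \<otimes> (x \<otimes> y) \<otimes> inv z = (z \<otimes> x \<otimes> inv z) \<otimes> (z \<otimes> y \<otimes> inv z)"
        using z c by (simp add: m_assoc cancel_inv_left)
      then have "w = (N #> (z \<otimes> x \<otimes> inv z)) <#> (N #> (z \<otimes> y \<otimes> inv z))"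
        using z c by (simp add: N.rcos_sum)
      then show "w \<in> (\<lambda>(A, B). A <#> B) ` ((\<lambda>z. N #> (z \<otimes> x \<otimes> inv z)) ` carrier G \<times>
                              (\<lambda>z. N #> (z \<otimes> y \<otimes> inv z)) ` carrier G)"
        using z(1) by blast
    qed
    moreover have "finite \<dots>" using xy by (auto simp: iff)
    ultimately show "x \<otimes> y \<in> FC_next G N" using c by (auto simp: iff intro: finite_subset)
  next
    fix x assume x: "x \<in> FC_next G N"
    then have c: "x \<in> carrier G" by (auto simp: iff)
    have "N #> (z \<otimes> inv x \<otimes> inv z) = set_inv (N #> (z \<otimes> x \<otimes> inv z))" if "z \<in> carrier G" for z
      using that c by (simp add: N.rcos_inv inv_mult_group m_assoc)
    then have "(\<lambda>z. N #> (z \<otimes> inv x \<otimes> inv z)) ` carrier G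
        = (\<lambda>A. set_inv A) ` (\<lambda>z. N #> (z \<otimes> x \<otimes> inv z)) ` carrier G"
      unfolding image_image by (intro image_cong) auto
    then show "inv x \<in> FC_next G N" using x c by (auto simp: iff)
  next
    fix x h assume x: "x \<in> carrier G" and h: "h \<in> FC_next G N"
    then have c: "h \<in> carrier G" by (auto simp: iff)
    have "(\<lambda>z. N #> (z \<otimes> (x \<otimes> h \<otimes> inv x) \<otimes> inv z)) ` carrier G \<subseteq>
          (\<lambda>z. N #> (z \<otimes> h \<otimes> inv z)) ` carrier G"
    proof (rule image_subsetI)
      fix z assume z: "z \<in> carrier G"
      have "z \<otimes> (x \<otimes> h \<otimes> inv x) \<otimes> inv z = (z \<otimes> x) \<otimes> h \<otimes> inv (z \<otimes> x)"
        using x c z by (simp add: m_assoc inv_mult_group)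
      then show "N #> (z \<otimes> (x \<otimes> h \<otimes> inv x) \<otimes> inv z) \<in> (\<lambda>z. N #> (z \<otimes> h \<otimes> inv z)) ` carrier G"
        using x z by auto
    qed
    then show "x \<otimes> h \<otimes> inv x \<in> FC_next G N"
      using x c h by (auto simp: iff intro: finite_subset)
  qed
qed

lemma FC_series_normal_mono:
  assumes r: "Well_order r"
  shows "FC_series G r a \<lhd> G \<and> (\<forall>b \<in> underS r a. FC_series G r b \<subseteq> FC_series G r a)"
proof -
  interpret W: wo_rel r using r by (simp add: wo_rel_def)
  show ?thesis
  proof (induction a rule: W.well_order_induct)
    case (1 a)
    then have IH: "FC_series G r b \<lhd> G" "c \<in> underS r b \<Longrightarrow> FC_series G r c \<subseteq> FC_series G r b"
      if "b \<in> underS r a" for b c using that by (auto simp: underS_def)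
    consider "underS r a = {}" | b where "immediate_pred r b a"
      | "underS r a \<noteq> {}" "\<nexists>b. immediate_pred r b a" by blast
    then show ?case
    proof cases
      case 1
      have "{\<one>} \<lhd> G" by (rule one_is_normal)
      then show ?thesis using 1 FC_series_zero[OF r 1, of G] by simp
    next
      case (2 b)
      then have b: "b \<in> underS r a" "\<And>c. c \<in> underS r a \<Longrightarrow> (c, b) \<in> r"
        by (auto simp: immediate_pred_def)
      have eq: "FC_series G r a = FC_next G (FC_series G r b)" by (rule FC_series_succ[OF r 2])
      have sub: "FC_series G r b \<subseteq> FC_series G r a"
        unfolding eq by (rule subset_FC_next[OF IH(1)[OF b(1)]])
      have "FC_series G r c \<subseteq> FC_series G r b" if "c \<in> underS r a" for c
        using b(2)[OF that] IH(2)[OF b(1), of c] by (cases "c = b") (auto simp: underS_def)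
      then show ?thesis using sub normal_FC_next[OF IH(1)[OF b(1)]] eq by auto
    next
      case 3
      have eq: "FC_series G r a = (\<Union>b \<in> underS r a. FC_series G r b)"
        by (rule FC_series_limit[OF r 3])
      have dir: "\<exists>d \<in> underS r a. FC_series G r b \<union> FC_series G r c \<subseteq> FC_series G r d"
        if "b \<in> underS r a" "c \<in> underS r a" for b c
      proof -
        have "b = c \<or> b \<in> underS r c \<or> c \<in> underS r b"
          using that W.TOTALS by (auto simp: underS_def Field_def)
        then show ?thesis using that IH(2)[OF that(1), of c] IH(2)[OF that(2), of b] by blast
      qed
      have N: "subgroup (FC_series G r b) G" "x \<in> carrier G \<Longrightarrow> h \<in> FC_series G r b \<Longrightarrow>
          x \<otimes> h \<otimes> inv x \<in> FC_series G r b" if "b \<in> underS r a" for b x h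
        using IH(1)[OF that] by (auto simp: normal_inv_iff)
      have "FC_series G r a \<lhd> G"
        unfolding normal_inv_iff
      proof (intro conjI subgroup.intro ballI)
        show "FC_series G r a \<subseteq> carrier G" unfolding eq using N(1) subgroup.subset by blast
        show "\<one> \<in> FC_series G r a" unfolding eq using N(1) 3(1) subgroup.one_closed by blast
      next
        fix x y assume "x \<in> FC_series G r a" "y \<in> FC_series G r a"
        then obtain b c where bc: "b \<in> underS r a" "c \<in> underS r a"
          "x \<in> FC_series G r b" "y \<in> FC_series G r c" unfolding eq by blast
        with dir[OF bc(1,2)] obtain d
          where d: "d \<in> underS r a" "x \<in> FC_series G r d" "y \<in> FC_series G r d"
          by blast
        then have "x \<otimes> y \<in> FC_series G r d" by (intro subgroup.m_closed[OF N(1)])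
        with d show "x \<otimes> y \<in> FC_series G r a" unfolding eq by blast
      next
        fix x assume "x \<in> FC_series G r a"
        then obtain b where b: "b \<in> underS r a" "x \<in> FC_series G r b" unfolding eq by blast
        then have "inv x \<in> FC_series G r b" by (intro subgroup.m_inv_closed[OF N(1)])
        with b show "inv x \<in> FC_series G r a" unfolding eq by blast
      next
        fix x h assume "x \<in> carrier G" "h \<in> FC_series G r a"
        then show "x \<otimes> h \<otimes> inv x \<in> FC_series G r a" unfolding eq using N(2) by blast
      qed
      then show ?thesis using eq by blast
    qed
  qed
qed

text \<open>
  The hyper-FC-centre is the least normal subgroup that is closed under the operator \<open>FC_next\<close>: by
  monotonicity of the operator, no term of the series leaves such a subgroup.
\<close>

lemma FC_series_subset:
  assumes r: "Well_order r" and N: "N \<lhd> G" and closed: "FC_next G N \<subseteq> N"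
  shows "FC_series G r a \<subseteq> N"
proof -
  interpret W: wo_rel r using r by (simp add: wo_rel_def)
  interpret N: normal N G by fact
  show ?thesis
  proof (induction a rule: W.well_order_induct)
    case (1 a)
    then have IH: "FC_series G r b \<subseteq> N" if "b \<in> underS r a" for b using that by (auto simp: underS_def)
    consider "underS r a = {}" | b where "immediate_pred r b a"
      | "underS r a \<noteq> {}" "\<nexists>b. immediate_pred r b a" by blast
    then show ?case
    proof cases
      case 1
      then show ?thesis using FC_series_zero[OF r 1, of G] N.one_closed by simp
    next
      case (2 b)
      then have "FC_series G r b \<subseteq> N" using IH by (auto simp: immediate_pred_def)
      then have "FC_next G (FC_series G r b) \<subseteq> FC_next G N"
        using FC_series_normal_mono[OF r] N by (intro FC_next_mono) auto
      then show ?thesis using closed FC_series_succ[OF r 2, of G] by blast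
    next
      case 3
      then show ?thesis using IH FC_series_limit[OF r 3, of G] by auto
    qed
  qed
qed

lemma hyper_FC_centre_subset:
  assumes "N \<lhd> G" "FC_next G N \<subseteq> N"
  shows "hyper_FC_centre G \<subseteq> N"
  unfolding hyper_FC_centre_def
proof (intro UN_least)
  fix r :: "'a set rel" and a assume "r \<in> {r. Well_order r}"
  then show "FC_series G r a \<subseteq> N" by (intro FC_series_subset[OF _ assms]) simp
qed

text \<open>
  If every step of the series along a well-order of all of \<open>'a set\<close> were strict, then choosing a
  new group element at each step would embed \<open>'a set\<close> into \<open>'a\<close>, against Cantor's theorem.
\<close>

lemma FC_series_stabilises:
  fixes r :: "'a set rel"
  assumes r: "Well_order r" "Field r = UNIV"
  shows "\<exists>a. FC_next G (FC_series G r a) \<subseteq> FC_series G r a"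
proof (rule ccontr)
  assume neg: "\<nexists>a. FC_next G (FC_series G r a) \<subseteq> FC_series G r a"
  interpret W: wo_rel r using r by (simp add: wo_rel_def)
  let ?F = "FC_series G r"
  note mono = FC_series_normal_mono[OF r(1), THEN conjunct2, rule_format]
  have next_le: "FC_next G (?F a) \<subseteq> ?F b" if ab: "a \<in> underS r b" for a b
  proof -
    define s where "s = W.suc {a}"
    have above: "AboveS r {a} \<noteq> {}" using ab r(2) by (auto simp: AboveS_def underS_def)
    have sa: "(a, s) \<in> r" "a \<noteq> s"
      using W.suc_greater[OF _ above, of a] r(2) by (auto simp: s_def)
    have least: "(s, c) \<in> r" if "(a, c) \<in> r" "a \<noteq> c" for c
      unfolding s_def using that r(2) by (intro W.suc_least_AboveS) (auto simp: AboveS_def)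
    have tot: "(x, y) \<in> r \<or> (y, x) \<in> r" for x y using W.TOTALS r(2) by auto
    have "immediate_pred r a s"
      unfolding immediate_pred_def
    proof (intro conjI ballI)
      show "a \<in> underS r s" using sa by (simp add: underS_def)
      fix c assume c: "c \<in> underS r s"
      show "(c, a) \<in> r"
      proof (rule ccontr)
        assume "(c, a) \<notin> r"
        then have "a \<noteq> c" "(a, c) \<in> r" using tot[of a c] tot[of a a] by metis+
        then have "(s, c) \<in> r" by (intro least)
        then show False using c W.ANTISYM by (auto simp: underS_def antisym_def)
      qed
    qed
    then have "FC_next G (?F a) = ?F s" by (rule FC_series_succ[OF r(1), symmetric])
    moreover have "(s, b) \<in> r" using ab by (intro least) (auto simp: underS_def)
    then have "?F s \<subseteq> ?F b" using mono[of s b] by (cases "s = b") (auto simp: underS_def)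
    ultimately show ?thesis by simp
  qed
  \<comment> \<open>The assumption that is to be refuted covers a last element of the order as well, so
    \<open>j\<close> is defined everywhere.\<close>
  define j where "j a = (SOME z. z \<in> FC_next G (?F a) - ?F a)" for a
  have j: "j a \<in> FC_next G (?F a)" "j a \<notin> ?F a" for a
  proof -
    have "\<exists>z. z \<in> FC_next G (?F a) - ?F a" using neg by blast
    from someI_ex[OF this] show "j a \<in> FC_next G (?F a)" "j a \<notin> ?F a" by (auto simp: j_def)
  qed
  have "inj j"
  proof (rule injI, rule ccontr)
    fix a b assume eq: "j a = j b" and "a \<noteq> b"
    then have "a \<in> underS r b \<or> b \<in> underS r a" using W.TOTALS r(2) by (auto simp: underS_def)
    then show False using next_le j eq by (metis subsetD)
  qed
  then have "surj (inv_into UNIV j)" by (rule inj_imp_surj_inv)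
  then show False using Cantors_theorem[of "UNIV :: 'a set"] by (metis Pow_UNIV)
qed

lemma hyper_FC_centre_closed: "hyper_FC_centre G \<lhd> G" "FC_next G (hyper_FC_centre G)
    \<subseteq> hyper_FC_centre G"
proof -
  obtain r :: "'a set rel" where r: "Well_order r" "Field r = UNIV"
    using well_ordering[where 'a = "'a set"] by (elim exE conjE)
  obtain a where a: "FC_next G (FC_series G r a) \<subseteq> FC_series G r a"
    using FC_series_stabilises[OF r] by (elim exE)
  have N: "FC_series G r a \<lhd> G" by (rule FC_series_normal_mono[OF r(1), THEN conjunct1])
  have "hyper_FC_centre G \<subseteq> FC_series G r a" by (rule hyper_FC_centre_subset[OF N a])
  moreover have "FC_series G r a \<subseteq> hyper_FC_centre G"
    unfolding hyper_FC_centre_def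
    by (intro SUP_upper2[of r] SUP_upper) (use r in auto)
  ultimately have "hyper_FC_centre G = FC_series G r a" by (rule equalityI)
  then show "hyper_FC_centre G \<lhd> G" "FC_next G (hyper_FC_centre G) \<subseteq> hyper_FC_centre G"
    using N a by simp_all
qed

lemma hyper_FC_centre_subset_carrier: "hyper_FC_centre G \<subseteq> carrier G"
  using hyper_FC_centre_closed(1) normal_imp_subgroup subgroup.subset by blast

end


section \<open>Bounded harmonic functions\<close>

definition markov_op :: "('a, 'b) monoid_scheme \<Rightarrow> 'a pmf \<Rightarrow> ('a \<Rightarrow> real) \<Rightarrow> 'a \<Rightarrow> real" where
  "markov_op G \<mu> f g = measure_pmf.expectation \<mu> (\<lambda>h. f (g \<otimes>\<^bsub>G\<^esub> h))"

definition bounded_harmonic :: "('a, 'b) monoid_scheme \<Rightarrow> 'a pmf \<Rightarrow> ('a \<Rightarrow> real) \<Rightarrow> bool" where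
  "bounded_harmonic G \<mu> f \<longleftrightarrow> (\<exists>c. \<forall>g. \<bar>f g\<bar> \<le> c) \<and> (\<forall>g \<in> carrier G. markov_op G \<mu> f g = f g)"

lemma integrable_pmf_bounded:
  fixes f :: "'a \<Rightarrow> real"
  assumes "\<And>x. \<bar>f x\<bar> \<le> c"
  shows "integrable (measure_pmf \<mu>) f"
  by (rule measure_pmf.integrable_const_bound[where B = c]) (use assms in auto)

lemma abs_square_le:
  fixes x :: real
  assumes "\<bar>x\<bar> \<le> c"
  shows "\<bar>x\<^sup>2\<bar> \<le> c\<^sup>2"
  using power_mono[OF assms abs_ge_zero, of 2] by simp

lemma markov_op_bounded:
  assumes "\<And>g. \<bar>f g\<bar> \<le> c"
  shows "\<bar>markov_op G \<mu> f g\<bar> \<le> c"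
proof -
  have "\<bar>markov_op G \<mu> f g\<bar> \<le> measure_pmf.expectation \<mu> (\<lambda>h. \<bar>f (g \<otimes>\<^bsub>G\<^esub> h)\<bar>)"
    unfolding markov_op_def by (rule integral_abs_bound)
  also have "\<dots> \<le> c"
    by (rule measure_pmf.integral_le_const) (use assms in \<open>auto intro!: integrable_pmf_bounded[of _ c]\<close>)
  finally show ?thesis .
qed

lemma markov_op_diff:
  assumes "\<And>g. \<bar>f g\<bar> \<le> c" "\<And>g. \<bar>f' g\<bar> \<le> c'"
  shows "markov_op G \<mu> (\<lambda>x. f x - f' x) g = markov_op G \<mu> f g - markov_op G \<mu> f' g"
  unfolding markov_op_def
  by (rule Bochner_Integration.integral_diff) (use assms in \<open>auto intro: integrable_pmf_bounded\<close>)

lemma markov_op_iter_bounded: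
  assumes "\<And>g. \<bar>f g\<bar> \<le> c"
  shows "\<bar>(markov_op G \<mu> ^^ k) f g\<bar> \<le> c"
proof (induction k arbitrary: g)
  case (Suc k)
  then show ?case by (simp add: markov_op_bounded)
qed (use assms in simp)

lemma markov_op_iter_diff:
  assumes "\<And>g. \<bar>f g\<bar> \<le> c" "\<And>g. \<bar>f' g\<bar> \<le> c'"
  shows "(markov_op G \<mu> ^^ k) (\<lambda>x. f x - f' x) = (\<lambda>g. (markov_op G \<mu> ^^ k) f g - (markov_op G \<mu> ^^
      k) f' g)"
proof (induction k)
  case (Suc k)
  show ?case
    unfolding funpow.simps o_def Suc
    by (rule ext, rule markov_op_diff[of _ c _ c'])
       (use markov_op_iter_bounded[OF assms(1)] markov_op_iter_bounded[OF assms(2)] in auto)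
qed simp

lemma markov_op_iter_cmult:
  "(markov_op G \<mu> ^^ k) (\<lambda>x. a * f x) = (\<lambda>g. a * (markov_op G \<mu> ^^ k) f g)"
  by (induction k) (simp_all add: markov_op_def fun_eq_iff)

context group
begin

context
  fixes \<mu> :: "'a pmf"
  assumes full: "set_pmf \<mu> = carrier G"
begin

lemma markov_op_mono:
  assumes "\<And>x. \<bar>f x\<bar> \<le> c" "\<And>x. \<bar>f' x\<bar> \<le> c'" "\<And>x. x \<in> carrier G \<Longrightarrow> f x \<le> f' x" "g \<in> carrier G"
  shows "markov_op G \<mu> f g \<le> markov_op G \<mu> f' g"
  unfolding markov_op_def
  by (rule integral_mono_AE) (use assms full in \<open>auto intro: integrable_pmf_bounded simp:
      AE_measure_pmf_iff\<close>)

lemma markov_op_iter_mono: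
  assumes "\<And>x. \<bar>f x\<bar> \<le> c" "\<And>x. \<bar>f' x\<bar> \<le> c'" "\<And>x. x \<in> carrier G \<Longrightarrow> f x \<le> f' x" "g \<in> carrier G"
  shows "(markov_op G \<mu> ^^ k) f g \<le> (markov_op G \<mu> ^^ k) f' g"
  using assms(4)
proof (induction k arbitrary: g)
  case (Suc k)
  show ?case
    unfolding funpow.simps o_def
    by (rule markov_op_mono[of _ c _ c'])
       (use Suc markov_op_iter_bounded[OF assms(1)] markov_op_iter_bounded[OF assms(2)] in auto)
qed (use assms in simp)

text \<open>
  The mixed term vanishes because the increments of a harmonic function have mean zero.
\<close>

lemma harmonic_variance:
  assumes b: "\<And>x. \<bar>f x\<bar> \<le> c" and h: "markov_op G \<mu> f g = f g"
  shows "markov_op G \<mu> (\<lambda>x. (f x)\<^sup>2) g - (f g)\<^sup>2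
    = measure_pmf.expectation \<mu> (\<lambda>h. (f (g \<otimes> h) - f g)\<^sup>2)"
proof -
  have "\<bar>(f x)\<^sup>2\<bar> \<le> c\<^sup>2" for x by (rule abs_square_le[OF b])
  then have i2: "integrable (measure_pmf \<mu>) (\<lambda>h. (f (g \<otimes> h))\<^sup>2)"
    by (intro integrable_pmf_bounded[of _ "c\<^sup>2"]) auto
  have i1: "integrable (measure_pmf \<mu>) (\<lambda>h. f (g \<otimes> h))"
    by (intro integrable_pmf_bounded[of _ c] b)
  have "measure_pmf.expectation \<mu> (\<lambda>h. (f (g \<otimes> h) - f g)\<^sup>2)
     = measure_pmf.expectation \<mu> (\<lambda>h. (f (g \<otimes> h))\<^sup>2 - 2 * f g * f (g \<otimes> h) + (f g)\<^sup>2)"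
    by (simp add: power2_diff algebra_simps)
  also have "\<dots> = measure_pmf.expectation \<mu> (\<lambda>h. (f (g \<otimes> h))\<^sup>2)
       - 2 * f g * measure_pmf.expectation \<mu> (\<lambda>h. f (g \<otimes> h)) + (f g)\<^sup>2"
    using i1 i2 by simp
  also have "\<dots> = markov_op G \<mu> (\<lambda>x. (f x)\<^sup>2) g - 2 * f g * f g + (f g)\<^sup>2"
    using h by (simp add: markov_op_def)
  finally show ?thesis by (simp add: power2_eq_square)
qed

lemma harmonic_translate:
  assumes "bounded_harmonic G \<mu> f" "z \<in> carrier G"
  shows "bounded_harmonic G \<mu> (\<lambda>g. f (z \<otimes> g))"
proof -
  have "markov_op G \<mu> (\<lambda>g. f (z \<otimes> g)) g = f (z \<otimes> g)" if "g \<in> carrier G" for g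
  proof -
    have "markov_op G \<mu> (\<lambda>g. f (z \<otimes> g)) g = markov_op G \<mu> f (z \<otimes> g)"
      unfolding markov_op_def
      by (rule integral_cong_AE) (use assms that full in \<open>auto simp: AE_measure_pmf_iff m_assoc\<close>)
    then show ?thesis using assms that by (simp add: bounded_harmonic_def)
  qed
  then show ?thesis using assms by (auto simp: bounded_harmonic_def)
qed

text \<open>
  Let \<open>P\<close> be the Markov operator and \<open>e = P (f\<^sup>2) - f\<^sup>2\<close>, the mean squared increment. The sum of
  the functions \<open>P ^^ k\<close> applied to \<open>e\<close> telescopes and is bounded, hence these functions tend to
  zero. Now \<open>z \<otimes> g = g \<otimes> (inv g \<otimes> z \<otimes> g)\<close>, where the conjugate runs through finitely many cosets
  of \<open>N\<close>; since \<open>f\<close> does not see \<open>N\<close>, the difference \<open>D g = f (z \<otimes> g) - f g\<close> is one of finitely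
  many increments of \<open>f\<close> under right multiplication by steps of positive probability. So
  \<open>D\<^sup>2 \<le> K * e\<close> for a constant \<open>K\<close>. As \<open>D\<close> is harmonic, \<open>D\<^sup>2\<close> is subharmonic, and \<open>D\<^sup>2\<close> is bounded
  by \<open>K\<close> times a null sequence.
\<close>

lemma harmonic_invariant_FC_next:
  assumes N: "N \<lhd> G" and f: "bounded_harmonic G \<mu> f"
    and inv: "\<And>n g. n \<in> N \<Longrightarrow> g \<in> carrier G \<Longrightarrow> f (n \<otimes> g) = f g"
    and z: "z \<in> FC_next G N" and g: "g \<in> carrier G"
  shows "f (z \<otimes> g) = f g"
proof -
  interpret N: normal N G by fact
  let ?P = "markov_op G \<mu>"
  obtain c where c: "\<And>g. \<bar>f g\<bar> \<le> c" and harm: "\<And>g. g \<in> carrier G \<Longrightarrow> ?P f g = f g"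
    using f by (auto simp: bounded_harmonic_def)
  have zG: "z \<in> carrier G" and fin: "finite ((\<lambda>x. N #> (x \<otimes> z \<otimes> inv x)) ` carrier G)"
    using z FC_next_iff[OF N] by auto
  obtain X where X: "X \<subseteq> carrier G" "finite X"
    "(\<lambda>x. N #> (x \<otimes> z \<otimes> inv x)) ` carrier G = (\<lambda>x. N #> (x \<otimes> z \<otimes> inv x)) ` X"
    using finite_subset_image[OF fin order_refl] by blast
  define C where "C = (\<lambda>x. x \<otimes> z \<otimes> inv x) ` X"
  have C: "finite C" "C \<subseteq> carrier G" using X zG by (auto simp: C_def)
  have fz: "\<exists>c \<in> C. f (z \<otimes> g) = f (g \<otimes> c)" if g: "g \<in> carrier G" for g
  proof -
    have "N #> (inv g \<otimes> z \<otimes> inv (inv g)) \<in> (\<lambda>x. N #> (x \<otimes> z \<otimes> inv x)) ` carrier G"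
      using g by blast
    then obtain c where c: "c \<in> C" "N #> (inv g \<otimes> z \<otimes> g) = N #> c"
      using X(3) g by (auto simp: C_def)
    have cG: "c \<in> carrier G" using c C by auto
    have "inv g \<otimes> z \<otimes> g \<in> N #> c"
      unfolding c(2)[symmetric] using g zG N.subgroup_axioms by (intro rcos_self) auto
    then obtain n where n: "n \<in> N" "inv g \<otimes> z \<otimes> g = n \<otimes> c" by (auto simp: r_coset_def)
    have nG: "n \<in> carrier G" using n by auto
    have "z \<otimes> g = g \<otimes> (inv g \<otimes> z \<otimes> g)" using g zG by (simp add: m_assoc cancel_inv_left)
    also have "\<dots> = (g \<otimes> n \<otimes> inv g) \<otimes> (g \<otimes> c)"
      unfolding n(2) using g nG cG by (simp add: m_assoc cancel_inv_left)
    finally have "f (z \<otimes> g) = f (g \<otimes> c)"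
      using inv N.inv_op_closed2[OF g n(1)] g cG by simp
    then show ?thesis using c(1) by blast
  qed
  define e where "e = (\<lambda>x. ?P (\<lambda>x. (f x)\<^sup>2) x - (f x)\<^sup>2)"
  have sqb: "\<bar>(f x)\<^sup>2\<bar> \<le> c\<^sup>2" for x by (rule abs_square_le[OF c])
  note Psqb = markov_op_bounded[of "\<lambda>x. (f x)\<^sup>2", OF sqb]
  have eb: "\<bar>e x\<bar> \<le> 2 * c\<^sup>2" for x
    using sqb[of x] Psqb[of G \<mu> x] zero_le_power2[of c] zero_le_power2[of "f x"]
    unfolding e_def by linarith
  define K where "K = (\<Sum>c\<in>C. 1 / pmf \<mu> c)"
  define D where "D = (\<lambda>x. f (z \<otimes> x) - f x)"
  have D_le: "(D x)\<^sup>2 \<le> K * e x" and e_nonneg: "e x \<ge> 0" if x: "x \<in> carrier G" for x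
  proof -
    have e_eq: "e x = measure_pmf.expectation \<mu> (\<lambda>h. (f (x \<otimes> h) - f x)\<^sup>2)"
      unfolding e_def by (rule harmonic_variance[OF c harm[OF x]])
    then show e0: "e x \<ge> 0" by simp
    obtain a where a: "a \<in> C" "f (z \<otimes> x) = f (x \<otimes> a)" using fz[OF x] by blast
    have apos: "pmf \<mu> a > 0" using a C full by (simp add: pmf_positive_iff subset_iff)
    have db: "\<bar>(f (x \<otimes> h) - f x)\<^sup>2\<bar> \<le> (2 * c)\<^sup>2" for h
      using c[of "x \<otimes> h"] c[of x] by (intro abs_square_le) linarith
    have "pmf \<mu> a * (D x)\<^sup>2 = measure_pmf.expectation \<mu> (\<lambda>h. (D x)\<^sup>2 * indicator {a} h)"
      by (simp add: measure_pmf_single)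
    also have "\<dots> \<le> e x"
    proof -
      have "integrable (measure_pmf \<mu>) (\<lambda>h. (D x)\<^sup>2 * indicator {a} h)"
        by (rule integrable_pmf_bounded[of _ "(D x)\<^sup>2"]) (simp add: indicator_def)
      moreover have "integrable (measure_pmf \<mu>) (\<lambda>h. (f (x \<otimes> h) - f x)\<^sup>2)"
        by (rule integrable_pmf_bounded[OF db])
      ultimately show ?thesis
        unfolding e_eq by (rule integral_mono) (auto simp: D_def a(2) indicator_def)
    qed
    finally have "(D x)\<^sup>2 \<le> 1 / pmf \<mu> a * e x" using apos by (simp add: field_simps)
    also have "\<dots> \<le> K * e x"
      unfolding K_def using a C(1) e0 by (intro mult_right_mono member_le_sum) auto
    finally show "(D x)\<^sup>2 \<le> K * e x" .
  qed
  have Db: "\<bar>D x\<bar> \<le> 2 * c" for x using c[of x] c[of "z \<otimes> x"] unfolding D_def by linarith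
  have D2b: "\<bar>(D x)\<^sup>2\<bar> \<le> (2 * c)\<^sup>2" for x
    by (rule abs_square_le[OF Db])
  have D_harm: "?P D x = D x" if x: "x \<in> carrier G" for x
  proof -
    have "?P (\<lambda>x. f (z \<otimes> x)) x = f (z \<otimes> x)"
      using harmonic_translate[OF f zG] x by (simp add: bounded_harmonic_def)
    then show ?thesis
      using markov_op_diff[of "\<lambda>x. f (z \<otimes> x)" c f c G \<mu> x] c harm[OF x] by (simp add: D_def)
  qed
  have D_sub: "(D x)\<^sup>2 \<le> (?P ^^ k) (\<lambda>x. (D x)\<^sup>2) x" if "x \<in> carrier G" for k x
    using that
  proof (induction k arbitrary: x)
    case (Suc k)
    have "0 \<le> ?P (\<lambda>x. (D x)\<^sup>2) x - (D x)\<^sup>2"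
      unfolding harmonic_variance[OF Db D_harm[OF Suc.prems]] by simp
    also have "?P (\<lambda>x. (D x)\<^sup>2) x \<le> ?P ((?P ^^ k) (\<lambda>x. (D x)\<^sup>2)) x"
      by (rule markov_op_mono[OF D2b markov_op_iter_bounded[OF D2b] Suc.IH Suc.prems])
    finally show ?case by simp
  qed simp
  let ?e = "\<lambda>k. (?P ^^ k) e g"
  have ek: "?e k = (?P ^^ Suc k) (\<lambda>x. (f x)\<^sup>2) g - (?P ^^ k) (\<lambda>x. (f x)\<^sup>2) g" for k
    unfolding e_def markov_op_iter_diff[OF Psqb sqb] by (simp add: funpow_swap1)
  have tel: "(\<Sum>k<n. ?e k) = (?P ^^ n) (\<lambda>x. (f x)\<^sup>2) g - (f g)\<^sup>2" for n
    using sum_lessThan_telescope[of "\<lambda>k. (?P ^^ k) (\<lambda>x. (f x)\<^sup>2) g" n] unfolding ek by simp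
  have e_pos: "?e k \<ge> 0" for k
  proof -
    have "(?P ^^ k) (\<lambda>_. 0) g \<le> ?e k"
      by (rule markov_op_iter_mono[of _ 0 _ "2 * c\<^sup>2"]) (use eb e_nonneg g in auto)
    moreover have "(?P ^^ k) (\<lambda>_. 0) g = 0"
      using markov_op_iter_bounded[of "\<lambda>_. 0" 0 k G \<mu> g] by simp
    ultimately show ?thesis by simp
  qed
  have "summable ?e"
  proof (rule summableI_nonneg_bounded[of _ "c\<^sup>2"])
    show "(\<Sum>k<n. ?e k) \<le> c\<^sup>2" for n
      unfolding tel using markov_op_iter_bounded[of "\<lambda>x. (f x)\<^sup>2", OF sqb, of n G \<mu> g]
      by (simp add: abs_le_iff)  (smt (verit) zero_le_power2)
  qed (use e_pos in auto)
  then have "?e \<longlonglongrightarrow> 0" by (rule summable_LIMSEQ_zero)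
  then have "(\<lambda>k. K * ?e k) \<longlonglongrightarrow> 0" by (rule tendsto_mult_right_zero)
  moreover have "(D g)\<^sup>2 \<le> K * ?e k" for k
  proof -
    have "(D g)\<^sup>2 \<le> (?P ^^ k) (\<lambda>x. (D x)\<^sup>2) g" by (rule D_sub[OF g])
    also have "\<dots> \<le> (?P ^^ k) (\<lambda>x. K * e x) g"
    proof (rule markov_op_iter_mono[OF D2b _ D_le g])
      show "\<bar>K * e x\<bar> \<le> \<bar>K\<bar> * (2 * c\<^sup>2)" for x
        unfolding abs_mult using eb[of x] by (intro mult_left_mono) auto
    qed
    finally show ?thesis by (simp add: markov_op_iter_cmult)
  qed
  ultimately have "(D g)\<^sup>2 \<le> 0" by (intro LIMSEQ_le_const) auto
  then show ?thesis by (simp add: D_def)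
qed

text \<open>
  The elements that leave all bounded harmonic functions invariant form a normal subgroup, which
  is closed under \<open>FC_next\<close> by \<open>harmonic_invariant_FC_next\<close>.
\<close>

lemma harmonic_invariant_hyper_FC_centre:
  assumes "bounded_harmonic G \<mu> f" "z \<in> hyper_FC_centre G" "g \<in> carrier G"
  shows "f (z \<otimes> g) = f g"
proof -
  define S where "S = {z \<in> carrier G. \<forall>f g. bounded_harmonic G \<mu> f \<longrightarrow> g \<in> carrier G \<longrightarrow> f (z \<otimes> g) = f g}"
  have S: "S \<lhd> G"
    unfolding normal_inv_iff
  proof (intro conjI subgroup.intro ballI)
    fix x y assume xy: "x \<in> S" "y \<in> S"
    then have "f (x \<otimes> y \<otimes> g) = f g" if "bounded_harmonic G \<mu> f" "g \<in> carrier G" for f g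
    proof -
      have "f (x \<otimes> (y \<otimes> g)) = f (y \<otimes> g)" "f (y \<otimes> g) = f g"
        using xy that unfolding S_def by blast+
      then show ?thesis using xy that by (simp add: S_def m_assoc)
    qed
    then show "x \<otimes> y \<in> S" using xy by (auto simp: S_def)
  next
    fix x assume x: "x \<in> S"
    then have "f (inv x \<otimes> g) = f g" if "bounded_harmonic G \<mu> f" "g \<in> carrier G" for f g
    proof -
      have "f (x \<otimes> (inv x \<otimes> g)) = f (inv x \<otimes> g)" using x that unfolding S_def by blast
      then show ?thesis using x that by (simp add: S_def cancel_inv_left)
    qed
    then show "inv x \<in> S" using x by (auto simp: S_def)
  next
    fix x h assume x: "x \<in> carrier G" and h: "h \<in> S"
    have "f (x \<otimes> h \<otimes> inv x \<otimes> g) = f g" if f: "bounded_harmonic G \<mu> f" and g: "g \<in> carrier G" for f g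
    proof -
      have "f (x \<otimes> (h \<otimes> (inv x \<otimes> g))) = f (x \<otimes> (inv x \<otimes> g))"
        using h harmonic_translate[OF f x] x g unfolding S_def by blast
      then show ?thesis using x g h by (simp add: S_def m_assoc cancel_inv_left)
    qed
    then show "x \<otimes> h \<otimes> inv x \<in> S" using x h by (auto simp: S_def)
  qed (auto simp: S_def)
  have "FC_next G S \<subseteq> S"
  proof
    fix z assume z: "z \<in> FC_next G S"
    then have "z \<in> carrier G" using FC_next_iff[OF S] by auto
    moreover have "f (z \<otimes> g) = f g" if "bounded_harmonic G \<mu> f" "g \<in> carrier G" for f g
      by (rule harmonic_invariant_FC_next[OF S that(1) _ z that(2)]) (use that in \<open>auto simp: S_def\<close>)
    ultimately show "z \<in> S" by (auto simp: S_def)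
  qed
  then have "hyper_FC_centre G \<subseteq> S" by (rule hyper_FC_centre_subset[OF S])
  then show ?thesis using assms unfolding S_def by blast
qed

end
end


section \<open>Exit sets and harmonic functions\<close>

lemma walk_case_nat: "walk G g (case_nat h x) = case_nat g (walk G (g \<otimes>\<^bsub>G\<^esub> h) x)"
proof
  fix n
  have "walk G g (case_nat h x) (Suc n) = walk G (g \<otimes>\<^bsub>G\<^esub> h) x n" for n
    by (induction n) simp_all
  then show "walk G g (case_nat h x) n = case_nat g (walk G (g \<otimes>\<^bsub>G\<^esub> h) x) n"
    by (cases n) simp_all
qed

abbreviation step_measure :: "('a, 'b) monoid_scheme \<Rightarrow> 'a pmf \<Rightarrow> 'a measure" where
  "step_measure G \<mu> \<equiv> restrict_space (measure_pmf \<mu>) (carrier G)"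

context
  fixes G :: "('a, 'b) monoid_scheme" (structure) and \<mu> :: "'a pmf"
  assumes grp: "group G" and cnt: "countable (carrier G)" and supp: "set_pmf \<mu> \<subseteq> carrier G"
begin

interpretation group G by (rule grp)

lemma case_nat_measurable:
  assumes "g \<in> carrier G"
  shows "case_nat g \<in> path_space G \<rightarrow>\<^sub>M path_space G"
proof (rule path_space_measurableI)
  show "(\<lambda>y. case_nat g y n) \<in> path_space G \<rightarrow>\<^sub>M count_space (carrier G)" for n
    using assms by (cases n) simp_all
qed

text \<open>
  If \<open>h\<close> is the first increment of a walk from \<open>g\<close>, then the shifted path is a walk from \<open>g \<otimes> h\<close>,
  and prefixing \<open>g\<close> to it restores the path.
\<close>

lemma path_measure_step:
  assumes g: "g \<in> carrier G" and S: "S \<in> sets (path_space G)"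
  shows "emeasure (path_measure G \<mu> g) S =
    (\<integral>\<^sup>+ h. emeasure (path_measure G \<mu> (g \<otimes> h)) (case_nat g -` S \<inter> space (path_space G))
      \<partial>step_measure G \<mu>)"
proof -
  let ?M = "step_measure G \<mu>"
  interpret M: prob_space ?M by (rule prob_space_increment[OF grp cnt supp])
  interpret sequence_space ?M ..
  interpret I: prob_space "increments G \<mu>" by (rule prob_space_increments[OF grp cnt supp])
  have spI: "space (increments G \<mu>) = space (path_space G)"
    by (rule sets_eq_imp_space_eq[OF sets_increments[OF grp cnt supp]])
  let ?c = "\<lambda>(h, x). case_nat h x"
  have c_meas: "?c \<in> ?M \<Otimes>\<^sub>M increments G \<mu> \<rightarrow>\<^sub>M increments G \<mu>"
    unfolding increments_def by measurable
  note wm = walk_measurable[OF grp cnt supp]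
  let ?A = "walk G g -` S \<inter> space (increments G \<mu>)"
  have A: "?A \<in> sets (increments G \<mu>)" using wm[OF g] S by (rule measurable_sets)
  have "emeasure (path_measure G \<mu> g) S = emeasure (increments G \<mu>) ?A"
    unfolding path_measure_def by (rule emeasure_distr[OF wm[OF g] S])
  also have "\<dots> = emeasure (distr (?M \<Otimes>\<^sub>M increments G \<mu>) (increments G \<mu>) ?c) ?A"
    by (simp only: increments_def PiM_iter)
  also have "\<dots> = emeasure (?M \<Otimes>\<^sub>M increments G \<mu>) (?c -` ?A \<inter> space (?M \<Otimes>\<^sub>M increments G \<mu>))"
    by (rule emeasure_distr[OF c_meas A])
  also have "\<dots> = (\<integral>\<^sup>+ h. emeasure (increments G \<mu>)
      (Pair h -` (?c -` ?A \<inter> space (?M \<Otimes>\<^sub>M increments G \<mu>))) \<partial>?M)"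
    by (rule I.emeasure_pair_measure_alt) (rule measurable_sets[OF c_meas A])
  also have "\<dots> = (\<integral>\<^sup>+ h. emeasure (path_measure G \<mu> (g \<otimes> h)) (case_nat g -` S \<inter> space (path_space
      G)) \<partial>?M)"
  proof (rule nn_integral_cong)
    fix h assume "h \<in> space ?M"
    then have h: "h \<in> carrier G" by (simp add: space_restrict_space)
    then have gh: "g \<otimes> h \<in> carrier G" using g by simp
    have "Pair h -` (?c -` ?A \<inter> space (?M \<Otimes>\<^sub>M increments G \<mu>)) =
      walk G (g \<otimes> h) -` (case_nat g -` S \<inter> space (path_space G)) \<inter> space (increments G \<mu>)"
    proof -
      have "case_nat h x \<in> space (increments G \<mu>)" "walk G (g \<otimes> h) x \<in> space (path_space G)"
        if "x \<in> space (increments G \<mu>)" for x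
        using that h measurable_space[OF wm[OF gh] that] unfolding spI
        by (auto simp: space_path_space split: nat.split)
      then show ?thesis
        using h by (auto simp: space_pair_measure space_restrict_space walk_case_nat)
    qed
    also have "emeasure (increments G \<mu>) \<dots> =
      emeasure (path_measure G \<mu> (g \<otimes> h)) (case_nat g -` S \<inter> space (path_space G))"
      unfolding path_measure_def
      by (rule emeasure_distr[OF wm[OF gh] measurable_sets[OF case_nat_measurable[OF g] S], symmetric])
    finally show "emeasure (increments G \<mu>) (Pair h -` (?c -` ?A \<inter> space (?M \<Otimes>\<^sub>M increments G \<mu>))) =
      emeasure (path_measure G \<mu> (g \<otimes> h)) (case_nat g -` S \<inter> space (path_space G))" .
  qed
  finally show ?thesis .
qed

text \<open>
  The set \<open>A\<close> is carried through the step unchanged because it is invariant under the shift modulo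
  null sets.
\<close>

lemma exit_step:
  assumes g: "g \<in> carrier G" and A: "A \<in> exit_sets G \<mu>" and S: "S \<in> sets (path_space G)"
  shows "emeasure (path_measure G \<mu> g) (A \<inter> S) =
    (\<integral>\<^sup>+ h. emeasure (path_measure G \<mu> (g \<otimes> h)) (A \<inter> (case_nat g -` S \<inter> space (path_space G)))
      \<partial>step_measure G \<mu>)"
proof -
  let ?M = "step_measure G \<mu>"
  have AS: "A \<in> sets (path_space G)" using A by (simp add: exit_sets_def)
  note cn = measurable_sets[OF case_nat_measurable[OF g]]
  define B where "B = {y \<in> space (path_space G). (y \<in> A) \<noteq> (path_shift y \<in> A)}"
  have "path_shift \<in> path_space G \<rightarrow>\<^sub>M path_space G"
    unfolding path_shift_def by (rule path_space_measurableI) simp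
  note ps = measurable_sets[OF this AS]
  have "B = sym_diff A (path_shift -` A \<inter> space (path_space G))"
    using sets.sets_into_space[OF AS] by (auto simp: B_def)
  then have B: "B \<in> sets (path_space G)" using AS ps by simp
  have "AE y in path_measure G \<mu> g. path_shift y \<in> A \<longleftrightarrow> y \<in> A"
    using A g AE_path_measure_sum[OF grp cnt supp] by (auto simp: exit_sets_def)
  then have "AE y in path_measure G \<mu> g. y \<notin> B" by eventually_elim (auto simp: B_def)
  then have "emeasure (path_measure G \<mu> g) B = 0"
    using B sets.sets_into_space[OF B]
    by (subst (asm) AE_iff_measurable[of B]) (auto simp: path_measure_def)
  then have "(\<integral>\<^sup>+ h. emeasure (path_measure G \<mu> (g \<otimes> h)) (case_nat g -` B \<inter> space (path_space G))
      \<partial>?M) = 0"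
    unfolding path_measure_step[OF g B] .
  moreover have "f \<in> borel_measurable ?M" for f :: "'a \<Rightarrow> ennreal"
    by (rule measurable_restrict_space1) simp
  ultimately have ae: "AE h in ?M. emeasure (path_measure G \<mu> (g \<otimes> h)) (case_nat g -` B \<inter> space
      (path_space G)) = 0"
    by (subst (asm) nn_integral_0_iff_AE) auto
  have "emeasure (path_measure G \<mu> g) (A \<inter> S) =
    (\<integral>\<^sup>+ h. emeasure (path_measure G \<mu> (g \<otimes> h)) (case_nat g -` (A \<inter> S) \<inter> space (path_space G)) \<partial>?M)"
    using AS S by (intro path_measure_step[OF g]) auto
  also have "\<dots> = (\<integral>\<^sup>+ h. emeasure (path_measure G \<mu> (g \<otimes> h)) (A \<inter> (case_nat g -` S \<inter> space
      (path_space G))) \<partial>?M)"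
  proof (rule nn_integral_cong_AE, use ae in eventually_elim)
    case (elim h)
    have "AE y in path_measure G \<mu> (g \<otimes> h). y \<notin> case_nat g -` B \<inter> space (path_space G)"
      using elim cn[OF B] by (intro AE_not_in) (auto simp: null_sets_def)
    then have "AE y in path_measure G \<mu> (g \<otimes> h).
       y \<in> case_nat g -` (A \<inter> S) \<inter> space (path_space G) \<longleftrightarrow> y \<in> A \<inter> (case_nat g -` S \<inter> space
           (path_space G))"
      by eventually_elim
        (use sets.sets_into_space[OF AS] measurable_space[OF case_nat_measurable[OF g]]
          in \<open>auto simp: B_def path_shift_def\<close>)
    then show ?case
      using cn[of "A \<inter> S"] cn[OF S] AS S by (intro emeasure_eq_AE) auto
  qed
  finally show ?thesis .
qed

text \<open>
  An exit set is determined modulo null sets by the harmonic function \<open>g \<mapsto> P\<^sub>g A\<close>. By induction on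
  the length of a cylinder \<open>C\<close>, \<open>exit_step\<close> shows that \<open>P\<^sub>g (A \<inter> C)\<close> depends only on this
  function; cylinders generate, so \<open>P\<^sub>g (A \<inter> C) = P\<^sub>g (A' \<inter> C)\<close> for all measurable \<open>C\<close>, in
  particular for the complements of \<open>A\<close> and \<open>A'\<close>.
\<close>

lemma exit_sets_eq_AE:
  assumes A: "A \<in> exit_sets G \<mu>" "A' \<in> exit_sets G \<mu>"
    and eq: "\<And>g. g \<in> carrier G \<Longrightarrow> emeasure (path_measure G \<mu> g) A = emeasure (path_measure G \<mu> g) A'"
    and g: "g \<in> carrier G"
  shows "AE y in path_measure G \<mu> g. y \<in> A \<longleftrightarrow> y \<in> A'"
proof -
  let ?X = "path_space G"
  have AS: "A \<in> sets ?X" "A' \<in> sets ?X" using A by (simp_all add: exit_sets_def)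
  define cyl where "cyl F n = {y \<in> space ?X. \<forall>i<n. y i \<in> F i}" for F :: "nat \<Rightarrow> 'a set" and n
  have cyl_sets: "cyl F n \<in> sets ?X" for F n
  proof -
    have "{y \<in> space ?X. y i \<in> F i} \<in> sets ?X" for i
    proof -
      have "(\<lambda>y. y i) -` (F i \<inter> carrier G) \<inter> space ?X \<in> sets ?X"
        by (rule measurable_sets[OF path_component]) auto
      moreover have "(\<lambda>y. y i) -` (F i \<inter> carrier G) \<inter> space ?X = {y \<in> space ?X. y i \<in> F i}"
        by (auto simp: space_path_space)
      ultimately show ?thesis by simp
    qed
    then have "{y \<in> space ?X. \<forall>i\<in>{..<n}. y i \<in> F i} \<in> sets ?X"
      by (intro sets.sets_Collect_finite_All) auto
    moreover have "{y \<in> space ?X. \<forall>i\<in>{..<n}. y i \<in> F i} = cyl F n" by (auto simp: cyl_def)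
    ultimately show ?thesis by simp
  qed
  have cyl_eq: "emeasure (path_measure G \<mu> g) (A \<inter> cyl F n) = emeasure (path_measure G \<mu> g) (A' \<inter>
      cyl F n)"
    if "g \<in> carrier G" for g F n
    using that
  proof (induction n arbitrary: F g)
    case 0
    have "cyl F 0 = space ?X" by (simp add: cyl_def)
    then show ?case using eq[OF 0] AS sets.sets_into_space by (simp add: Int_absorb2)
  next
    case (Suc n)
    have cs: "case_nat g -` cyl F (Suc n) \<inter> space ?X = (if g \<in> F 0 then cyl (\<lambda>i. F (Suc i)) n else {})"
    proof -
      have "case_nat g y \<in> space ?X" if "y \<in> space ?X" for y
        using measurable_space[OF case_nat_measurable[OF Suc.prems] that] .
      then show ?thesis by (auto simp: cyl_def All_less_Suc2)
    qed
    show ?case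
      unfolding exit_step[OF Suc.prems A(1) cyl_sets] exit_step[OF Suc.prems A(2) cyl_sets] cs
      by (intro nn_integral_cong) (use Suc.IH Suc.prems in \<open>auto simp: space_restrict_space\<close>)
  qed
  interpret P: prob_space "path_measure G \<mu> g" by (rule prob_space_path_measure[OF grp cnt supp g])
  have "density (path_measure G \<mu> g) (indicator A) = density (path_measure G \<mu> g) (indicator A')"
  proof (rule measure_eqI_PiM_infinite)
    show "sets (density (path_measure G \<mu> g) (indicator A)) = sets (Pi\<^sub>M UNIV (\<lambda>_::nat.
        count_space (carrier G)))"
      "sets (density (path_measure G \<mu> g) (indicator A')) = sets (Pi\<^sub>M UNIV (\<lambda>_::nat. count_space
          (carrier G)))"
      by (simp_all add: path_space_def)
    have "emeasure (density (path_measure G \<mu> g) (indicator A)) (space (path_measure G \<mu> g)) =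
          emeasure (path_measure G \<mu> g) (A \<inter> space (path_measure G \<mu> g))"
      using AS by (intro emeasure_restricted sets.top) auto
    then show "finite_measure (density (path_measure G \<mu> g) (indicator A))"
      by (intro finite_measureI) simp
    fix F and J :: "nat set" assume J: "finite J" and F: "\<And>i. i \<in> J \<Longrightarrow> F i \<in> sets (count_space
        (carrier G))"
    define n where "n = Suc (Max (insert 0 J))"
    have n: "i < n" if "i \<in> J" for i using J that by (auto simp: n_def less_Suc_eq_le)
    have "prod_emb UNIV (\<lambda>_. count_space (carrier G)) J (Pi\<^sub>E J F) = cyl (\<lambda>i.
        if i \<in> J then F i else carrier G) n"
      using n by (auto simp: prod_emb_def cyl_def path_space_def space_PiM PiE_iff)
    then show "emeasure (density (path_measure G \<mu> g) (indicator A)) (prod_emb UNIV (\<lambda>_.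
        count_space (carrier G)) J (Pi\<^sub>E J F))
      = emeasure (density (path_measure G \<mu> g) (indicator A')) (prod_emb UNIV (\<lambda>_. count_space
          (carrier G)) J (Pi\<^sub>E J F))"
      using AS cyl_sets cyl_eq[OF g] by (simp add: emeasure_restricted)
  qed
  then have E: "emeasure (path_measure G \<mu> g) (A \<inter> C) = emeasure (path_measure G \<mu> g) (A' \<inter> C)"
    if "C \<in> sets ?X" for C
    using that AS emeasure_restricted[of _ "path_measure G \<mu> g" C] by (metis sets_path_measure)
  have "emeasure (path_measure G \<mu> g) (A - A') = 0" "emeasure (path_measure G \<mu> g) (A' - A) = 0"
    using E[of "space ?X - A'"] E[of "space ?X - A"] AS sets.sets_into_space[OF AS(1)]
        sets.sets_into_space[OF AS(2)]
    by (auto simp: Diff_eq Int_assoc[symmetric] Int_absorb2 Int_commute)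
  then have "A - A' \<in> null_sets (path_measure G \<mu> g)" "A' - A \<in> null_sets (path_measure G \<mu> g)"
    using AS by (auto simp: null_sets_def)
  then have "AE y in path_measure G \<mu> g. y \<notin> A - A'" "AE y in path_measure G \<mu> g. y \<notin> A' - A"
    by (auto dest: AE_not_in)
  then show ?thesis by eventually_elim auto
qed

lemma exit_harmonic:
  assumes A: "A \<in> exit_sets G \<mu>"
  shows "bounded_harmonic G \<mu> (\<lambda>g. if g \<in> carrier G then measure (path_measure G \<mu> g) A else 0)"
    (is "bounded_harmonic G \<mu> ?f")
  unfolding bounded_harmonic_def
proof (intro conjI ballI exI[of _ 1] allI)
  note P = prob_space_path_measure[OF grp cnt supp]
  have AS: "A \<in> sets (path_space G)" using A by (simp add: exit_sets_def)
  show b: "\<bar>?f g\<bar> \<le> 1" for g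
    using prob_space.prob_le_1[OF P[of g]] by (simp add: measure_nonneg)
  fix g assume g: "g \<in> carrier G"
  have "ennreal (?f g) = emeasure (path_measure G \<mu> g) (A \<inter> space (path_space G))"
    using g AS sets.sets_into_space[OF AS] P[OF g]
    by (simp add: Int_absorb2 finite_measure.emeasure_eq_measure prob_space.finite_measure)
  also have "\<dots> = (\<integral>\<^sup>+ h. emeasure (path_measure G \<mu> (g \<otimes> h)) (A \<inter> (case_nat g -` space (path_space
      G) \<inter> space (path_space G)))
      \<partial>step_measure G \<mu>)" by (rule exit_step[OF g A]) simp
  also have "\<dots> = (\<integral>\<^sup>+ h. ennreal (?f (g \<otimes> h)) \<partial>step_measure G \<mu>)"
  proof (rule nn_integral_cong)
    fix h assume "h \<in> space (step_measure G \<mu>)"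
    then have gh: "g \<otimes> h \<in> carrier G" using g by (simp add: space_restrict_space)
    have "A \<inter> (case_nat g -` space (path_space G) \<inter> space (path_space G)) = A"
      using sets.sets_into_space[OF AS] measurable_space[OF case_nat_measurable[OF g]] by blast
    then show "emeasure (path_measure G \<mu> (g \<otimes> h)) (A \<inter> (case_nat g -` space (path_space G) \<inter>
        space (path_space G)))
       = ennreal (?f (g \<otimes> h))"
      using gh P[OF gh] by (simp add: finite_measure.emeasure_eq_measure prob_space.finite_measure)
  qed
  also have "\<dots> = (\<integral>\<^sup>+ h. ennreal (?f (g \<otimes> h)) * indicator (carrier G) h \<partial>measure_pmf \<mu>)"
    by (rule nn_integral_restrict_space) simp
  also have "\<dots> = (\<integral>\<^sup>+ h. ennreal (?f (g \<otimes> h)) \<partial>measure_pmf \<mu>)"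
    using supp by (intro nn_integral_cong_AE) (auto simp: AE_measure_pmf_iff)
  also have "\<dots> = ennreal (markov_op G \<mu> ?f g)"
    unfolding markov_op_def
    by (rule nn_integral_eq_integral) (use b in \<open>auto intro!: integrable_pmf_bounded[of _ 1]\<close>)
  finally show "markov_op G \<mu> ?f g = ?f g"
    by (subst (asm) ennreal_inj) (auto simp: markov_op_def intro!: integral_nonneg)
qed

text \<open>
  The sets \<open>A\<close> and \<open>z\<^sup>-\<^sup>1 A\<close> have the same harmonic function.
\<close>

lemma hyper_FC_centre_preserves_exit_sets:
  assumes full: "set_pmf \<mu> = carrier G" and z: "z \<in> hyper_FC_centre G" and A: "A \<in> exit_sets G \<mu>"
  shows "AE y in path_measure_sum G \<mu>. left_mult G z y \<in> A \<longleftrightarrow> y \<in> A"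
  unfolding AE_path_measure_sum[OF grp cnt supp]
proof
  fix g assume g: "g \<in> carrier G"
  have zG: "z \<in> carrier G" using z hyper_FC_centre_subset_carrier by blast
  have AS: "A \<in> sets (path_space G)" using A by (simp add: exit_sets_def)
  let ?A = "left_mult G z -` A \<inter> space (path_space G)"
  note lm = left_mult_measurable[OF grp cnt supp zG]
  have "AE y in path_measure G \<mu> g. y \<in> ?A \<longleftrightarrow> y \<in> A"
  proof (rule exit_sets_eq_AE[OF exit_left_mult[OF grp cnt supp zG A] A _ g])
    fix x assume x: "x \<in> carrier G"
    have "emeasure (path_measure G \<mu> x) ?A =
          emeasure (distr (path_measure G \<mu> x) (path_space G) (left_mult G z)) A"
      using AS lm by (subst emeasure_distr) (auto simp: path_measure_def)
    also have "\<dots> = emeasure (path_measure G \<mu> (z \<otimes> x)) A"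
      by (simp add: distr_left_mult[OF grp cnt supp zG x])
    also have "\<dots> = emeasure (path_measure G \<mu> x) A"
      using harmonic_invariant_hyper_FC_centre[OF full exit_harmonic[OF A] z x] zG x
        prob_space_path_measure[OF grp cnt supp x] prob_space_path_measure[OF grp cnt supp, of "z \<otimes> x"]
      by (simp add: finite_measure.emeasure_eq_measure prob_space.finite_measure)
    finally show "emeasure (path_measure G \<mu> x) ?A = emeasure (path_measure G \<mu> x) A" .
  qed
  moreover have "AE y in path_measure G \<mu> g. y \<in> space (path_space G)"
    using AE_space[of "path_measure G \<mu> g"] by (simp add: path_measure_def)
  ultimately show "AE y in path_measure G \<mu> g. left_mult G z y \<in> A \<longleftrightarrow> y \<in> A"
    by eventually_elim auto
qed

end


section \<open>Switching elements\<close>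

text \<open>
  The condition \<open>inv t \<otimes> x \<notin> K\<close> says that \<open>x\<close> lies outside the coset \<open>t K\<close>.
\<close>

definition infinite_index :: "('a, 'b) monoid_scheme \<Rightarrow> 'a set \<Rightarrow> bool" where
  "infinite_index G K \<longleftrightarrow> (\<forall>T. finite T \<longrightarrow> T \<subseteq> carrier G \<longrightarrow>
     (\<exists>x \<in> carrier G. \<forall>t \<in> T. inv\<^bsub>G\<^esub> t \<otimes>\<^bsub>G\<^esub> x \<notin> K))"

definition centralizer :: "('a, 'b) monoid_scheme \<Rightarrow> 'a \<Rightarrow> 'a set" where
  "centralizer G s = {x \<in> carrier G. x \<otimes>\<^bsub>G\<^esub> s = s \<otimes>\<^bsub>G\<^esub> x}"

text \<open>
  If \<open>b\<close> is switching for \<open>F\<close>, then the prefix of a product \<open>w \<otimes> b \<otimes> v\<close> or \<open>w \<otimes> inv b \<otimes> v\<close> can be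
  recovered from the product, provided that the quotients of the admissible prefixes and suffixes
  lie in \<open>F\<close>.
\<close>

definition switching :: "('a, 'b) monoid_scheme \<Rightarrow> 'a set \<Rightarrow> 'a \<Rightarrow> bool" where
  "switching G F b \<longleftrightarrow> b \<in> carrier G \<and> b \<notin> F \<and>
     (\<forall>c \<in> {b, inv\<^bsub>G\<^esub> b}. \<forall>c' \<in> {b, inv\<^bsub>G\<^esub> b}. \<forall>s \<in> F. \<forall>t \<in> F.
        s \<otimes>\<^bsub>G\<^esub> c \<otimes>\<^bsub>G\<^esub> t = c' \<longrightarrow> s = \<one>\<^bsub>G\<^esub>)"

context group
begin

text \<open>
  B. H. Neumann's lemma. If finitely many cosets cover the group, then a coset \<open>g K\<close> that is not
  among those of the first subgroup \<open>K\<close> is covered by cosets of the others; its translates cover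
  all cosets of \<open>K\<close>, so \<open>K\<close> can be dispensed with.
\<close>

lemma infinite_index_cosets_not_cover:
  assumes "finite \<K>" and "\<And>K. K \<in> \<K> \<Longrightarrow> subgroup K G" "\<And>K. K \<in> \<K> \<Longrightarrow> infinite_index G K"
    and "finite T" "T \<subseteq> carrier G"
  shows "\<exists>x \<in> carrier G. \<forall>K \<in> \<K>. \<forall>t \<in> T. inv t \<otimes> x \<notin> K"
  using assms
proof (induction \<K> arbitrary: T rule: finite_induct)
  case (insert K \<K>)
  interpret K: subgroup K G using insert.prems(1) by simp
  show ?case
  proof (rule ccontr)
    assume "\<not> ?thesis"
    then have cover: "\<exists>K' \<in> insert K \<K>. \<exists>t \<in> T. inv t \<otimes> x \<in> K'" if "x \<in> carrier G" for x
      using that by blast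
    obtain g where g: "g \<in> carrier G" "\<And>t. t \<in> T \<Longrightarrow> inv t \<otimes> g \<notin> K"
      using insert.prems unfolding infinite_index_def by (metis insertI1)
    define T' where "T' = T \<union> (\<lambda>(t, t'). t \<otimes> inv g \<otimes> t') ` (T \<times> T)"
    have "finite T'" "T' \<subseteq> carrier G"
      using insert.prems(3,4) g(1) by (auto simp: T'_def)
    then obtain x where x: "x \<in> carrier G" "\<And>K' t. K' \<in> \<K> \<Longrightarrow> t \<in> T' \<Longrightarrow> inv t \<otimes> x \<notin> K'"
      using insert.IH[of T'] insert.prems by auto
    obtain t where t: "t \<in> T" "inv t \<otimes> x \<in> K"
      using cover[OF x(1)] x(2) by (auto simp: T'_def)
    have tG: "t \<in> carrier G" using t insert.prems by auto
    obtain K' t' where K': "K' \<in> insert K \<K>" "t' \<in> T" "inv t' \<otimes> (g \<otimes> (inv t \<otimes> x)) \<in> K'"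
      using cover[of "g \<otimes> (inv t \<otimes> x)"] g x tG by auto
    have t'G: "t' \<in> carrier G" using K' insert.prems by auto
    show False
    proof (cases "K' = K")
      case True
      then have "inv t' \<otimes> (g \<otimes> (inv t \<otimes> x)) \<otimes> inv (inv t \<otimes> x) \<in> K" using K' t by auto
      moreover have "inv t' \<otimes> (g \<otimes> (inv t \<otimes> x)) \<otimes> inv (inv t \<otimes> x) = inv t' \<otimes> g"
        using g x tG t'G by (simp add: m_assoc)
      ultimately show False using g(2)[OF K'(2)] by simp
    next
      case False
      have "inv (t \<otimes> inv g \<otimes> t') \<otimes> x = inv t' \<otimes> (g \<otimes> (inv t \<otimes> x))"
        using g x tG t'G by (simp add: m_assoc inv_mult_group)
      moreover have "t \<otimes> inv g \<otimes> t' \<in> T'" using t K' by (auto simp: T'_def)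
      ultimately show False using x(2) K' False by (metis insertE)
    qed
  qed
qed auto

lemma subgroup_centralizer:
  assumes s: "s \<in> carrier G"
  shows "subgroup (centralizer G s) G"
proof (rule subgroup.intro)
  fix x y assume "x \<in> centralizer G s" "y \<in> centralizer G s"
  then show "x \<otimes> y \<in> centralizer G s"
    using s by (auto simp: centralizer_def m_assoc) (metis m_assoc)
next
  fix x assume "x \<in> centralizer G s"
  then have x: "x \<in> carrier G" "x \<otimes> s = s \<otimes> x" by (auto simp: centralizer_def)
  have "inv x \<otimes> s = inv x \<otimes> (s \<otimes> x) \<otimes> inv x" using x(1) s by (simp add: m_assoc)
  also have "\<dots> = s \<otimes> inv x" unfolding x(2)[symmetric] using x(1) s by (simp add: cancel_inv_left)
  finally show "inv x \<in> centralizer G s" using x by (simp add: centralizer_def)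
qed (use s in \<open>auto simp: centralizer_def\<close>)

lemma infinite_index_centralizer:
  assumes icc: "FC_centre G = {\<one>}" and s: "s \<in> carrier G" "s \<noteq> \<one>"
  shows "infinite_index G (centralizer G s)"
  unfolding infinite_index_def
proof (intro allI impI, rule ccontr)
  fix T assume T: "finite T" "T \<subseteq> carrier G" "\<not> (\<exists>x\<in>carrier G. \<forall>t\<in>T. inv t \<otimes> x \<notin> centralizer G s)"
  have "{x \<otimes> s \<otimes> inv x | x. x \<in> carrier G} \<subseteq> (\<lambda>t. t \<otimes> s \<otimes> inv t) ` T"
  proof clarify
    fix x assume x: "x \<in> carrier G"
    with T(3) obtain t where t: "t \<in> T" "inv t \<otimes> x \<in> centralizer G s" by blast
    have tG: "t \<in> carrier G" using t T by auto
    have "inv t \<otimes> x \<otimes> s = s \<otimes> (inv t \<otimes> x)" using t by (simp add: centralizer_def)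
    then have "t \<otimes> (inv t \<otimes> x \<otimes> s) \<otimes> inv x = t \<otimes> (s \<otimes> (inv t \<otimes> x)) \<otimes> inv x" by simp
    then have "x \<otimes> s \<otimes> inv x = t \<otimes> s \<otimes> inv t"
      using x tG s by (simp add: m_assoc cancel_inv_left)
    then show "x \<otimes> s \<otimes> inv x \<in> (\<lambda>t. t \<otimes> s \<otimes> inv t) ` T" using t by blast
  qed
  then have "s \<in> FC_centre G" using T(1) s finite_subset by (auto simp: FC_centre_def)
  then show False using icc s by simp
qed

text \<open>
  A pair \<open>(u, s)\<close> stands for the coset \<open>u C(s)\<close>. The centralizer \<open>C(s)\<close> has infinite index because
  the conjugacy class of \<open>s\<close> is infinite.
\<close>

lemma avoid_centralizer_cosets:
  assumes icc: "FC_centre G = {\<one>}" and D: "finite D" "D \<subseteq> carrier G \<times> (carrier G - {\<one>})"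
  shows "\<exists>x \<in> carrier G. \<forall>(u, s) \<in> D. inv u \<otimes> x \<notin> centralizer G s"
proof -
  have "\<exists>x \<in> carrier G. \<forall>K \<in> centralizer G ` snd ` D. \<forall>t \<in> fst ` D. inv t \<otimes> x \<notin> K"
    using D by (intro infinite_index_cosets_not_cover)
      (auto intro!: subgroup_centralizer infinite_index_centralizer[OF icc])
  then show ?thesis by force
qed

lemma inv_prod3:
  assumes "x \<in> carrier G" "y \<in> carrier G" "z \<in> carrier G"
  shows "inv (x \<otimes> y \<otimes> z) = inv z \<otimes> inv y \<otimes> inv x"
  using assms by (simp add: inv_mult_group m_assoc)

text \<open>
  For \<open>s \<noteq> \<one>\<close>, the solutions \<open>b\<close> of \<open>s \<otimes> b \<otimes> t = b\<close> form a coset of a centralizer, and can be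
  avoided. A solution of \<open>s \<otimes> b \<otimes> t = inv b\<close> satisfies \<open>(t \<otimes> b)\<^sup>2 = t \<otimes> inv s\<close>, so \<open>t \<otimes> b\<close>
  commutes with \<open>t \<otimes> inv s\<close>; this also confines \<open>b\<close> to a coset of a centralizer, unless \<open>s = t\<close>
  and \<open>(t \<otimes> b)\<^sup>2 = \<one>\<close>. If that exceptional case cannot be avoided together with the cosets, then
  some translate \<open>t \<otimes> x\<close> of an element \<open>x\<close> that avoids sufficiently many cosets has square \<open>\<one>\<close>; it
  serves as \<open>b\<close>, for which \<open>inv b = b\<close> and the second equation is the first one.
\<close>

lemma switching_exists:
  assumes icc: "FC_centre G = {\<one>}" and nontriv: "carrier G \<noteq> {\<one>}"
    and F: "finite F" "F \<subseteq> carrier G" "\<And>s. s \<in> F \<Longrightarrow> inv s \<in> F"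
  shows "\<exists>b. switching G F b"
proof -
  obtain s0 where s0: "s0 \<in> carrier G" "s0 \<noteq> \<one>" using nontriv by blast
  define sol where "sol s t = (SOME b. b \<in> carrier G \<and> s \<otimes> b \<otimes> t = b)" for s t
  have sol: "sol s t \<in> carrier G" "s \<otimes> sol s t \<otimes> t = sol s t"
    if "b \<in> carrier G" "s \<otimes> b \<otimes> t = b" for s t b
    using someI[of "\<lambda>b. b \<in> carrier G \<and> s \<otimes> b \<otimes> t = b" b] that by (auto simp: sol_def)
  \<comment> \<open>The cosets \<open>f C(s0)\<close> keep \<open>b\<close> out of \<open>F\<close>, those with \<open>sol s t\<close> exclude the first
    equation, and the last ones the second equation.\<close>
  define D where "D = F \<times> {s0} \<union>
    (\<lambda>(s, t). (sol s t, inv t)) ` {(s, t) \<in> F \<times> F. s \<noteq> \<one> \<and> t \<noteq> \<one> \<and> sol s t \<in> carrier G} \<union>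
    (\<lambda>(s, t). (inv t, t \<otimes> inv s)) ` {(s, t) \<in> F \<times> F. s \<noteq> t}"
  have Dfin: "finite D"
  proof -
    have "finite {(s, t) \<in> F \<times> F. s \<noteq> \<one> \<and> t \<noteq> \<one> \<and> sol s t \<in> carrier G}" "finite {(s, t) \<in> F \<times> F. s \<noteq> t}"
      using F(1) by (auto intro: finite_subset[of _ "F \<times> F"])
    then show ?thesis using F(1) by (simp add: D_def)
  qed
  have Dsub: "D \<subseteq> carrier G \<times> (carrier G - {\<one>})"
  proof -
    have "t \<otimes> inv s \<noteq> \<one>" if "s \<in> F" "t \<in> F" "s \<noteq> t" for s t
      using that F(2) inv_equality[of t "inv s"] by (metis inv_closed inv_inv subsetD)
    then show ?thesis using subsetD[OF F(2)] s0 by (auto simp: D_def)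
  qed
  define avoid where "avoid x \<longleftrightarrow> (\<forall>(u, s) \<in> D. inv u \<otimes> x \<notin> centralizer G s)" for x
  have notF: "b \<notin> F" if "avoid b" for b
  proof
    assume "b \<in> F"
    then have "inv b \<otimes> b \<notin> centralizer G s0" using that by (auto simp: avoid_def D_def)
    then show False using \<open>b \<in> F\<close> F(2) s0 by (auto simp: centralizer_def)
  qed
  have same: "s = \<one>" if b: "avoid b" "b \<in> carrier G" and st: "s \<in> F" "t \<in> F" and eq: "s \<otimes> b \<otimes> t
      = b" for b s t
  proof (rule ccontr)
    assume s: "s \<noteq> \<one>"
    have G: "s \<in> carrier G" "t \<in> carrier G" using st F(2) by auto
    have t: "t \<noteq> \<one>"
    proof
      assume "t = \<one>"
      then have "s \<otimes> b = \<one> \<otimes> b" using eq G b(2) by simp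
      then show False using s G b(2) by (metis one_closed right_cancel)
    qed
    define a where "a = sol s t"
    have a: "a \<in> carrier G" "s \<otimes> a \<otimes> t = a" using sol[OF b(2) eq] by (auto simp: a_def)
    have "(a, inv t) \<in> D" using st s t a(1) by (auto simp: D_def a_def)
    then have "inv a \<otimes> b \<notin> centralizer G (inv t)" using b(1) by (auto simp: avoid_def)
    moreover have "inv a \<otimes> b \<otimes> inv t = inv t \<otimes> (inv a \<otimes> b)"
    proof -
      have 1: "b \<otimes> inv t = s \<otimes> b" using eq G b(2) by (metis inv_solve_right m_closed)
      have "inv t \<otimes> inv a \<otimes> inv s = inv a" using a G inv_prod3[of s a t] by simp
      then have 2: "inv t \<otimes> inv a = inv a \<otimes> s"
        using G a(1) by (metis inv_closed inv_inv inv_solve_right m_closed)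
      have "inv a \<otimes> b \<otimes> inv t = inv a \<otimes> s \<otimes> b" using 1 G a(1) b(2) by (simp add: m_assoc)
      also have "\<dots> = inv t \<otimes> (inv a \<otimes> b)" unfolding 2[symmetric] using G a(1) b(2)
          by (simp add: m_assoc)
      finally show ?thesis .
    qed
    ultimately show False using a(1) b(2) by (simp add: centralizer_def)
  qed
  show ?thesis
  proof (cases "\<exists>b \<in> carrier G. avoid b \<and> (\<forall>t \<in> F. (t \<otimes> b) \<otimes> (t \<otimes> b) \<noteq> \<one>)")
    case True
    then obtain b where b: "b \<in> carrier G" "avoid b" "\<And>t. t \<in> F \<Longrightarrow> (t \<otimes> b) \<otimes> (t \<otimes> b) \<noteq> \<one>" by blast
    have diff: False if st: "s \<in> F" "t \<in> F" and eq: "s \<otimes> b \<otimes> t = inv b" for s t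
    proof -
      have G: "s \<in> carrier G" "t \<in> carrier G" using st F(2) by auto
      have "b \<otimes> t = inv s \<otimes> inv b" using eq G b(1) by (simp add: inv_solve_left m_assoc)
      then have "b \<otimes> t \<otimes> b = inv s" using G b(1) by (simp add: m_assoc)
      then have sq: "(t \<otimes> b) \<otimes> (t \<otimes> b) = t \<otimes> inv s" using G b(1) by (simp add: m_assoc)
      show False
      proof (cases "s = t")
        case True
        then show False using b(3)[OF st(2)] sq G by simp
      next
        case False
        then have "(inv t, t \<otimes> inv s) \<in> D" using st by (force simp: D_def)
        then have "inv (inv t) \<otimes> b \<notin> centralizer G (t \<otimes> inv s)" using b(2) by (auto simp: avoid_def)
        then show False unfolding sq[symmetric] using G b(1) by (simp add: centralizer_def m_assoc)
      qed
    qed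
    have "s = \<one>" if "c \<in> {b, inv b}" "c' \<in> {b, inv b}" "s \<in> F" "t \<in> F" "s \<otimes> c \<otimes> t = c'" for c c' s t
    proof -
      have G: "s \<in> carrier G" "t \<in> carrier G" using that F(2) by auto
      have i: "inv t \<otimes> inv c \<otimes> inv s = inv c'" 
      proof -
        have "c \<in> carrier G" using that(1) b(1) by auto
        then show ?thesis using inv_prod3[OF G(1) _ G(2), of c] that(5) by simp
      qed
      have cc: "c = b \<or> c = inv b" "c' = b \<or> c' = inv b" using that(1,2) by blast+
      consider "c = b" "c' = b" | "c = b" "c' = inv b" | "c = inv b" "c' = b" | "c = inv b" "c' = inv b"
        using cc by blast
      then show ?thesis
      proof cases
        case 1 then show ?thesis using same[OF b(2,1) that(3,4)] that(5) by simp
      next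
        case 2 then show ?thesis using diff[OF that(3,4)] that(5) by simp
      next
        case 3
        have "inv c = b" unfolding 3 using b(1) by simp
        then have "inv t \<otimes> b \<otimes> inv s = inv b" using i unfolding 3(2) by metis
        then show ?thesis using diff F(3) that(3,4) by blast
      next
        case 4
        have "inv c = b" "inv c' = b" unfolding 4 using b(1) by simp_all
        then have "inv t \<otimes> b \<otimes> inv s = b" using i by metis
        then have "inv t = \<one>" using same[OF b(2,1)] F(3) that(3,4) by blast
        then have "t = \<one>" using G by simp
        then have "s \<otimes> inv b = \<one> \<otimes> inv b" using that(5) 4 G b(1) by simp
        then show ?thesis using G b(1) by (metis inv_closed one_closed right_cancel)
      qed
    qed
    then have "switching G F b" using b notF unfolding switching_def by blast
    then show ?thesis by blast
  next
    case False
    \<comment> \<open>Avoiding \<open>D'\<close> means that all translates by elements of \<open>F\<close> avoid \<open>D\<close>.\<close>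
    define D' where "D' = D \<union> (\<lambda>(t, (u, s)). (inv t \<otimes> u, s)) ` (F \<times> D)"
    have "finite D'" "D' \<subseteq> carrier G \<times> (carrier G - {\<one>})"
      using Dfin Dsub F by (auto simp: D'_def)
    then obtain x where x: "x \<in> carrier G" "\<And>u s. (u, s) \<in> D' \<Longrightarrow> inv u \<otimes> x \<notin> centralizer G s"
      using avoid_centralizer_cosets[OF icc, of D'] by blast
    have "avoid x" using x(2) by (auto simp: avoid_def D'_def)
    then obtain t where t: "t \<in> F" "(t \<otimes> x) \<otimes> (t \<otimes> x) = \<one>" using False x(1) by blast
    have tG: "t \<in> carrier G" using t F by auto
    define b where "b = t \<otimes> x"
    have b: "b \<in> carrier G" "inv b = b" using t x(1) tG by (auto simp: b_def intro: inv_equality)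
    have "avoid b"
      unfolding avoid_def
    proof clarify
      fix u s assume us: "(u, s) \<in> D" and c: "inv u \<otimes> b \<in> centralizer G s"
      have uG: "u \<in> carrier G" using us Dsub by auto
      have "(inv t \<otimes> u, s) \<in> D'" using us t(1) by (force simp: D'_def)
      then have "inv (inv t \<otimes> u) \<otimes> x \<notin> centralizer G s" by (rule x(2))
      moreover have "inv (inv t \<otimes> u) \<otimes> x = inv u \<otimes> b"
        using tG uG x(1) by (simp add: b_def inv_mult_group m_assoc)
      ultimately show False using c by simp
    qed
    then have "switching G F b"
      unfolding switching_def b(2) using same[of b] notF[of b] b(1) by auto
    then show ?thesis by blast
  qed
qed

end


section \<open>The forest of a switching sequence\<close>

primrec words :: "('a, 'b) monoid_scheme \<Rightarrow> 'a set \<Rightarrow> nat \<Rightarrow> 'a set" where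
  "words G S 0 = {\<one>\<^bsub>G\<^esub>}"
| "words G S (Suc n) = (\<lambda>(x, s). x \<otimes>\<^bsub>G\<^esub> s) ` (words G S n \<times> S)"

context group
begin

lemma words_subset: "S \<subseteq> carrier G \<Longrightarrow> words G S n \<subseteq> carrier G"
  by (induction n) auto

lemma finite_words: "finite S \<Longrightarrow> finite (words G S n)"
  by (induction n) auto

lemma words_snoc: "x \<in> words G S n \<Longrightarrow> s \<in> S \<Longrightarrow> x \<otimes> s \<in> words G S (Suc n)"
  by auto

lemma words_mult:
  assumes "S \<subseteq> carrier G" "x \<in> words G S m" "y \<in> words G S n"
  shows "x \<otimes> y \<in> words G S (m + n)"
  using assms(3)
proof (induction n arbitrary: y)
  case 0
  have "x \<in> carrier G" using assms(1,2) words_subset by blast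
  then show ?case using 0 assms(2) by simp
next
  case (Suc n)
  then obtain z s where z: "z \<in> words G S n" "s \<in> S" "y = z \<otimes> s" by auto
  have "x \<in> carrier G" "z \<in> carrier G" "s \<in> carrier G"
    using assms(1,2) z words_subset by blast+
  then have "x \<otimes> y = (x \<otimes> z) \<otimes> s" using z by (simp add: m_assoc)
  then show ?case using words_snoc[OF Suc.IH[OF z(1)] z(2)] by simp
qed

lemma words_single: "S \<subseteq> carrier G \<Longrightarrow> s \<in> S \<Longrightarrow> s \<in> words G S 1"
  by (auto simp: image_iff) (metis l_one subsetD)

lemma words_mono_length:
  assumes "\<one> \<in> S" "S \<subseteq> carrier G" "m \<le> n"
  shows "words G S m \<subseteq> words G S n"
  using assms(3)
proof (induction rule: dec_induct)
  case (step n)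
  have "x \<in> words G S (Suc n)" if "x \<in> words G S n" for x
    using words_snoc[OF that assms(1)] words_subset[OF assms(2)] that by (metis r_one subsetD)
  then show ?case using step by blast
qed simp

lemma words_mono_set: "S \<subseteq> S' \<Longrightarrow> words G S n \<subseteq> words G S' n"
  by (induction n) auto

lemma words_inv:
  assumes S: "S \<subseteq> carrier G" "\<And>s. s \<in> S \<Longrightarrow> inv s \<in> S" and x: "x \<in> words G S n"
  shows "inv x \<in> words G S n"
  using x
proof (induction n arbitrary: x)
  case (Suc n)
  then obtain z s where z: "z \<in> words G S n" "s \<in> S" "x = z \<otimes> s" by auto
  have "z \<in> carrier G" "s \<in> carrier G" using S z words_subset by blast+
  then have "inv x = inv s \<otimes> inv z" using z by (simp add: inv_mult_group)
  then show ?case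
    using words_mult[OF S(1) words_single[OF S(1) S(2)[OF z(2)]] Suc.IH[OF z(1)]] by simp
qed simp

end

text \<open>
  The elements \<open>e i\<close> enter the alphabets so that every group element is a letter from some level
  on. The length of the words for which \<open>b m\<close> is switching leaves room for the products of three
  elements of \<open>ball m\<close> below.
\<close>

locale switching_sequence = group G for G (structure) +
  fixes letters :: "nat \<Rightarrow> 'a set" and b e :: "nat \<Rightarrow> 'a"
  assumes letters_0: "letters 0 = {\<one>}"
    and letters_Suc: "letters (Suc m) = letters m \<union> {b m, inv (b m), e m, inv (e m)}"
    and e_range: "range e = carrier G"
    and b_switching: "switching G (words G (letters m) (3 * 4 ^ Suc m)) (b m)"
begin

lemma b_closed: "b m \<in> carrier G"
  using b_switching[of m] by (simp add: switching_def)

lemma e_closed: "e m \<in> carrier G"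
  using e_range by blast

lemma letters_closed: "letters m \<subseteq> carrier G"
  by (induction m) (use b_closed e_closed in \<open>auto simp: letters_0 letters_Suc\<close>)

lemma letters_inv: "s \<in> letters m \<Longrightarrow> inv s \<in> letters m"
  by (induction m) (use b_closed e_closed in \<open>auto simp: letters_0 letters_Suc\<close>)

lemma letters_mono: "m \<le> n \<Longrightarrow> letters m \<subseteq> letters n"
  by (induction rule: dec_induct) (auto simp: letters_Suc)

lemma one_letters: "\<one> \<in> letters m"
  using letters_mono[of 0 m] by (simp add: letters_0)

lemma b_letters: "m < n \<Longrightarrow> {b m, inv (b m)} \<subseteq> letters n"
  using letters_mono[of "Suc m" n] by (auto simp: letters_Suc)

lemma e_letters: "m < n \<Longrightarrow> {e m, inv (e m)} \<subseteq> letters n"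
  using letters_mono[of "Suc m" n] by (auto simp: letters_Suc)

text \<open>
  The length \<open>4 ^ Suc m\<close> is at least \<open>m + 2\<close>, which accommodates \<open>m\<close> steps of a walk, its starting
  point and one left translation, and it grows so fast that \<open>w \<otimes> b m \<otimes> v\<close> with \<open>w\<close> and \<open>v\<close> in
  \<open>ball m\<close> lies in \<open>ball (Suc m)\<close>.
\<close>

definition ball :: "nat \<Rightarrow> 'a set" where
  "ball m = words G (letters m) (4 ^ Suc m)"

text \<open>
  The parent of \<open>z\<close> is the prefix in front of its letter of highest level.
\<close>

definition parent_at :: "nat \<Rightarrow> 'a \<Rightarrow> 'a \<Rightarrow> bool" where
  "parent_at m z w \<longleftrightarrow> w \<in> ball m \<and> (\<exists>c \<in> {b m, inv (b m)}. \<exists>v \<in> ball m. z = w \<otimes> c \<otimes> v)"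

lemma ball_closed: "ball m \<subseteq> carrier G"
  unfolding ball_def by (rule words_subset[OF letters_closed])

lemma ball_inv: "x \<in> ball m \<Longrightarrow> inv x \<in> ball m"
  unfolding ball_def by (rule words_inv[OF letters_closed letters_inv])

lemma words_ball: "k \<le> 4 ^ Suc m \<Longrightarrow> words G (letters m) k \<subseteq> ball m"
  unfolding ball_def by (rule words_mono_length[OF one_letters letters_closed])

lemma ball_mono:
  assumes "m \<le> n"
  shows "ball m \<subseteq> ball n"
proof -
  have "ball m \<subseteq> words G (letters n) (4 ^ Suc m)"
    unfolding ball_def by (rule words_mono_set[OF letters_mono[OF assms]])
  also have "\<dots> \<subseteq> ball n"
    using assms by (intro words_ball power_increasing) auto
  finally show ?thesis .
qed

lemma b_not_in_ball_product:
  assumes c: "c \<in> {b m, inv (b m)}" and x: "x \<in> ball m" "y \<in> ball m" "z \<in> ball m"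
  shows "c \<noteq> x \<otimes> y \<otimes> z"
proof
  let ?F = "words G (letters m) (3 * 4 ^ Suc m)"
  assume "c = x \<otimes> y \<otimes> z"
  moreover have "x \<otimes> y \<otimes> z \<in> words G (letters m) (4 ^ Suc m + 4 ^ Suc m + 4 ^ Suc m)"
    using x unfolding ball_def by (intro words_mult letters_closed)
  ultimately have "c \<in> ?F" by (simp add: numeral_3_eq_3 add.assoc)
  then have "b m \<in> ?F"
    using c words_inv[OF letters_closed letters_inv \<open>c \<in> ?F\<close>] b_closed by auto
  then show False using b_switching[of m] by (simp add: switching_def)
qed

lemma parent_at_ball:
  assumes "parent_at m z w"
  shows "z \<in> ball (Suc m)"
proof -
  obtain c v where c: "c \<in> {b m, inv (b m)}" and v: "v \<in> ball m" and w: "w \<in> ball m" and z: "z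
      = w \<otimes> c \<otimes> v"
    using assms by (auto simp: parent_at_def)
  let ?L = "letters (Suc m)"
  have sub: "ball m \<subseteq> words G ?L (4 ^ Suc m)"
    unfolding ball_def by (rule words_mono_set[OF letters_mono]) simp
  have "c \<in> words G ?L 1" using c b_letters[of m "Suc m"] by (intro words_single letters_closed) auto
  then have "z \<in> words G ?L (4 ^ Suc m + 1 + 4 ^ Suc m)"
    unfolding z using v w sub by (intro words_mult letters_closed) auto
  moreover have "(4::nat) ^ Suc m + 1 + 4 ^ Suc m \<le> 4 ^ Suc (Suc m)" by simp
  ultimately show ?thesis using words_ball[of "4 ^ Suc m + 1 + 4 ^ Suc m" "Suc m"] by blast
qed

lemma parent_at_not_ball:
  assumes "parent_at m z w"
  shows "z \<notin> ball m"
proof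
  assume zb: "z \<in> ball m"
  obtain c v where c: "c \<in> {b m, inv (b m)}" and v: "v \<in> ball m" and w: "w \<in> ball m" and z: "z
      = w \<otimes> c \<otimes> v"
    using assms by (auto simp: parent_at_def)
  have G: "c \<in> carrier G" "v \<in> carrier G" "w \<in> carrier G" using c v w b_closed ball_closed by auto
  have "c = inv w \<otimes> z \<otimes> inv v" unfolding z using G by (simp add: m_assoc cancel_inv_left)
  then show False using b_not_in_ball_product[OF c ball_inv[OF w] zb ball_inv[OF v]] by simp
qed

lemma parent_at_level:
  assumes "parent_at m z w" "z \<in> ball n"
  shows "m < n"
  using parent_at_not_ball[OF assms(1)] assms(2) ball_mono[of n m] by (meson not_le subsetD)

text \<open>
  Elements with a parent at level \<open>m\<close> lie in \<open>ball (Suc m)\<close> but not in \<open>ball m\<close>, so the level is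
  determined; at a fixed level, the prefix is determined because \<open>b m\<close> is switching. Hence the
  parent relation is a forest.
\<close>

lemma parent_at_unique:
  assumes z: "parent_at m z w" "parent_at m' z w'"
  shows "m = m'" "w = w'"
proof -
  have "m < Suc m'" "m' < Suc m"
    using parent_at_level parent_at_ball z by blast+
  then show m: "m = m'" by simp
  obtain c v where c: "c \<in> {b m, inv (b m)}" and v: "v \<in> ball m" and w: "w \<in> ball m" and eq: "z
      = w \<otimes> c \<otimes> v"
    using z by (auto simp: parent_at_def)
  obtain c' v' where c': "c' \<in> {b m, inv (b m)}" and v': "v' \<in> ball m" and w': "w' \<in> ball m"
      and eq': "z = w' \<otimes> c' \<otimes> v'"
    using z m by (auto simp: parent_at_def)
  have G: "c \<in> carrier G" "v \<in> carrier G" "w \<in> carrier G" "c' \<in> carrier G" "v' \<in> carrier G" "w' \<in>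
      carrier G"
    using c v w c' v' w' b_closed ball_closed by auto
  let ?F = "words G (letters m) (3 * 4 ^ Suc m)"
  have ball2: "x \<otimes> y \<in> ?F" if "x \<in> ball m" "y \<in> ball m" for x y
  proof -
    have "x \<otimes> y \<in> words G (letters m) (4 ^ Suc m + 4 ^ Suc m)"
      using that unfolding ball_def by (intro words_mult letters_closed)
    then show ?thesis
      using words_mono_length[OF one_letters letters_closed, of "4 ^ Suc m
          + 4 ^ Suc m" "3 * 4 ^ Suc m" m] by auto
  qed
  have "(inv w' \<otimes> w) \<otimes> c \<otimes> (v \<otimes> inv v') = inv w' \<otimes> (w \<otimes> c \<otimes> v) \<otimes> inv v'"
    using G by (simp add: m_assoc)
  also have "\<dots> = c'" unfolding eq[symmetric] eq' using G by (simp add: m_assoc cancel_inv_left)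
  finally have "inv w' \<otimes> w = \<one>"
    using b_switching[of m] c c' ball2[OF ball_inv[OF w'] w] ball2[OF v ball_inv[OF v']]
    unfolding switching_def by blast
  then show "w = w'" using G by (metis inv_closed inv_equality inv_inv)
qed

definition ancestor :: "'a \<Rightarrow> 'a \<Rightarrow> bool" where
  "ancestor = (\<lambda>z w. \<exists>m. parent_at m z w)\<^sup>+\<^sup>+"

lemma ancestor_parent: "parent_at m z w \<Longrightarrow> ancestor z w"
  unfolding ancestor_def by auto

lemma ancestor_parent_trans: "parent_at m z y \<Longrightarrow> ancestor y w \<Longrightarrow> ancestor z w"
  unfolding ancestor_def by (rule tranclp_into_tranclp2) auto

lemma ancestor_level:
  assumes "ancestor u a" "parent_at m u x" "parent_at m' a y"
  shows "m' < m"
  using assms unfolding ancestor_def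
proof (induction arbitrary: y m' rule: tranclp_induct)
  case (base a)
  then obtain k where "parent_at k u a" by blast
  then have "parent_at m u a" using parent_at_unique base.prems(1) by metis
  then show ?case using parent_at_level base.prems(2) by (auto simp: parent_at_def)
next
  case (step a a')
  then obtain k where k: "parent_at k a a'" by blast
  then have "m' < k" using parent_at_level step.prems(2) by (auto simp: parent_at_def)
  then show ?case using step.IH[OF step.prems(1) k] by simp
qed

lemma ancestor_comparable:
  assumes "ancestor u a" "ancestor u a'"
  shows "a = a' \<or> ancestor a a' \<or> ancestor a' a"
  using assms unfolding ancestor_def
proof (induction rule: tranclp_induct)
  case (base a)
  obtain z where z: "\<exists>m. parent_at m u z" "(\<lambda>z w. \<exists>m. parent_at m z w)\<^sup>*\<^sup>* z a'"
    using tranclpD[OF base.prems] by blast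
  have "z = a" using base.hyps z(1) parent_at_unique(2) by blast
  then show ?case using rtranclpD[OF z(2)] by blast
next
  case (step a y)
  let ?R = "\<lambda>z w. \<exists>m. parent_at m z w"
  consider "a = a'" | "?R\<^sup>+\<^sup>+ a a'" | "?R\<^sup>+\<^sup>+ a' a" using step.IH[OF step.prems] by blast
  then show ?case
  proof cases
    case 1
    then show ?thesis using step.hyps(2) by auto
  next
    case 2
    obtain z where z: "?R a z" "?R\<^sup>*\<^sup>* z a'" using tranclpD[OF 2] by blast
    have "z = y" using step.hyps(2) z(1) parent_at_unique(2) by blast
    then show ?thesis using rtranclpD[OF z(2)] by blast
  next
    case 3
    then have "?R\<^sup>+\<^sup>+ a' y" using step.hyps(2) by (rule tranclp.trancl_into_trancl)
    then show ?thesis by blast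
  qed
qed

text \<open>
  At time \<open>t\<close>, the increment with index \<open>\<tau>\<close> holds the record level \<open>m\<close>: all others lie in the
  alphabet below this level, and there are so few of them that their products lie in \<open>ball m\<close>.
\<close>

definition records_at :: "(nat \<Rightarrow> 'a) \<Rightarrow> nat \<Rightarrow> nat \<Rightarrow> nat \<Rightarrow> bool" where
  "records_at q t \<tau> m \<longleftrightarrow> \<tau> < t \<and> t \<le> m \<and> q \<tau> \<in> {b m, inv (b m)} \<and>
     (\<forall>i<t. i \<noteq> \<tau> \<longrightarrow> q i \<in> letters m)"

lemma b_in_letters:
  assumes "c \<in> {b m, inv (b m)}" "c \<in> letters n"
  shows "m < n"
proof (rule ccontr)
  assume "\<not> m < n"
  then have "c \<in> letters m" using assms(2) letters_mono[of n m] by auto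
  then have "c \<in> words G (letters m) 1" by (rule words_single[OF letters_closed])
  then have "c \<in> ball m" using words_ball[of 1 m] by auto
  moreover have "\<one> \<in> ball m" using words_ball[of 0 m] by auto
  ultimately have "c \<noteq> c \<otimes> \<one> \<otimes> \<one>" using b_not_in_ball_product[OF assms(1)] by blast
  then show False using assms(1) b_closed by auto
qed

lemma b_inj:
  assumes "c \<in> {b m, inv (b m)}" "c \<in> {b n, inv (b n)}"
  shows "m = n"
proof -
  have "c \<in> letters (Suc n)" "c \<in> letters (Suc m)"
    using assms b_letters[of n "Suc n"] b_letters[of m "Suc m"] by auto
  then have "m < Suc n" "n < Suc m" using assms b_in_letters by blast+
  then show ?thesis by simp
qed

lemma walk_closed:
  assumes "\<And>i. q i \<in> carrier G" "h \<in> carrier G"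
  shows "walk G h q t \<in> carrier G"
  by (induction t) (use assms in auto)

lemma walk_words:
  assumes "h \<in> letters m" "\<And>i. i < t \<Longrightarrow> q i \<in> letters m"
  shows "walk G h q t \<in> words G (letters m) (Suc t)"
  using assms(2)
proof (induction t)
  case 0
  then show ?case using words_single[OF letters_closed assms(1)] by simp
next
  case (Suc t)
  then show ?case using words_snoc[of "walk G h q t" "letters m" "Suc t" "q t"] by simp
qed

lemma walk_tail_words:
  assumes q: "\<And>i. q i \<in> carrier G" and h: "h \<in> carrier G"
    and l: "\<And>i. \<tau> < i \<Longrightarrow> i < Suc \<tau> + k \<Longrightarrow> q i \<in> letters m"
  shows "\<exists>v \<in> words G (letters m) k. walk G h q (Suc \<tau> + k) = walk G h q \<tau> \<otimes> q \<tau> \<otimes> v"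
  using l
proof (induction k)
  case 0
  then show ?case using walk_closed[OF q h] q by simp
next
  case (Suc k)
  then obtain v where v: "v \<in> words G (letters m) k"
    "walk G h q (Suc \<tau> + k) = walk G h q \<tau> \<otimes> q \<tau> \<otimes> v" by auto
  have "v \<in> carrier G" using v words_subset[OF letters_closed] by blast
  then have "walk G h q (Suc \<tau> + Suc k) = walk G h q \<tau> \<otimes> q \<tau> \<otimes> (v \<otimes> q (Suc \<tau> + k))"
    using v(2) walk_closed[OF q h] q by (simp add: m_assoc)
  then show ?case
    by (rule bexI[OF _ words_snoc[OF v(1)]]) (use Suc.prems in auto)
qed

text \<open>
  The parent of the position at time \<open>t\<close> is the position just before the record, and this persists
  under a left translation.
\<close>

lemma record_parent:
  assumes q: "\<And>i. q i \<in> carrier G" and h: "h \<in> letters t" and \<gamma>: "\<gamma> \<in> letters t"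
    and rec: "records_at q t \<tau> m"
  shows "parent_at m (\<gamma> \<otimes> walk G h q t) (\<gamma> \<otimes> walk G h q \<tau>)"
proof -
  have r: "\<tau> < t" "t \<le> m" "q \<tau> \<in> {b m, inv (b m)}" "\<And>i. i < t \<Longrightarrow> i \<noteq> \<tau> \<Longrightarrow> q i \<in> letters m"
    using rec by (auto simp: records_at_def)
  have hm: "h \<in> letters m" "\<gamma> \<in> letters m" using h \<gamma> letters_mono[OF r(2)] by auto
  then have G: "h \<in> carrier G" "\<gamma> \<in> carrier G" using letters_closed by auto
  have pow: "Suc (Suc m) \<le> 4 ^ Suc m"
  proof (induction m)
    case (Suc m)
    then show ?case by simp
  qed simp
  have "walk G h q \<tau> \<in> words G (letters m) (Suc \<tau>)"
    using r by (intro walk_words hm) auto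
  then have "\<gamma> \<otimes> walk G h q \<tau> \<in> words G (letters m) (1 + Suc \<tau>)"
    by (intro words_mult letters_closed words_single hm)
  then have w: "\<gamma> \<otimes> walk G h q \<tau> \<in> ball m"
    using words_ball[of "1 + Suc \<tau>" m] pow r by (auto simp del: words.simps)
  obtain k where k: "t = Suc \<tau> + k" using r(1) less_imp_Suc_add by auto
  have "\<exists>v \<in> words G (letters m) k. walk G h q (Suc \<tau> + k) = walk G h q \<tau> \<otimes> q \<tau> \<otimes> v"
    using r(4) k by (intro walk_tail_words q G) auto
  then obtain v where v: "v \<in> words G (letters m) k" "walk G h q t = walk G h q \<tau> \<otimes> q \<tau> \<otimes> v"
    using k by blast
  have vb: "v \<in> ball m" using v(1) words_ball[of k m] pow r(2) k by auto
  have "\<gamma> \<otimes> walk G h q t = (\<gamma> \<otimes> walk G h q \<tau>) \<otimes> q \<tau> \<otimes> v"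
    using v(2) G q walk_closed[OF q G(1)] vb ball_closed by (simp add: m_assoc subset_iff)
  then show ?thesis using w vb r(3) unfolding parent_at_def by blast
qed

text \<open>
  Two record indices that are both smaller than \<open>t\<close> must agree, since otherwise the level of each
  would be smaller than the level of the other.
\<close>

lemma record_Suc:
  assumes "records_at q t \<tau> m" "records_at q (Suc t) \<tau>' m'"
  shows "\<tau>' = \<tau> \<or> \<tau>' = t"
proof (rule ccontr)
  assume neg: "\<not> ?thesis"
  then have "\<tau>' < t" using assms(2) by (auto simp: records_at_def)
  then have "q \<tau>' \<in> letters m" "q \<tau> \<in> letters m'"
    using assms neg by (auto simp: records_at_def)
  then have "m' < m" "m < m'"
    using assms b_in_letters unfolding records_at_def by blast+
  then show False by simp
qed

text \<open>
  The position \<open>w\<close> before a late record is an ancestor of all later positions \<open>z\<^sub>t\<close>, and likewise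
  \<open>\<gamma> \<otimes> w\<close> of \<open>\<gamma> \<otimes> z\<^sub>t\<close>. If \<open>w\<close> were also an ancestor of \<open>\<gamma> \<otimes> z\<^sub>t\<close>, then \<open>w\<close> and \<open>\<gamma> \<otimes> w\<close> would be
  comparable in the forest; but both have their parent at the same level, and levels drop strictly
  along ancestors, so they would be equal.
\<close>

lemma records_separate:
  assumes q: "\<And>i. q i \<in> carrier G" and h: "h \<in> carrier G" and \<gamma>: "\<gamma> \<in> carrier G" "\<gamma> \<noteq> \<one>"
    and ev: "eventually (\<lambda>t. \<exists>\<tau> m. records_at q t \<tau> m) sequentially"
  shows "\<exists>w \<in> carrier G. eventually (\<lambda>t. ancestor (walk G h q t) w) sequentially \<and>
           \<not> eventually (\<lambda>t. ancestor (\<gamma> \<otimes> walk G h q t) w) sequentially"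
proof -
  let ?z = "walk G h q"
  obtain T0 where T0: "\<And>t. t \<ge> T0 \<Longrightarrow> \<exists>\<tau> m. records_at q t \<tau> m" using ev
      by (auto simp: eventually_sequentially)
  obtain i j where ij: "h = e i" "\<gamma> = e j" using h \<gamma> e_range by (metis rangeE)
  define T where "T = Max {T0, Suc i, Suc j}"
  have T: "T0 \<le> T" "i < T" "j < T" by (auto simp: T_def less_Suc_eq_le[symmetric] less_max_iff_disj)
  have hl: "h \<in> letters t" "\<gamma> \<in> letters t" "\<one> \<in> letters t" if "t \<ge> T" for t
    using ij e_letters[of i t] e_letters[of j t] T that one_letters by auto
  have rec: "\<exists>\<tau> m. records_at q t \<tau> m" if "t \<ge> T" for t using T0 T that by auto
  obtain \<tau>s ms where s: "records_at q T \<tau>s ms" using rec by blast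
  \<comment> \<open>The level of the record at time \<open>t1\<close> exceeds all levels that occur before time \<open>T\<close>,
    so this record is set at a time \<open>\<tau>1 \<ge> T\<close>, and \<open>w\<close> itself has a parent.\<close>
  define t1 where "t1 = max T (Suc ms)"
  obtain \<tau>1 m1 where r1: "records_at q t1 \<tau>1 m1" using rec[of t1] by (auto simp: t1_def)
  have \<tau>1: "\<tau>1 \<ge> T"
  proof (rule ccontr)
    assume neg: "\<not> T \<le> \<tau>1"
    have m1: "ms < m1" using r1 by (auto simp: records_at_def t1_def)
    have c: "q \<tau>1 \<in> {b m1, inv (b m1)}" using r1 by (simp add: records_at_def)
    show False
    proof (cases "\<tau>1 = \<tau>s")
      case True
      then have "m1 = ms" using s c b_inj by (auto simp: records_at_def)
      then show False using m1 by simp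
    next
      case False
      then have "q \<tau>1 \<in> letters ms" using s neg by (auto simp: records_at_def)
      then show False using b_in_letters[OF c] m1 by fastforce
    qed
  qed
  obtain \<tau>0 m0 where r0: "records_at q \<tau>1 \<tau>0 m0" using rec[OF \<tau>1] by blast
  define w where "w = ?z \<tau>1"
  have zG: "?z t \<in> carrier G" for t by (rule walk_closed[OF q h])
  have wG: "w \<in> carrier G" by (simp add: w_def zG)
  have anc: "ancestor (\<delta> \<otimes> ?z t) (\<delta> \<otimes> w)"
    if \<delta>: "\<And>t. t \<ge> T \<Longrightarrow> \<delta> \<in> letters t" and t: "t \<ge> t1" for \<delta> t
  proof -
    have par: "parent_at m (\<delta> \<otimes> ?z t) (\<delta> \<otimes> ?z \<tau>)" if "records_at q t \<tau> m" "t \<ge> T" for t \<tau> m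
      by (rule record_parent[OF q hl(1)[OF that(2)] \<delta>[OF that(2)] that(1)])
    have "\<exists>\<tau> m. records_at q t \<tau> m \<and> (\<tau> = \<tau>1 \<or> ancestor (\<delta> \<otimes> ?z \<tau>) (\<delta> \<otimes> w))"
      using t
    proof (induction t rule: dec_induct)
      case base
      then show ?case using r1 by blast
    next
      case (step t)
      then obtain \<tau> m where \<tau>: "records_at q t \<tau> m" "\<tau> = \<tau>1 \<or> ancestor (\<delta> \<otimes> ?z \<tau>) (\<delta> \<otimes> w)" by blast
      have tT: "t \<ge> T" using step.hyps by (simp add: t1_def)
      obtain \<tau>' m' where \<tau>': "records_at q (Suc t) \<tau>' m'" using rec[of "Suc t"] tT by auto
      from record_Suc[OF \<tau>(1) \<tau>'] show ?case
      proof
        assume "\<tau>' = \<tau>"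
        then show ?thesis using \<tau> \<tau>' by blast
      next
        assume "\<tau>' = t"
        moreover have "ancestor (\<delta> \<otimes> ?z t) (\<delta> \<otimes> w)"
          using par[OF \<tau>(1) tT] \<tau>(2) ancestor_parent ancestor_parent_trans by (auto simp: w_def)
        ultimately show ?thesis using \<tau>' by blast
      qed
    qed
    then obtain \<tau> m where \<tau>: "records_at q t \<tau> m" "\<tau> = \<tau>1 \<or> ancestor (\<delta> \<otimes> ?z \<tau>) (\<delta> \<otimes> w)" by blast
    have "t \<ge> T" using t by (simp add: t1_def)
    from par[OF \<tau>(1) this] \<tau>(2) show ?thesis
      using ancestor_parent ancestor_parent_trans by (auto simp: w_def)
  qed
  have p0: "parent_at m0 (\<delta> \<otimes> w) (\<delta> \<otimes> ?z \<tau>0)" if "\<delta> \<in> letters \<tau>1" for \<delta>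
    unfolding w_def by (rule record_parent[OF q hl(1)[OF \<tau>1] that r0])
  have "parent_at m0 w (?z \<tau>0)" using p0[of \<one>] hl(3)[OF \<tau>1] wG zG by simp
  note pw = this p0[OF hl(2)[OF \<tau>1]]
  have "ancestor (?z t) w" if "t \<ge> t1" for t
    using anc[of \<one>, OF hl(3) that] wG zG by simp
  then have A: "eventually (\<lambda>t. ancestor (?z t) w) sequentially"
    by (auto simp: eventually_sequentially)
  have "\<not> ancestor (\<gamma> \<otimes> ?z t) w" if "t \<ge> t1" for t
  proof
    assume "ancestor (\<gamma> \<otimes> ?z t) w"
    moreover have "ancestor (\<gamma> \<otimes> ?z t) (\<gamma> \<otimes> w)" by (rule anc[OF hl(2) that])
    ultimately consider "w = \<gamma> \<otimes> w" | "ancestor w (\<gamma> \<otimes> w)" | "ancestor (\<gamma> \<otimes> w) w"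
      using ancestor_comparable by blast
    then show False
    proof cases
      case 1
      then have "\<one> \<otimes> w = \<gamma> \<otimes> w" using wG by simp
      then show False using \<gamma> wG by (metis one_closed right_cancel)
    next
      case 2
      then show False using ancestor_level[OF 2 pw(1,2)] by simp
    next
      case 3
      then show False using ancestor_level[OF 3 pw(2,1)] by simp
    qed
  qed
  then have "\<not> eventually (\<lambda>t. ancestor (\<gamma> \<otimes> ?z t) w) sequentially"
    unfolding eventually_sequentially by (metis nle_le)
  then show ?thesis using A wG by blast
qed

end

lemma (in group) switching_sequence_exists:
  assumes icc: "FC_centre G = {\<one>}" and nontriv: "carrier G \<noteq> {\<one>}" and e: "range e = carrier G"
  shows "\<exists>letters b. switching_sequence G letters b e"
proof -
  define step where "step m L c = L \<union> {c, inv c, e m, inv (e m)}" for m :: nat and L :: "'a set" and c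
  define ok where "ok m = (\<lambda>(L, c). finite L \<and> L \<subseteq> carrier G \<and> (\<forall>s \<in> L. inv s \<in> L) \<and>
     switching G (words G L (3 * 4 ^ Suc m)) c \<and> (m = 0 \<longrightarrow> L = {\<one>}))" for m
  have eG: "e m \<in> carrier G" for m using e by blast
  have ex: "\<exists>c. switching G (words G L k) c" if "finite L" "L \<subseteq> carrier G" "\<forall>s \<in> L. inv s \<in> L" for L k
    using that by (intro switching_exists[OF icc nontriv] finite_words words_subset words_inv) auto
  have "\<exists>f. \<forall>m. ok m (f m) \<and> fst (f (Suc m)) = step m (fst (f m)) (snd (f m))"
  proof (rule dependent_nat_choice)
    obtain c where "switching G (words G {\<one>} (3 * 4 ^ Suc 0)) c" using ex[of "{\<one>}"] by auto
    then have "ok 0 ({\<one>}, c)" by (simp add: ok_def)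
    then show "\<exists>x. ok 0 x" by blast
  next
    fix x m assume x: "ok m x"
    obtain L c where Lc: "x = (L, c)" by (cases x)
    have c: "c \<in> carrier G" using x by (auto simp: ok_def Lc switching_def)
    let ?L = "step m L c"
    have L: "finite ?L" "?L \<subseteq> carrier G" "\<forall>s \<in> ?L. inv s \<in> ?L"
      using x c eG by (auto simp: ok_def Lc step_def)
    obtain c' where "switching G (words G ?L (3 * 4 ^ Suc (Suc m))) c'" using ex[OF L] by blast
    then have "ok (Suc m) (?L, c')" unfolding ok_def using L by blast
    then show "\<exists>y. ok (Suc m) y \<and> fst y = step m (fst x) (snd x)" by (auto simp: Lc)
  qed
  then obtain f where f: "\<And>m. ok m (f m)" "\<And>m. fst (f (Suc m)) = step m (fst (f m)) (snd (f m))"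
      by blast
  have "switching_sequence G (\<lambda>m. fst (f m)) (\<lambda>m. snd (f m)) e"
  proof
    show "fst (f 0) = {\<one>}" using f(1)[of 0] by (auto simp: ok_def split: prod.splits)
    show "fst (f (Suc m)) = fst (f m) \<union> {snd (f m), inv (snd (f m)), e m, inv (e m)}" for m
      using f(2)[of m] by (simp add: step_def)
    show "switching G (words G (fst (f m)) (3 * 4 ^ Suc m)) (snd (f m))" for m
      using f(1)[of m] by (auto simp: ok_def split: prod.splits)
  qed (rule e)
  then show ?thesis by blast
qed


section \<open>Heavy-tailed levels and entropy\<close>

text \<open>
  The distribution of the levels, given by its tail. The exponent is small enough for a record
  among the first \<open>t\<close> levels to exceed \<open>t ^ 3\<close> with overwhelming probability, and the single
  probabilities decay faster than \<open>m powr (-6/5)\<close>, so that ties among the levels above \<open>t ^ 3\<close> are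
  rare.
\<close>

definition heavy_tail :: "nat \<Rightarrow> real" where
  "heavy_tail n = real (Suc n) powr (-1/4)"

lemma heavy_tail_decreasing: "heavy_tail (Suc n) < heavy_tail n"
  unfolding heavy_tail_def by (intro powr_less_mono2_neg) auto

lemma heavy_tail_tendsto: "heavy_tail \<longlonglongrightarrow> 0"
  unfolding heavy_tail_def by real_asymp

lemma heavy_sums: "(\<lambda>n. heavy_tail n - heavy_tail (Suc n)) sums 1"
  using telescope_sums'[OF heavy_tail_tendsto] by (simp add: heavy_tail_def)

definition heavy_pmf :: "nat pmf" where
  "heavy_pmf = embed_pmf (\<lambda>n. heavy_tail n - heavy_tail (Suc n))"

lemma pmf_heavy: "pmf heavy_pmf n = heavy_tail n - heavy_tail (Suc n)"
  unfolding heavy_pmf_def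
proof (rule pmf_embed_pmf)
  show "0 \<le> heavy_tail n - heavy_tail (Suc n)" for n using heavy_tail_decreasing[of n] by simp
  then show "(\<integral>\<^sup>+ n. ennreal (heavy_tail n - heavy_tail (Suc n)) \<partial>count_space UNIV) = 1"
    using heavy_sums by (simp add: nn_integral_count_space_nat suminf_ennreal2 sums_iff)
qed

lemma pmf_heavy_pos: "pmf heavy_pmf n > 0"
  using heavy_tail_decreasing[of n] by (simp add: pmf_heavy)

lemma measure_pmf_atLeast:
  "measure_pmf.prob p {M..} = 1 - (\<Sum>n<M. pmf p n)" for p :: "nat pmf"
proof -
  have "measure_pmf.prob p {..<M} = (\<Sum>n<M. pmf p n)"
    by (rule measure_measure_pmf_finite) simp
  moreover have "measure_pmf.prob p (UNIV - {..<M}) = 1 - measure_pmf.prob p {..<M}"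
    using measure_pmf.prob_compl[of "{..<M}" p] by simp
  moreover have "UNIV - {..<M} = {M..}" by auto
  ultimately show ?thesis by simp
qed

lemma heavy_prob_atLeast: "measure_pmf.prob heavy_pmf {M..} = heavy_tail M"
proof -
  have "(\<Sum>n<M. pmf heavy_pmf n) = heavy_tail 0 - heavy_tail M"
    unfolding pmf_heavy by (induction M) simp_all
  then show ?thesis by (simp add: measure_pmf_atLeast heavy_tail_def)
qed

lemma geometric_prob_atLeast: "measure_pmf.prob (geometric_pmf (1/2)) {M..} = (1/2)^M"
proof -
  have "(\<Sum>n<M. pmf (geometric_pmf (1/2)) n) = 1 - (1/2)^M"
    by (induction M) (simp_all add: field_simps)
  then show ?thesis by (simp add: measure_pmf_atLeast)
qed

lemma integrable_measure_pmf_nat: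
  fixes p :: "nat pmf" and f :: "nat \<Rightarrow> real"
  assumes "summable (\<lambda>n. pmf p n * \<bar>f n\<bar>)"
  shows "integrable (measure_pmf p) f"
  unfolding measure_pmf_eq_density
  by (subst integrable_density) (use assms in \<open>auto simp: integrable_count_space_nat_iff abs_mult\<close>)

lemma integrable_ln_heavy: "integrable (measure_pmf heavy_pmf) (\<lambda>n. ln (pmf heavy_pmf n))"
proof (rule integrable_measure_pmf_nat, rule summable_comparison_test_bigo)
  show "summable (\<lambda>n. norm (real n powr (-9/8)))"
    by (simp add: summable_real_powr_iff)
  show "(\<lambda>n. pmf heavy_pmf n * \<bar>ln (pmf heavy_pmf n)\<bar>) \<in> O(\<lambda>n. real n powr (-9/8))"
    unfolding pmf_heavy heavy_tail_def by real_asymp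
qed

lemma integrable_ln_geometric:
  "integrable (measure_pmf (geometric_pmf (1/2))) (\<lambda>n. ln (pmf (geometric_pmf (1/2)) n))"
proof (rule integrable_measure_pmf_nat, rule summable_comparison_test_bigo)
  show "summable (\<lambda>n. norm (real n powr (-2)))"
    by (simp add: summable_real_powr_iff)
  have "(\<lambda>n. (1/2::real) ^ n * (1/2) * \<bar>ln ((1/2) ^ n * (1/2))\<bar>) \<in> O(\<lambda>n. real n powr (-2))"
    by real_asymp
  then show "(\<lambda>n. pmf (geometric_pmf (1/2)) n * \<bar>ln (pmf (geometric_pmf (1/2)) n)\<bar>) \<in> O(\<lambda>n. real n
      powr (-2))"
    by simp
qed

text \<open>
  The probability of \<open>f l\<close> is at least the probability of \<open>l\<close>, so an image distribution has no
  larger entropy.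
\<close>

lemma finite_entropy_map_pmf:
  assumes L: "integrable (measure_pmf L) (\<lambda>l. ln (pmf L l))"
  shows "finite_entropy G (map_pmf f L)"
proof -
  let ?\<mu> = "map_pmf f L"
  have le: "pmf L l \<le> pmf ?\<mu> (f l)" for l
  proof -
    have "pmf L l = measure_pmf.prob L {l}" by (simp add: measure_pmf_single)
    also have "\<dots> \<le> measure_pmf.prob L (f -` {f l})" by (rule measure_pmf.finite_measure_mono) auto
    also have "\<dots> = pmf ?\<mu> (f l)" by (simp add: pmf_map)
    finally show ?thesis .
  qed
  have "integrable (measure_pmf L) (\<lambda>l. ln (pmf ?\<mu> (f l)))"
  proof (rule Bochner_Integration.integrable_bound[OF L])
    show "AE l in measure_pmf L. norm (ln (pmf ?\<mu> (f l))) \<le> norm (ln (pmf L l))"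
      unfolding AE_measure_pmf_iff
    proof
      fix l assume "l \<in> set_pmf L"
      then have "0 < pmf L l" by (simp add: pmf_positive_iff)
      then have "ln (pmf L l) \<le> ln (pmf ?\<mu> (f l))" "ln (pmf ?\<mu> (f l)) \<le> 0"
        using le[of l] pmf_le_1[of ?\<mu> "f l"] by auto
      then show "norm (ln (pmf ?\<mu> (f l))) \<le> norm (ln (pmf L l))" by simp
    qed
  qed simp
  then have "integrable (measure_pmf ?\<mu>) (\<lambda>g. ln (pmf ?\<mu> g))" by simp
  then have "integrable (density (count_space UNIV) (pmf ?\<mu>)) (\<lambda>g. ln (pmf ?\<mu> g))"
    by (simp only: measure_pmf_eq_density)
  then have "integrable (count_space UNIV) (\<lambda>g. pmf ?\<mu> g * ln (pmf ?\<mu> g))"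
    by (subst (asm) integrable_density) auto
  then have "Infinite_Set_Sum.abs_summable_on (\<lambda>g. pmf ?\<mu> g * ln (pmf ?\<mu> g)) UNIV"
    by (simp add: Infinite_Set_Sum.abs_summable_on_def)
  then have "(\<lambda>g. pmf ?\<mu> g * ln (pmf ?\<mu> g)) summable_on UNIV"
    using abs_summable_equivalent abs_summable_summable by blast
  then have "(\<lambda>g. - (pmf ?\<mu> g * ln (pmf ?\<mu> g))) summable_on UNIV"
    by (simp add: summable_on_uminus)
  then show ?thesis
    unfolding finite_entropy_def by (rule summable_on_subset_banach) simp
qed

text \<open>
  A label consists of a level \<open>n\<close>, an index \<open>k\<close>, and two fair bits, which select one of the
  letters \<open>b n\<close> and \<open>e k\<close> and its sign.
\<close>

definition label_pmf :: "((nat \<times> nat) \<times> (bool \<times> bool)) pmf" where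
  "label_pmf = pair_pmf (pair_pmf heavy_pmf (geometric_pmf (1/2)))
     (pair_pmf (bernoulli_pmf (1/2)) (bernoulli_pmf (1/2)))"

lemma integrable_ln_label: "integrable (measure_pmf label_pmf) (\<lambda>l. ln (pmf label_pmf l))"
proof -
  let ?g = "geometric_pmf (1/2)"
  have eq: "ln (pmf label_pmf l) = ln (pmf heavy_pmf (fst (fst l))) + ln (pmf ?g (snd (fst l)))
      + ln (1/4)" for l
  proof -
    obtain n k i j where l: "l = ((n, k), (i, j))" by (metis prod.exhaust)
    have c: "pmf (bernoulli_pmf (1/2)) i = 1/2" for i by (cases i) simp_all
    have mult: "ln (x * y * (1/2 * (1/2))) = ln x + ln y + ln (1/4)" if "x > 0" "y > 0" for x y :: real
      using that ln_mult[of "x * y" "1/4"] by (simp add: ln_mult)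
    have "pmf ?g k > 0" by simp
    then show ?thesis using mult[OF pmf_heavy_pos[of n], of "pmf ?g k"]
      unfolding l label_pmf_def pmf_pair c by simp
  qed
  have "map_pmf (\<lambda>l. fst (fst l)) label_pmf = heavy_pmf" "map_pmf (\<lambda>l. snd (fst l)) label_pmf = ?g"
    unfolding label_pmf_def by (simp_all flip: map_pmf_comp add: map_fst_pair_pmf map_snd_pair_pmf)
  then have "integrable (measure_pmf label_pmf) (\<lambda>l. ln (pmf heavy_pmf (fst (fst l))))"
    "integrable (measure_pmf label_pmf) (\<lambda>l. ln (pmf ?g (snd (fst l))))"
    using integrable_ln_heavy integrable_ln_geometric
      integrable_map_pmf_eq[of "\<lambda>l. fst (fst l)" label_pmf "\<lambda>n. ln (pmf heavy_pmf n)"]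
      integrable_map_pmf_eq[of "\<lambda>l. snd (fst l)" label_pmf "\<lambda>n. ln (pmf ?g n)"] by simp_all
  then show ?thesis unfolding eq by auto
qed

text \<open>
  For large \<open>t\<close>, the summands bound the probabilities, up to time \<open>t\<close>, that no level reaches
  \<open>t ^ 3\<close>, that two increments have the same level of at least \<open>t ^ 3\<close>, and that an element \<open>e k\<close>
  with \<open>k \<ge> t ^ 3\<close> occurs.
\<close>

definition record_bound :: "nat \<Rightarrow> real" where
  "record_bound t = (1 - heavy_tail (t ^ 3) / 2) ^ t
     + real t ^ 2 * (real t ^ 3) powr (-6/5) + real t * (1/2) ^ t"

lemma summable_record_bound: "summable record_bound"
proof (rule summable_comparison_test_bigo)
  show "summable (\<lambda>t. norm (real t powr (-8/5)))"
    by (simp add: summable_real_powr_iff)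
  have "(\<lambda>t. (1 - heavy_tail (t ^ 3) / 2) ^ t) \<in> O(\<lambda>t. exp (- (heavy_tail (t ^ 3) / 2) * real t))"
  proof (rule bigoI[of _ 1], rule always_eventually, rule allI)
    fix t
    have h: "heavy_tail (t ^ 3) \<le> 1" "heavy_tail (t ^ 3) \<ge> 0"
      using powr_mono2'[of "-1/4" 1 "real (Suc (t ^ 3))"] by (simp_all add: heavy_tail_def)
    have "(1 - heavy_tail (t ^ 3) / 2) ^ t \<le> exp (- (heavy_tail (t ^ 3) / 2)) ^ t"
      using h exp_ge_add_one_self[of "- (heavy_tail (t ^ 3) / 2)"] by (intro power_mono) auto
    also have "\<dots> = exp (- (heavy_tail (t ^ 3) / 2) * real t)"
      by (simp add: exp_of_nat_mult[symmetric] mult.commute)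
    finally show "norm ((1 - heavy_tail (t ^ 3) / 2) ^ t) \<le> 1 * norm (exp (- (heavy_tail (t ^ 3) /
        2) * real t))"
      using h by simp
  qed
  also have "(\<lambda>t. exp (- (heavy_tail (t ^ 3) / 2) * real t)) \<in> O(\<lambda>t. real t powr (-8/5))"
    unfolding heavy_tail_def by real_asymp
  finally have 1: "(\<lambda>t. (1 - heavy_tail (t ^ 3) / 2) ^ t) \<in> O(\<lambda>t. real t powr (-8/5))" .
  have 2: "(\<lambda>t. real t ^ 2 * (real t ^ 3) powr (-6/5)) \<in> O(\<lambda>t. real t powr (-8/5))" by real_asymp
  have 3: "(\<lambda>t. real t * (1/2) ^ t) \<in> O(\<lambda>t. real t powr (-8/5))" by real_asymp
  show "record_bound \<in> O(\<lambda>t. real t powr (-8/5))"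
    unfolding record_bound_def[abs_def] by (intro sum_in_bigo 1 2 3)
qed

lemma level_prob_small:
  "eventually (\<lambda>m. pmf heavy_pmf m + (1/2) ^ m \<le> real m powr (-6/5)) sequentially"
proof -
  have "(\<lambda>m. pmf heavy_pmf m) \<in> o(\<lambda>m. real m powr (-6/5))"
    unfolding pmf_heavy heavy_tail_def by real_asymp
  moreover have "(\<lambda>m. (1/2) ^ m) \<in> o(\<lambda>m. real m powr (-6/5))" by real_asymp
  ultimately have "(\<lambda>m. pmf heavy_pmf m + (1/2) ^ m) \<in> o(\<lambda>m. real m powr (-6/5))"
    by (rule sum_in_smallo)
  from landau_o.smallD[OF this zero_less_one] show ?thesis
    by eventually_elim simp
qed


section \<open>The step distribution\<close>

definition letter :: "('a, 'b) monoid_scheme \<Rightarrow> (nat \<Rightarrow> 'a) \<Rightarrow> (nat \<Rightarrow> 'a) \<Rightarrow> (nat \<times> nat) \<times> (bool \<times>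
    bool) \<Rightarrow> 'a" where
  "letter G b e = (\<lambda>((n, k), (is_b, sign)).
     let x = (if is_b then b n else e k) in if sign then x else inv\<^bsub>G\<^esub> x)"

definition record_pmf :: "('a, 'b) monoid_scheme \<Rightarrow> (nat \<Rightarrow> 'a) \<Rightarrow> (nat \<Rightarrow> 'a) \<Rightarrow> 'a pmf" where
  "record_pmf G b e = map_pmf (letter G b e) label_pmf"

lemma set_label_pmf: "set_pmf label_pmf = UNIV"
proof -
  have "set_pmf heavy_pmf = UNIV" using pmf_heavy_pos by (auto simp: set_pmf_iff less_le)
  then show ?thesis by (simp add: label_pmf_def set_pmf_geometric set_pmf_bernoulli)
qed

lemma finite_entropy_record_pmf: "finite_entropy G (record_pmf G b e)"
  unfolding record_pmf_def by (rule finite_entropy_map_pmf[OF integrable_ln_label])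

lemma label_pmf_flip:
  "map_pmf (\<lambda>((n, k), (i, s)). ((n, k), (i, \<not> s))) label_pmf = label_pmf"
proof -
  have "map_pmf Not (bernoulli_pmf (1/2)) = bernoulli_pmf (1/2)"
  proof (rule pmf_eqI)
    fix s
    have "pmf (map_pmf Not (bernoulli_pmf (1/2))) (\<not> \<not> s) = pmf (bernoulli_pmf (1/2)) (\<not> s)"
      by (rule pmf_map_inj') (auto simp: inj_def)
    then show "pmf (map_pmf Not (bernoulli_pmf (1/2))) s = pmf (bernoulli_pmf (1/2)) s"
      by (cases s) simp_all
  qed
  then have "label_pmf = pair_pmf (pair_pmf heavy_pmf (geometric_pmf (1/2)))
     (pair_pmf (bernoulli_pmf (1/2)) (map_pmf Not (bernoulli_pmf (1/2))))"
    by (simp add: label_pmf_def)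
  also have "\<dots> = map_pmf (\<lambda>((n, k), (i, s)). ((n, k), (i, \<not> s))) label_pmf"
    unfolding label_pmf_def pair_map_pmf2 by (simp add: apsnd_def map_prod_def split_beta')
  finally show ?thesis by simp
qed

context group
begin

context
  fixes b e :: "nat \<Rightarrow> 'a"
  assumes b: "\<And>m. b m \<in> carrier G" and e: "range e = carrier G"
begin

lemma e_in: "e k \<in> carrier G" using e by blast

lemma set_record_pmf: "set_pmf (record_pmf G b e) = carrier G"
proof -
  have "letter G b e l \<in> carrier G" for l
    using b e_in by (auto simp: letter_def Let_def split: prod.splits)
  moreover have "g \<in> range (letter G b e)" if g: "g \<in> carrier G" for g
  proof -
    obtain k where "g = e k" using g e by blast
    then have "g = letter G b e ((0, k), (False, True))" by (simp add: letter_def)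
    then show ?thesis by blast
  qed
  ultimately show ?thesis by (auto simp: record_pmf_def set_label_pmf)
qed

text \<open>
  Flipping the sign bit of the label inverts the letter.
\<close>

lemma symmetric_record_pmf: "symmetric_pmf G (record_pmf G b e)"
proof -
  have "inv (letter G b e l) = letter G b e ((\<lambda>((n, k), (i, s)). ((n, k), (i, \<not> s))) l)" for l
    using b e_in by (auto simp: letter_def Let_def split: prod.splits)
  then have "map_pmf (\<lambda>g. inv g) (record_pmf G b e) =
    map_pmf (letter G b e) (map_pmf (\<lambda>((n, k), (i, s)). ((n, k), (i, \<not> s))) label_pmf)"
    by (simp add: record_pmf_def map_pmf_comp)
  then have eq: "map_pmf (\<lambda>g. inv g) (record_pmf G b e) = record_pmf G b e"
    by (simp add: label_pmf_flip record_pmf_def)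
  have "pmf (record_pmf G b e) g = pmf (record_pmf G b e) (inv g)" if "g \<in> carrier G" for g
    using pmf_map_inj[of "\<lambda>g. inv g" "record_pmf G b e" g] that inv_inj
    unfolding set_record_pmf eq by (simp add: inj_on_def)
  then show ?thesis unfolding symmetric_pmf_def by blast
qed

lemma nondegenerate_record_pmf: "nondegenerate G (record_pmf G b e)"
proof -
  have "x \<in> carrier G" if "x \<in> semigroup_generate G (carrier G)" for x
    using that by induction auto
  then show ?thesis
    unfolding nondegenerate_def set_record_pmf by (auto intro: semigroup_generate.incl)
qed

lemma record_pmf_atLeast:
  "measure_pmf.prob (record_pmf G b e) (\<Union>m\<in>{M..}. {b m, inv (b m)}) \<ge> heavy_tail M / 2"
proof -
  have "heavy_tail M / 2 = measure_pmf.prob label_pmf (({M..} \<times> UNIV) \<times> ({True} \<times> UNIV))"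
    unfolding label_pmf_def by (simp add: measure_pmf_prob_product heavy_prob_atLeast
        measure_pmf_single)
  also have "\<dots> \<le> measure_pmf.prob label_pmf (letter G b e -` (\<Union>m\<in>{M..}. {b m, inv (b m)}))"
    by (rule measure_pmf.finite_measure_mono) (auto simp: letter_def Let_def)
  finally show ?thesis by (simp add: record_pmf_def)
qed

lemma measure_label_level:
  "measure_pmf.prob label_pmf {l. fst (fst l) \<in> A} = measure_pmf.prob heavy_pmf A"
proof -
  have "map_pmf (\<lambda>l. fst (fst l)) label_pmf = heavy_pmf"
    unfolding label_pmf_def by (simp flip: map_pmf_comp add: map_fst_pair_pmf)
  then have "measure_pmf.prob heavy_pmf A = measure_pmf.prob (map_pmf (\<lambda>l. fst (fst l)) label_pmf)
      A" by simp
  then show ?thesis by (simp add: vimage_def)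
qed

lemma measure_label_index:
  "measure_pmf.prob label_pmf {l. snd (fst l) \<in> A} = measure_pmf.prob (geometric_pmf (1/2)) A"
proof -
  have "map_pmf (\<lambda>l. snd (fst l)) label_pmf = geometric_pmf (1/2)"
    unfolding label_pmf_def by (simp flip: map_pmf_comp add: map_fst_pair_pmf map_snd_pair_pmf)
  then have "measure_pmf.prob (geometric_pmf (1/2)) A = measure_pmf.prob (map_pmf (\<lambda>l. snd (fst
      l)) label_pmf) A" by simp
  then show ?thesis by (simp add: vimage_def)
qed

text \<open>
  The summand \<open>(1/2) ^ m\<close> accounts for the occurrences of \<open>b m\<close> and its inverse among the letters
  \<open>e k\<close>.
\<close>

lemma record_pmf_level:
  assumes disj: "\<And>n. {b m, inv (b m)} \<inter> {b n, inv (b n)} \<noteq> {} \<Longrightarrow> n = m"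
    and late: "\<And>k. {b m, inv (b m)} \<inter> {e k, inv (e k)} \<noteq> {} \<Longrightarrow> m \<le> k"
  shows "measure_pmf.prob (record_pmf G b e) {b m, inv (b m)} \<le> pmf heavy_pmf m + (1/2) ^ m"
proof -
  have "letter G b e -` {b m, inv (b m)} \<subseteq> {l. fst (fst l) \<in> {m}} \<union> {l. snd (fst l) \<in> {m..}}"
  proof
    fix l assume l: "l \<in> letter G b e -` {b m, inv (b m)}"
    obtain n k i s where eq: "l = ((n, k), (i, s))" by (metis prod.exhaust)
    show "l \<in> {l. fst (fst l) \<in> {m}} \<union> {l. snd (fst l) \<in> {m..}}"
    proof (cases i)
      case True
      then have "letter G b e l \<in> {b n, inv (b n)}" by (simp add: eq letter_def Let_def)
      then have "n = m" using l by (intro disj) auto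
      then show ?thesis by (simp add: eq)
    next
      case False
      then have "letter G b e l \<in> {e k, inv (e k)}" by (simp add: eq letter_def Let_def)
      then have "m \<le> k" using l by (intro late) auto
      then show ?thesis by (simp add: eq)
    qed
  qed
  then have "measure_pmf.prob (record_pmf G b e) {b m, inv (b m)} \<le>
    measure_pmf.prob label_pmf ({l. fst (fst l) \<in> {m}} \<union> {l. snd (fst l) \<in> {m..}})"
    unfolding record_pmf_def measure_map_pmf by (intro measure_pmf.finite_measure_mono) auto
  also have "\<dots> \<le> measure_pmf.prob label_pmf {l. fst (fst l) \<in> {m}}
      + measure_pmf.prob label_pmf {l. snd (fst l) \<in> {m..}}"
    by (rule measure_Un_le) auto
  also have "\<dots> = pmf heavy_pmf m + (1/2) ^ m"
    unfolding measure_label_level measure_label_index geometric_prob_atLeast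
        by (simp add: measure_pmf_single)
  finally show ?thesis .
qed

lemma record_pmf_rest:
  "measure_pmf.prob (record_pmf G b e) (- ((\<Union>m. {b m, inv (b m)}) \<union> (\<Union>k\<in>{..<M}. {e k, inv (e k)})))
     \<le> (1/2) ^ M"
proof -
  have "letter G b e -` (- ((\<Union>m. {b m, inv (b m)}) \<union> (\<Union>k\<in>{..<M}. {e k, inv (e k)})))
      \<subseteq> {l. snd (fst l) \<in> {M..}}"
  proof
    fix l assume l: "l \<in> letter G b e -` (- ((\<Union>m. {b m, inv (b m)}) \<union> (\<Union>k\<in>{..<M}. {e k, inv (e k)})))"
    obtain n k i s where eq: "l = ((n, k), (i, s))" by (metis prod.exhaust)
    have "letter G b e l \<in> {b n, inv (b n)} \<or> letter G b e l \<in> {e k, inv (e k)}"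
      by (simp add: eq letter_def Let_def)
    moreover have "letter G b e l \<notin> {b n, inv (b n)}" using l by blast
    ultimately have "letter G b e l \<in> {e k, inv (e k)}" by blast
    then have "\<not> k < M" using l by blast
    then show "l \<in> {l. snd (fst l) \<in> {M..}}" by (simp add: eq)
  qed
  then have "measure_pmf.prob (record_pmf G b e) (- ((\<Union>m. {b m, inv (b m)}) \<union> (\<Union>k\<in>{..<M}. {e k,
      inv (e k)}))) \<le>
    measure_pmf.prob label_pmf {l. snd (fst l) \<in> {M..}}"
    unfolding record_pmf_def measure_map_pmf by (intro measure_pmf.finite_measure_mono) auto
  then show ?thesis unfolding measure_label_index geometric_prob_atLeast .
qed

end
end

context
  fixes G :: "('a, 'b) monoid_scheme" (structure) and \<mu> :: "'a pmf"
  assumes grp: "group G" and cnt: "countable (carrier G)" and supp: "set_pmf \<mu> \<subseteq> carrier G"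
begin

lemma emeasure_increments_cylinder:
  assumes "finite J"
  shows "emeasure (increments G \<mu>) {x \<in> space (increments G \<mu>). \<forall>j\<in>J. x j \<in> S j} =
    (\<Prod>j\<in>J. emeasure (measure_pmf \<mu>) (S j))"
    and "{x \<in> space (increments G \<mu>). \<forall>j\<in>J. x j \<in> S j} \<in> sets (increments G \<mu>)"
proof -
  let ?M = "step_measure G \<mu>"
  interpret M: prob_space ?M by (rule prob_space_increment[OF grp cnt supp])
  interpret product_prob_space "\<lambda>_. ?M" "UNIV :: nat set" ..
  have eq: "{x \<in> space (increments G \<mu>). \<forall>j\<in>J. x j \<in> S j} =
    {x \<in> space (PiM UNIV (\<lambda>_. ?M)). \<forall>j\<in>J. x j \<in> S j \<inter> carrier G}"
    unfolding increments_def by (auto simp: space_PiM space_restrict_space PiE_iff)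
  have m: "S j \<inter> carrier G \<in> sets ?M" for j by (auto simp: sets_restrict_space)
  have "emeasure ?M (S j \<inter> carrier G) = emeasure (measure_pmf \<mu>) (S j)" for j
  proof -
    have "emeasure ?M (S j \<inter> carrier G) = emeasure (measure_pmf \<mu>) (S j \<inter> carrier G)"
      by (rule emeasure_restrict_space) auto
    also have "\<dots> = emeasure (measure_pmf \<mu>) (S j)"
      using supp by (intro emeasure_eq_AE) (auto simp: AE_measure_pmf_iff)
    finally show ?thesis .
  qed
  then show "emeasure (increments G \<mu>) {x \<in> space (increments G \<mu>). \<forall>j\<in>J. x j \<in> S j} =
    (\<Prod>j\<in>J. emeasure (measure_pmf \<mu>) (S j))"
    unfolding eq unfolding increments_def
    by (subst emeasure_PiM_Collect) (use assms m in auto)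
  show "{x \<in> space (increments G \<mu>). \<forall>j\<in>J. x j \<in> S j} \<in> sets (increments G \<mu>)"
    unfolding eq unfolding increments_def
    by (intro sets.sets_Collect_finite_All assms sets_Collect_single m UNIV_I)
qed

end


section \<open>Almost sure records\<close>

context
  fixes G :: "('a, 'b) monoid_scheme" (structure) and \<mu> :: "'a pmf"
  assumes grp: "group G" and cnt: "countable (carrier G)" and supp: "set_pmf \<mu> \<subseteq> carrier G"
begin

text \<open>
  Given one of the two increments, the other one hits the same set with probability at most \<open>c\<close>.
\<close>

lemma increments_tie_le:
  fixes B :: "nat \<Rightarrow> 'a set"
  assumes ij: "i \<noteq> j" and disj: "disjoint_family B" and c: "\<And>m. measure_pmf.prob \<mu> (B m) \<le> c"
  shows "measure (increments G \<mu>) (\<Union>m. {x \<in> space (increments G \<mu>). \<forall>l \<in> {i, j}. x l \<in> B m}) \<le> c"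
proof -
  note cyl = emeasure_increments_cylinder[OF grp cnt supp, of "{i, j}"]
  interpret I: prob_space "increments G \<mu>" by (rule prob_space_increments[OF grp cnt supp])
  let ?A = "\<lambda>m. {x \<in> space (increments G \<mu>). \<forall>l \<in> {i, j}. x l \<in> B m}"
  have c0: "c \<ge> 0" using c[of undefined] measure_nonneg by (rule order_trans[rotated])
  have A: "range ?A \<subseteq> sets (increments G \<mu>)" using cyl(2)[of "\<lambda>_. B _"] by auto
  have "emeasure (increments G \<mu>) (\<Union>m. ?A m) \<le> (\<Sum>m. emeasure (increments G \<mu>) (?A m))"
    by (rule emeasure_subadditive_countably[OF A])
  also have "\<dots> \<le> (\<Sum>m. ennreal c * emeasure (measure_pmf \<mu>) (B m))"
  proof (rule suminf_le)
    fix m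
    have "emeasure (increments G \<mu>) (?A m) = emeasure (measure_pmf \<mu>) (B m) * emeasure
        (measure_pmf \<mu>) (B m)"
      using cyl(1)[of "\<lambda>_. B m"] ij by simp
    also have "\<dots> \<le> ennreal c * emeasure (measure_pmf \<mu>) (B m)"
      using c[of m] by (intro mult_right_mono) (auto simp: measure_pmf.emeasure_eq_measure ennreal_leI)
    finally show "emeasure (increments G \<mu>) (?A m) \<le> ennreal c * emeasure (measure_pmf \<mu>) (B m)" .
  qed auto
  also have "\<dots> = ennreal c * emeasure (measure_pmf \<mu>) (\<Union>m. B m)"
    using disj by (simp add: ennreal_suminf_cmult suminf_emeasure)
  also have "\<dots> \<le> ennreal c * 1"
    by (intro mult_left_mono measure_pmf.emeasure_le_1) auto
  finally show ?thesis using c0 by (simp add: I.emeasure_eq_measure)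
qed

end

text \<open>
  By the Borel-Cantelli lemma, almost surely from some time \<open>t\<close> on, the first \<open>t\<close> increments
  contain a level of at least \<open>t ^ 3\<close>, no such level twice, and, apart from the elements \<open>b n\<close>,
  only elements \<open>e k\<close> with \<open>k < t ^ 3\<close>. Then the maximal level is a record.
\<close>

lemma (in group) AE_eventually_record:
  fixes Q (structure)
  assumes cnt: "countable (carrier G)" and Q: "switching_sequence Q letters b' e'"
    and hom: "group_hom G Q \<pi>"
    and b: "\<And>m. b m \<in> carrier G" "\<And>m. \<pi> (b m) = b' m"
    and e: "range e = carrier G" "\<And>k. \<pi> (e k) = e' k"
  shows "AE x in increments G (record_pmf G b e).
    eventually (\<lambda>t. \<exists>\<tau> m. switching_sequence.records_at Q letters b' (\<lambda>i. \<pi> (x i)) t \<tau> m) sequentially"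
proof -
  interpret S: switching_sequence Q letters b' e' by fact
  interpret h: group_hom G Q \<pi> by fact
  let ?\<mu> = "record_pmf G b e"
  have supp: "set_pmf ?\<mu> \<subseteq> carrier G" using set_record_pmf[OF b(1) e(1)] by simp
  interpret I: prob_space "increments G ?\<mu>"
    by (rule prob_space_increments[OF is_group cnt supp])
  note cyl = emeasure_increments_cylinder[OF is_group cnt supp]
  have cylm: "measure (increments G ?\<mu>) {x \<in> space (increments G ?\<mu>). \<forall>j\<in>J. x j \<in> S} =
      measure_pmf.prob ?\<mu> S ^ card J" if "finite J" for J S
    using cyl(1)[OF that, of "\<lambda>_. S"]
    by (simp add: I.emeasure_eq_measure measure_pmf.emeasure_eq_measure ennreal_power)
  define B where "B m = {b m, inv b m}" for m
  define E where "E k = {e k, inv e k}" for k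
  have eG: "e k \<in> carrier G" for k using e(1) by blast
  have \<pi>B: "\<pi> x \<in> {b' m, inv\<^bsub>Q\<^esub> b' m}" if "x \<in> B m" for x m
    using that b by (auto simp: B_def)
  have \<pi>E: "\<pi> x \<in> {e' k, inv\<^bsub>Q\<^esub> e' k}" if "x \<in> E k" for x k
    using that e(2) eG by (auto simp: E_def)
  have B_inj: "m = n" if "x \<in> B m" "x \<in> B n" for x m n
    using S.b_inj[OF \<pi>B[OF that(1)] \<pi>B[OF that(2)]] .
  have BE: "m \<le> k" if "x \<in> B m" "x \<in> E k" for x m k
  proof (rule ccontr)
    assume "\<not> m \<le> k"
    then have "\<pi> x \<in> letters m" using \<pi>E[OF that(2)] S.e_letters[of k m] by auto
    then show False using S.b_in_letters[OF \<pi>B[OF that(1)]] by blast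
  qed
  have level: "measure_pmf.prob ?\<mu> (B m) \<le> pmf heavy_pmf m + (1/2) ^ m" for m
    unfolding B_def
  proof (rule record_pmf_level[OF b(1) e(1)])
    show "n = m" if "{b m, inv b m} \<inter> {b n, inv b n} \<noteq> {}" for n
      using that B_inj unfolding B_def by blast
    show "m \<le> k" if "{b m, inv b m} \<inter> {e k, inv e k} \<noteq> {}" for k
      using that BE unfolding B_def E_def by blast
  qed
  obtain M0 where M0: "\<And>m. m \<ge> M0 \<Longrightarrow> pmf heavy_pmf m + (1/2) ^ m \<le> real m powr (-6/5)"
    using level_prob_small by (auto simp: eventually_sequentially)
  let ?I = "increments G ?\<mu>"
  define bad1 where "bad1 t = {x \<in> space ?I. \<forall>j\<in>{..<t}. x j \<in> - (\<Union>m\<in>{t^3..}. B m)}" for t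
  define pairs :: "nat \<Rightarrow> (nat \<times> nat) set" where
    "pairs t = {p \<in> {..<t} \<times> {..<t}. fst p \<noteq> snd p}" for t
  define bad2 where "bad2 t = (\<Union>p\<in>pairs t.
     \<Union>m. {x \<in> space ?I. \<forall>l\<in>{fst p, snd p}. x l \<in> B (t^3 + m)})" for t
  define bad3 where "bad3 t = (\<Union>i\<in>{..<t}. {x \<in> space ?I. \<forall>j\<in>{i}. x j \<in> - ((\<Union>m. B m) \<union>
      (\<Union>k\<in>{..<t^3}. E k))})" for t
  have fin: "finite (pairs t)" for t
    by (rule finite_subset[of _ "{..<t} \<times> {..<t}"]) (auto simp: pairs_def)
  have sets2: "(\<Union>m. {x \<in> space ?I. \<forall>l\<in>{i, j}. x l \<in> B (t^3 + m)}) \<in> sets ?I" for i j t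
    by (intro sets.countable_UN image_subsetI cyl(2)) simp
  have sets: "bad1 t \<in> sets ?I" "bad2 t \<in> sets ?I" "bad3 t \<in> sets ?I" for t
  proof -
    show "bad1 t \<in> sets ?I" unfolding bad1_def by (rule cyl(2)) simp
    show "bad2 t \<in> sets ?I" unfolding bad2_def
      by (rule sets.finite_UN[OF fin]) (use sets2 in auto)
    show "bad3 t \<in> sets ?I" unfolding bad3_def by (intro sets.finite_UN cyl(2)) auto
  qed
  have bound: "measure ?I (bad1 t \<union> bad2 t \<union> bad3 t) \<le> record_bound t" if t: "t \<ge> Suc M0" for t
  proof -
    have t3: "t \<le> t ^ 3" by (rule self_le_power) (use t in auto)
    have "measure_pmf.prob ?\<mu> (- (\<Union>m\<in>{t^3..}. B m)) = 1 - measure_pmf.prob ?\<mu> (\<Union>m\<in>{t^3..}. B m)"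
      using measure_pmf.prob_compl[of "\<Union>m\<in>{t^3..}. B m" ?\<mu>] by (simp add: Compl_eq_Diff_UNIV)
    then have "measure_pmf.prob ?\<mu> (- (\<Union>m\<in>{t^3..}. B m)) \<le> 1 - heavy_tail (t ^ 3) / 2"
      using record_pmf_atLeast[OF b(1) e(1), of "t ^ 3"] by (simp add: B_def)
    then have 1: "measure ?I (bad1 t) \<le> (1 - heavy_tail (t ^ 3) / 2) ^ t"
      unfolding bad1_def cylm[OF finite_lessThan] card_lessThan by (intro power_mono) auto
    define c where "c = (real t ^ 3) powr (-6/5)"
    have c: "measure_pmf.prob ?\<mu> (B (t^3 + m)) \<le> c" for m
    proof -
      have "measure_pmf.prob ?\<mu> (B (t^3 + m)) \<le> pmf heavy_pmf (t^3 + m) + (1/2) ^ (t^3 + m)"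
          by (rule level)
      also have "\<dots> \<le> real (t^3 + m) powr (-6/5)" using t t3 by (intro M0) simp
      also have "\<dots> \<le> c" unfolding c_def using t by (intro powr_mono2') auto
      finally show ?thesis .
    qed
    have disj: "disjoint_family (\<lambda>m. B (t^3 + m))"
      using B_inj by (fastforce simp: disjoint_family_on_def)
    have "measure ?I (bad2 t) \<le> (\<Sum>p\<in>pairs t.
         measure ?I (\<Union>m. {x \<in> space ?I. \<forall>l\<in>{fst p, snd p}. x l \<in> B (t^3 + m)}))"
      unfolding bad2_def by (rule measure_UNION_le[OF fin sets2])
    also have "\<dots> \<le> (\<Sum>p\<in>pairs t. c)"
      by (rule sum_mono, rule increments_tie_le[OF is_group cnt supp _ disj c]) (simp add: pairs_def)
    also have "\<dots> = real (card (pairs t)) * c" by simp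
    also have "\<dots> \<le> real t ^ 2 * c"
    proof (rule mult_right_mono)
      have "card (pairs t) \<le> card ({..<t} \<times> {..<t})"
        by (rule card_mono) (auto simp: pairs_def)
      then have "card (pairs t) \<le> t ^ 2" by (simp add: power2_eq_square)
      then show "real (card (pairs t)) \<le> real t ^ 2"
        by (metis of_nat_le_iff of_nat_power)
    qed (simp add: c_def)
    finally have 2: "measure ?I (bad2 t) \<le> real t ^ 2 * (real t ^ 3) powr (-6/5)" by (simp add: c_def)
    have "measure ?I (bad3 t) \<le> (\<Sum>i<t. measure ?I {x \<in> space ?I. \<forall>j\<in>{i}. x j \<in> - ((\<Union>m. B m) \<union>
        (\<Union>k\<in>{..<t^3}. E k))})"
      unfolding bad3_def by (rule measure_UNION_le[OF finite_lessThan cyl(2)]) simp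
    also have "\<dots> \<le> (\<Sum>i<t. (1/2) ^ t)"
    proof (rule sum_mono)
      fix i
      have "measure ?I {x \<in> space ?I. \<forall>j\<in>{i}. x j \<in> - ((\<Union>m. B m) \<union> (\<Union>k\<in>{..<t^3}. E k))} \<le> (1/2) ^ (t^3)"
        using cylm[of "{i}" "- ((\<Union>m. B m) \<union> (\<Union>k\<in>{..<t^3}. E k))"] record_pmf_rest[OF b(1) e(1),
            where M = "t^3"]
        by (simp add: B_def E_def)
      also have "\<dots> \<le> (1/2) ^ t" using t3 by (intro power_decreasing) auto
      finally show "measure ?I {x \<in> space ?I. \<forall>j\<in>{i}. x j \<in> - ((\<Union>m. B m) \<union> (\<Union>k\<in>{..<t^3}. E k))}
          \<le> (1/2) ^ t" .
    qed
    finally have 3: "measure ?I (bad3 t) \<le> real t * (1/2) ^ t" by simp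
    have "measure ?I (bad1 t \<union> bad2 t \<union> bad3 t) \<le> measure ?I (bad1 t) + measure ?I (bad2 t)
        + measure ?I (bad3 t)"
      using sets[of t] by (intro order_trans[OF measure_Un_le] add_mono measure_Un_le) auto
    then show ?thesis using 1 2 3 by (simp add: record_bound_def)
  qed
  have "AE x in ?I. eventually (\<lambda>t. x \<in> space ?I - (bad1 t \<union> bad2 t \<union> bad3 t)) sequentially"
  proof (rule borel_cantelli_AE1)
    show "bad1 t \<union> bad2 t \<union> bad3 t \<in> sets ?I" for t using sets[of t] by auto
    show "emeasure ?I (bad1 t \<union> bad2 t \<union> bad3 t) < \<infinity>" for t by (simp add: less_top[symmetric])
    show "summable (\<lambda>t. measure ?I (bad1 t \<union> bad2 t \<union> bad3 t))"
      by (rule summable_comparison_test'[OF summable_record_bound, of "Suc M0"]) (use bound in auto)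
  qed
  then show ?thesis
  proof eventually_elim
    case (elim x)
    then show ?case
    proof eventually_elim
      case (elim t)
      then have x: "x \<in> space ?I" and g1: "x \<notin> bad1 t" and g2: "x \<notin> bad2 t" and g3: "x \<notin> bad3 t" by auto
      define lev where "lev = {m. \<exists>i<t. x i \<in> B m}"
      have "finite lev"
      proof -
        have "lev \<subseteq> (\<lambda>i. THE m. x i \<in> B m) ` {..<t}"
        proof
          fix m assume "m \<in> lev"
          then obtain i where i: "i < t" "x i \<in> B m" by (auto simp: lev_def)
          then have "(THE m. x i \<in> B m) = m" using B_inj by blast
          then show "m \<in> (\<lambda>i. THE m. x i \<in> B m) ` {..<t}" using i(1) by force
        qed
        then show ?thesis by (rule finite_subset) simp
      qed
      obtain i0 m0 where 0: "i0 < t" "m0 \<ge> t^3" "x i0 \<in> B m0" using g1 x by (auto simp: bad1_def)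
      define m where "m = Max lev"
      have m0: "m0 \<in> lev" using 0 by (auto simp: lev_def)
      then have "m \<in> lev" using \<open>finite lev\<close> unfolding m_def by (intro Max_in) auto
      then obtain \<tau> where \<tau>: "\<tau> < t" "x \<tau> \<in> B m" by (auto simp: lev_def)
      have mt: "m \<ge> t^3" using Max_ge[OF \<open>finite lev\<close> m0] 0(2) by (simp add: m_def)
      have "t \<le> t ^ 3" using \<tau>(1) by (intro self_le_power) auto
      then have tm: "t \<le> m" using mt by simp
      have "\<pi> (x i) \<in> letters m" if i: "i < t" "i \<noteq> \<tau>" for i
      proof -
        have "x i \<in> (\<Union>m. B m) \<union> (\<Union>k\<in>{..<t^3}. E k)" using g3 x i(1) by (auto simp: bad3_def)
        then consider n where "x i \<in> B n" | k where "k < t^3" "x i \<in> E k" by blast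
        then show ?thesis
        proof cases
          case (1 n)
          then have "n \<in> lev" using i(1) by (auto simp: lev_def)
          then have "n \<le> m" using Max_ge[OF \<open>finite lev\<close>] by (simp add: m_def)
          moreover have "n \<noteq> m"
          proof
            assume "n = m"
            then have "x i \<in> B (t^3 + (m - t^3))" "x \<tau> \<in> B (t^3 + (m - t^3))" using 1 \<tau>(2) mt by auto
            moreover have "(i, \<tau>) \<in> pairs t" using i \<tau>(1) by (simp add: pairs_def)
            ultimately have "x \<in> bad2 t" unfolding bad2_def using x by fastforce
            then show False using g2 by simp
          qed
          ultimately show ?thesis using \<pi>B[OF 1] S.b_letters[of n m] by auto
        next
          case (2 k)
          then show ?thesis using \<pi>E[OF 2(2)] S.e_letters[of k m] mt by auto
        qed
      qed
      then have "S.records_at (\<lambda>i. \<pi> (x i)) t \<tau> m"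
        unfolding S.records_at_def using \<tau>(1) tm \<pi>B[OF \<tau>(2)] by blast
      then show ?case by blast
    qed
  qed
qed


section \<open>The action on the boundary\<close>

lemma (in group_hom) hom_walk:
  assumes "g \<in> carrier G" "\<And>n. x n \<in> carrier G"
  shows "h (walk G g x n) = walk H (h g) (\<lambda>i. h (x i)) n \<and> walk G g x n \<in> carrier G"
  by (induction n) (use assms in auto)

lemma (in group) FC_centre_quotient_trivial:
  assumes N: "N \<lhd> G" and closed: "FC_next G N \<subseteq> N"
  shows "FC_centre (G Mod N) = {\<one>\<^bsub>G Mod N\<^esub>}"
proof -
  interpret N: normal N G by fact
  interpret Q: group "G Mod N" by (rule N.factorgroup_is_group)
  have "{x \<otimes>\<^bsub>G Mod N\<^esub> \<one>\<^bsub>G Mod N\<^esub> \<otimes>\<^bsub>G Mod N\<^esub> inv\<^bsub>G Mod N\<^esub> x | x. x \<in> carrier (G Mod N)} \<subseteq> {\<one>\<^bsub>G Mod N\<^esub>}"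
    using Q.r_inv Q.r_one by auto
  then have "\<one>\<^bsub>G Mod N\<^esub> \<in> FC_centre (G Mod N)"
    unfolding FC_centre_def using Q.one_closed by (auto intro: finite_subset)
  moreover have "X = \<one>\<^bsub>G Mod N\<^esub>" if X: "X \<in> FC_centre (G Mod N)" for X
  proof -
    obtain g where g: "g \<in> carrier G" "X = N #> g"
      using X by (auto simp: FC_centre_def carrier_FactGroup)
    then have "g \<in> N" using X closed by (auto simp: FC_next_def)
    then show ?thesis using g N.subgroup_axioms by (simp add: coset_join2)
  qed
  ultimately show ?thesis by blast
qed

context
  fixes G :: "('a, 'b) monoid_scheme" (structure) and \<mu> :: "'a pmf"
  assumes grp: "group G" and cnt: "countable (carrier G)" and supp: "set_pmf \<mu> \<subseteq> carrier G"
begin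

interpretation group G by (rule grp)

text \<open>
  An event that concerns only the ultimate behaviour of the positions is invariant under the
  shift.
\<close>

lemma eventually_exit_set:
  "{y \<in> space (path_space G). eventually (\<lambda>t. P (y t)) sequentially} \<in> exit_sets G \<mu>"
proof -
  have "{y \<in> space (path_space G). P (y t)} \<in> sets (path_space G)" for t
  proof -
    have "(\<lambda>y. y t) -` ({a. P a} \<inter> carrier G) \<inter> space (path_space G) \<in> sets (path_space G)"
      by (rule measurable_sets[OF path_component]) auto
    moreover have "(\<lambda>y. y t) -` ({a. P a} \<inter> carrier G) \<inter> space (path_space G)
        = {y \<in> space (path_space G). P (y t)}"
      by (auto simp: space_path_space)
    ultimately show ?thesis by simp
  qed
  then have "{y \<in> space (path_space G). eventually (\<lambda>t. P (y t)) sequentially} \<in> sets (path_space G)"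
    unfolding eventually_sequentially
    by (intro sets.sets_Collect_countable_Ex sets.sets_Collect_countable_All sets.sets_Collect_imp) auto
  moreover have "path_shift y \<in> {y \<in> space (path_space G). eventually (\<lambda>t. P (y t)) sequentially} \<longleftrightarrow>
     y \<in> {y \<in> space (path_space G). eventually (\<lambda>t. P (y t)) sequentially}"
         if "y \<in> space (path_space G)" for y
    using that eventually_sequentially_Suc[of "\<lambda>t. P (y t)"]
        by (simp add: path_shift_def space_path_space)
  moreover have "AE y in path_measure_sum G \<mu>. y \<in> space (path_space G)"
    using AE_space[of "path_measure_sum G \<mu>"] by (simp add: path_measure_sum_def)
  ultimately show ?thesis unfolding exit_sets_def by (auto elim: eventually_mono)
qed

text \<open>
  The sublevel sets of \<open>bnd\<close> at rational values are exit sets, and \<open>z\<close> preserves each of them.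
\<close>

lemma boundary_action_trivial:
  assumes PB: "poisson_boundary G \<mu> X bnd act" and full: "set_pmf \<mu> = carrier G"
    and z: "z \<in> hyper_FC_centre G"
  shows "AE y in path_measure_sum G \<mu>. act z (bnd y) = bnd y"
proof -
  interpret PB: poisson_boundary G \<mu> X bnd act by fact
  have zG: "z \<in> carrier G" using z hyper_FC_centre_subset_carrier by blast
  let ?A = "\<lambda>r. bnd -` ({..r} \<inter> space X) \<inter> space (path_space G)"
  have "{..r} \<inter> space X \<in> sets X" for r
    unfolding PB.sets_borel using PB.space_borel by (auto simp: sets_restrict_space)
  then have "\<forall>r \<in> \<rat>. AE y in path_measure_sum G \<mu>. left_mult G z y \<in> ?A r \<longleftrightarrow> y \<in> ?A r"
    by (intro ballI hyper_FC_centre_preserves_exit_sets[OF grp cnt supp full z] PB.bnd_exit)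
  then have "AE y in path_measure_sum G \<mu>. \<forall>r \<in> \<rat>. left_mult G z y \<in> ?A r \<longleftrightarrow> y \<in> ?A r"
    by (subst AE_ball_countable) (auto simp: countable_rat)
  moreover have "AE y in path_measure_sum G \<mu>. y \<in> space (path_space G)"
    using AE_space[of "path_measure_sum G \<mu>"] by (simp add: path_measure_sum_def)
  ultimately show ?thesis using PB.act_bnd[OF zG]
  proof eventually_elim
    case (elim y)
    have zy: "left_mult G z y \<in> space (path_space G)"
      by (rule measurable_space[OF left_mult_measurable[OF grp cnt supp zG] elim(2)])
    have sp: "bnd y \<in> space X" "bnd (left_mult G z y) \<in> space X"
      using measurable_space[OF PB.bnd_measurable] elim(2) zy by auto
    have le: "bnd (left_mult G z y) \<le> r \<longleftrightarrow> bnd y \<le> r" if "r \<in> \<rat>" for r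
      using elim(1) that zy elim(2) sp by auto
    have "bnd (left_mult G z y) = bnd y"
    proof (rule ccontr)
      assume "bnd (left_mult G z y) \<noteq> bnd y"
      then consider "bnd (left_mult G z y) < bnd y" | "bnd y < bnd (left_mult G z y)" by linarith
      then show False
      proof cases
        case 1
        from Rats_dense_in_real[OF this] le show False by force
      next
        case 2
        from Rats_dense_in_real[OF this] le show False by force
      qed
    qed
    then show ?case using elim(3) by simp
  qed
qed

text \<open>
  Exit sets are pulled back from the boundary, so a countable family of exit sets that
  distinguishes a path from its translate also distinguishes their boundary points.
\<close>

lemma boundary_action_nontrivial:
  assumes PB: "poisson_boundary G \<mu> X bnd act" and z: "z \<in> carrier G"
    and W: "countable W" "\<And>w. w \<in> W \<Longrightarrow> A w \<in> exit_sets G \<mu>"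
    and sep: "AE y in path_measure_sum G \<mu>. \<exists>w \<in> W. y \<in> A w \<and> left_mult G z y \<notin> A w"
  shows "AE y in path_measure_sum G \<mu>. act z (bnd y) \<noteq> bnd y"
proof -
  interpret PB: poisson_boundary G \<mu> X bnd act by fact
  have "\<forall>w. \<exists>B. w \<in> W \<longrightarrow> (AE y in path_measure_sum G \<mu>. y \<in> A w \<longleftrightarrow> bnd y \<in> B)"
    using PB.exit_bnd W(2) by blast
  then obtain B where B: "\<And>w. w \<in> W \<Longrightarrow> AE y in path_measure_sum G \<mu>. y \<in> A w \<longleftrightarrow> bnd y \<in> B w" by metis
  have "AE y in path_measure_sum G \<mu>. \<forall>w \<in> W. y \<in> A w \<longleftrightarrow> bnd y \<in> B w"
    using B W(1) by (subst AE_ball_countable) auto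
  moreover have "AE y in path_measure_sum G \<mu>. \<forall>w \<in> W. left_mult G z y \<in> A w
      \<longleftrightarrow> bnd (left_mult G z y) \<in> B w"
    using AE_left_mult[OF grp cnt supp z B] W(1) by (subst AE_ball_countable) auto
  ultimately show ?thesis using sep PB.act_bnd[OF z]
    by eventually_elim metis
qed

lemma AE_boundary_measureI:
  assumes PB: "poisson_boundary G \<mu> X bnd act"
    and ae: "AE y in path_measure_sum G \<mu>. P (bnd y)" and P: "{\<zeta> \<in> space X. P \<zeta>} \<in> sets X"
  shows "AE \<zeta> in boundary_measure G \<mu> X bnd \<theta>. P \<zeta>"
proof -
  interpret PB: poisson_boundary G \<mu> X bnd act by fact
  have bm: "bnd \<in> path_measure G \<mu> g \<rightarrow>\<^sub>M X" for g
    using PB.bnd_measurable by (simp cong: measurable_cong_sets)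
  show ?thesis
    unfolding boundary_measure_def
  proof (subst AE_weighted_sum)
    show "sets (harmonic_measure G \<mu> X bnd g) = sets X" for g by (simp add: harmonic_measure_def)
    show "\<forall>g\<in>carrier G. ennreal (pmf \<theta> g) \<noteq> 0 \<longrightarrow> (AE \<zeta> in harmonic_measure G \<mu> X bnd g. P \<zeta>)"
      unfolding harmonic_measure_def
      using ae AE_path_measure_sum[OF grp cnt supp] by (auto simp: AE_distr_iff[OF bm P])
  qed (rule cnt)
qed

lemma stabilizer_measurable:
  assumes PB: "poisson_boundary G \<mu> X bnd act" and H: "H \<subseteq> carrier G"
  shows "{\<zeta> \<in> space X. boundary_stabilizer G act \<zeta> = H} \<in> sets X"
proof -
  interpret PB: poisson_boundary G \<mu> X bnd act by fact
  have fixed: "{\<zeta> \<in> space X. act g \<zeta> = \<zeta>} \<in> sets X" if g: "g \<in> carrier G" for g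
  proof -
    have id: "(\<lambda>x. x) \<in> borel_measurable X"
      by (subst measurable_cong_sets[OF PB.sets_borel refl]) (rule measurable_restrict_space1, simp)
    have "X \<rightarrow>\<^sub>M X = X \<rightarrow>\<^sub>M restrict_space borel (space X)"
      by (rule measurable_cong_sets[OF refl PB.sets_borel])
    then have "act g \<in> X \<rightarrow>\<^sub>M restrict_space borel (space X)" using PB.act_measurable[OF g] by simp
    then have "act g \<in> borel_measurable X"
      by (simp add: measurable_restrict_space2_iff)
    then show ?thesis using id by (rule borel_measurable_eq)
  qed
  have eq: "{\<zeta> \<in> space X. act g \<zeta> = \<zeta> \<longleftrightarrow> g \<in> H} \<in> sets X" if g: "g \<in> carrier G" for g
    using fixed[OF g] sets.sets_Collect_neg[OF fixed[OF g]] by (cases "g \<in> H") auto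
  have "space X - (\<Union>g\<in>carrier G. space X - {\<zeta> \<in> space X. act g \<zeta> = \<zeta> \<longleftrightarrow> g \<in> H}) \<in> sets X"
    by (intro sets.Diff sets.top sets.countable_UN'' cnt eq)
  moreover have "space X - (\<Union>g\<in>carrier G. space X - {\<zeta> \<in> space X. act g \<zeta> = \<zeta> \<longleftrightarrow> g \<in> H}) =
      {\<zeta> \<in> space X. \<forall>g \<in> carrier G. act g \<zeta> = \<zeta> \<longleftrightarrow> g \<in> H}" by blast
  moreover have "boundary_stabilizer G act \<zeta> = H \<longleftrightarrow> (\<forall>g \<in> carrier G. act g \<zeta> = \<zeta> \<longleftrightarrow> g \<in> H)" for \<zeta>
    using H by (auto simp: boundary_stabilizer_def)
  ultimately show ?thesis by simp
qed

end

text \<open>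
  The set \<open>A w\<close> consists of the paths that ultimately descend from \<open>w\<close>, that is, that converge to
  an end of the forest below \<open>w\<close>.
\<close>

lemma (in group) record_walk_separates:
  fixes Q (structure)
  assumes cnt: "countable (carrier G)" and Q: "switching_sequence Q letters b' e'"
    and hom: "group_hom G Q \<pi>"
    and b: "\<And>m. b m \<in> carrier G" "\<And>m. \<pi> (b m) = b' m"
    and e: "range e = carrier G" "\<And>k. \<pi> (e k) = e' k"
    and z: "z \<in> carrier G" "\<pi> z \<noteq> \<one>\<^bsub>Q\<^esub>"
  defines "A \<equiv> \<lambda>w. {y \<in> space (path_space G).
      eventually (\<lambda>t. switching_sequence.ancestor Q letters b' (\<pi> (y t)) w) sequentially}"
  shows "AE y in path_measure_sum G (record_pmf G b e). \<exists>w \<in> \<pi> ` carrier G. y \<in> A w \<and> left_mult G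
      z y \<notin> A w"
proof -
  interpret S: switching_sequence Q letters b' e' by fact
  interpret h: group_hom G Q \<pi> by fact
  let ?\<mu> = "record_pmf G b e"
  have supp: "set_pmf ?\<mu> \<subseteq> carrier G" using set_record_pmf[OF b(1) e(1)] by simp
  have surj: "\<pi> ` carrier G = carrier Q"
  proof -
    have "\<pi> ` range e = range e'" using e(2) by (auto simp: image_iff)
    then show ?thesis using e(1) S.e_range by simp
  qed
  have As: "A w \<in> sets (path_space G)" for w
    using eventually_exit_set[OF is_group cnt supp, of "\<lambda>a. S.ancestor (\<pi> a) w"]
    by (simp add: A_def exit_sets_def)
  note lm = left_mult_measurable[OF is_group cnt supp z(1)]
  let ?D = "\<Union>w \<in> \<pi> ` carrier G. A w - (left_mult G z -` A w \<inter> space (path_space G))"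
  have "?D \<in> sets (path_space G)"
    using cnt As measurable_sets[OF lm As] by (intro sets.countable_UN'') auto
  moreover have "{y \<in> space (path_space G). \<exists>w \<in> \<pi> ` carrier G. y \<in> A w \<and> left_mult G z y \<notin> A w} = ?D"
    using sets.sets_into_space[OF As] by blast
  ultimately have meas: "{y \<in> space (path_space G). \<exists>w \<in> \<pi> ` carrier G. y \<in> A w \<and> left_mult G z y
      \<notin> A w} \<in> sets (path_space G)"
    by simp
  show ?thesis
    unfolding AE_path_measure_sum[OF is_group cnt supp]
  proof
    fix g assume g: "g \<in> carrier G"
    note wm = walk_measurable[OF is_group cnt supp g]
    have "AE x in increments G ?\<mu>. x \<in> space (path_space G)"
      using AE_space[of "increments G ?\<mu>"] sets_eq_imp_space_eq[OF sets_increments[OF is_group cnt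
          supp]] by simp
    with AE_eventually_record[OF cnt Q hom b e]
    have "AE x in increments G ?\<mu>. \<exists>w \<in> \<pi> ` carrier G. walk G g x \<in> A w \<and> left_mult G z (walk G g
        x) \<notin> A w"
    proof eventually_elim
      case (elim x)
      then have x: "x i \<in> carrier G" for i by (auto simp: space_path_space)
      have walk: "\<pi> (walk G g x t) = walk Q (\<pi> g) (\<lambda>i. \<pi> (x i)) t" "walk G g x t \<in> carrier G" for t
        using h.hom_walk[OF g x] by auto
      obtain w where w: "w \<in> carrier Q"
        "eventually (\<lambda>t. S.ancestor (walk Q (\<pi> g) (\<lambda>i. \<pi> (x i)) t) w) sequentially"
        "\<not> eventually (\<lambda>t. S.ancestor (\<pi> z \<otimes>\<^bsub>Q\<^esub> walk Q (\<pi> g) (\<lambda>i. \<pi> (x i)) t) w) sequentially"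
        using S.records_separate[of "\<lambda>i. \<pi> (x i)" "\<pi> g" "\<pi> z"] x g z elim(1) by auto
      have "walk G g x \<in> A w" using w(2) walk by (simp add: A_def space_path_space)
      moreover have "left_mult G z (walk G g x) \<notin> A w"
        using w(3) walk z(1) by (simp add: A_def left_mult_def)
      ultimately show ?case using w(1) surj by blast
    qed
    then show "AE y in path_measure G ?\<mu> g. \<exists>w \<in> \<pi> ` carrier G. y \<in> A w \<and> left_mult G z y \<notin> A w"
      unfolding path_measure_def using meas by (subst AE_distr_iff[OF wm]) auto
  qed
qed

theorem corollary5p17:
  fixes G :: "('a, 'b) monoid_scheme" (structure)
  assumes "group G"
    and "countable (carrier G)"
  shows "\<exists>\<mu> :: 'a pmf.
           set_pmf \<mu> \<subseteq> carrier G \<and> nondegenerate G \<mu> \<and>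
           symmetric_pmf G \<mu> \<and> finite_entropy G \<mu> \<and>
           (\<forall>X bnd act \<theta>.
              poisson_boundary G \<mu> X bnd act \<and> set_pmf \<theta> = carrier G \<longrightarrow>
              (AE \<zeta> in boundary_measure G \<mu> X bnd \<theta>.
                 boundary_stabilizer G act \<zeta> = hyper_FC_centre G))"
proof -
  interpret group G by fact
  note cnt = assms(2)
  define H where "H = hyper_FC_centre G"
  have H: "H \<lhd> G" "FC_next G H \<subseteq> H" "hyper_FC_centre G = H"
    unfolding H_def by (rule hyper_FC_centre_closed refl)+
  interpret H: normal H G by (rule H(1))
  let ?Q = "G Mod H"
  let ?\<pi> = "\<lambda>g. H #> g"
  have Q: "group ?Q" by (rule H.factorgroup_is_group)
  have hom: "group_hom G ?Q ?\<pi>"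
    using Q H.r_coset_hom_Mod by (simp add: group_hom_def group_hom_axioms_def)
  have ker: "g \<in> H" if "g \<in> carrier G" "?\<pi> g = \<one>\<^bsub>?Q\<^esub>" for g
    using that H.subgroup_axioms coset_join1 by (metis H.subset one_FactGroup)
  define e where "e = from_nat_into (carrier G)"
  have e: "range e = carrier G" unfolding e_def by (rule range_from_nat_into[OF carrier_not_empty cnt])
  have e': "range (\<lambda>k. ?\<pi> (e k)) = carrier ?Q" using e by (simp add: carrier_FactGroup
      image_image[symmetric])
  obtain b where b: "\<And>m. b m \<in> carrier G"
    and sw: "H \<noteq> carrier G \<Longrightarrow> \<exists>letters. switching_sequence ?Q letters (\<lambda>m. ?\<pi> (b m)) (\<lambda>k. ?\<pi> (e k))"
  proof (cases "H = carrier G")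
    case True
    \<comment> \<open>When the quotient is trivial, almost every boundary point is fixed by the whole
      group, and any choice of the elements \<open>b m\<close> will do.\<close>
    then show ?thesis using that[of "\<lambda>_. \<one>"] by simp
  next
    case False
    have "carrier ?Q \<noteq> {\<one>\<^bsub>?Q\<^esub>}" using False ker H.subset by (auto simp: carrier_FactGroup)
    then obtain letters b' where s: "switching_sequence ?Q letters b' (\<lambda>k. ?\<pi> (e k))"
      using group.switching_sequence_exists[OF Q FC_centre_quotient_trivial[OF H(1,2)] _ e'] by blast
    have "b' m \<in> ?\<pi> ` carrier G" for m
      using switching_sequence.b_closed[OF s] by (simp add: carrier_FactGroup)
    then have "\<forall>m. \<exists>x. x \<in> carrier G \<and> b' m = ?\<pi> x" by blast
    then obtain b where b: "\<And>m. b m \<in> carrier G" "\<And>m. b' m = ?\<pi> (b m)" by metis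
    then have "b' = (\<lambda>m. ?\<pi> (b m))" by auto
    then show ?thesis using that[of b] s b(1) by auto
  qed
  define \<mu> where "\<mu> = record_pmf G b e"
  have full: "set_pmf \<mu> = carrier G" unfolding \<mu>_def by (rule set_record_pmf[OF b e])
  then have supp: "set_pmf \<mu> \<subseteq> carrier G" by simp
  have "AE \<zeta> in boundary_measure G \<mu> X bnd \<theta>. boundary_stabilizer G act \<zeta> = hyper_FC_centre G"
    if PB: "poisson_boundary G \<mu> X bnd act" for X bnd act \<theta>
  proof (rule AE_boundary_measureI[OF is_group cnt supp PB])
    show "{\<zeta> \<in> space X. boundary_stabilizer G act \<zeta> = hyper_FC_centre G} \<in> sets X"
      unfolding H(3) by (rule stabilizer_measurable[OF is_group cnt supp PB H.subset])
    have "AE y in path_measure_sum G \<mu>. act g (bnd y) = bnd y \<longleftrightarrow> g \<in> H" if g: "g \<in> carrier G" for g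
    proof (cases "g \<in> H")
      case True
      then show ?thesis
        using boundary_action_trivial[OF is_group cnt supp PB full] H(3) by auto
    next
      case False
      then obtain letters where s: "switching_sequence ?Q letters (\<lambda>m. ?\<pi> (b m)) (\<lambda>k. ?\<pi> (e k))"
        using sw g by blast
      have "?\<pi> g \<noteq> \<one>\<^bsub>?Q\<^esub>" using ker[OF g] False by blast
      from record_walk_separates[OF cnt s hom b refl e refl g this]
      have "AE y in path_measure_sum G \<mu>. act g (bnd y) \<noteq> bnd y"
        unfolding \<mu>_def[symmetric]
        by (rule boundary_action_nontrivial[OF is_group cnt supp PB g, rotated -1])
           (use cnt eventually_exit_set[OF is_group cnt supp] in auto)
      then show ?thesis using False by auto
    qed
    then have "AE y in path_measure_sum G \<mu>. \<forall>g \<in> carrier G. act g (bnd y) = bnd y \<longleftrightarrow> g \<in> H"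
      using cnt by (subst AE_ball_countable) auto
    then show "AE y in path_measure_sum G \<mu>. boundary_stabilizer G act (bnd y) = hyper_FC_centre G"
      unfolding H(3) by eventually_elim (use H.subset in \<open>auto simp: boundary_stabilizer_def\<close>)
  qed
  moreover have "nondegenerate G \<mu>" unfolding \<mu>_def by (rule nondegenerate_record_pmf[OF b e])
  moreover have "symmetric_pmf G \<mu>" unfolding \<mu>_def by (rule symmetric_record_pmf[OF b e])
  moreover have "finite_entropy G \<mu>" unfolding \<mu>_def by (rule finite_entropy_record_pmf)
  ultimately show ?thesis using supp by blast
qed

end
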